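(* Let $\mathbb{K}$ be a field of characteristic $0$, $l>2$ an odd integer, $\epsilon\in\mathbb{K}$ a primitive $l$-th root of unity, and $n$ a positive integer. The discriminant of the specialization $R_\epsilon[M_n]$ of the algebra of square quantum matrices over its central subalgebra $C_\epsilon[M_n]$ is given by $$d(R_\epsilon[M_n]/C_\epsilon[M_n])=_{\mathbb{K}^\times}\prod_{k=1}^n\Delta_{[n-k+1,n];[1,k]}^L\ \prod_{j=1}^{n-1}\Delta_{[1,j];[n-j+1,n]}^L,\qquad L:=l^{n^2-1}(l-1).$$
   Context: $R_q[M_n]$ is the $\mathbb{K}[q^{\pm1}]$-algebra with generators $x_{ij}$, $1\le i,j\le n$, and relations: $x_{ij}x_{kj}=q\,x_{kj}x_{ij}$ for $i<k$; $x_{ij}x_{ir}=q\,x_{ir}x_{ij}$ for $j<r$; $x_{ij}x_{kr}=x_{kr}x_{ij}$ for $i<k,\ j>r$; $x_{ij}x_{kr}-x_{kr}x_{ij}=(q-q^{-1})x_{ir}x_{kj}$ for $i<k,\ j<r$. Set $R_\epsilon[M_n]:=R_q[M_n]/(q-\epsilon)R_q[M_n]$ with projection $\sigma$, and $z_{ij}:=\sigma(x_{ij})^l$. The $z_{ij}$ are central; $C_\epsilon[M_n]$ is the subalgebra generated by them. It is a polynomial algebra over $\mathbb{K}$ in the $z_{ij}$, and $R_\epsilon[M_n]$ is a free $C_\epsilon[M_n]$-module of rank $l^{n^2}$. Here $[i,j]:=\{i,\dots,j\}$, and $\Delta_{I;J}$ denotes the minor of the matrix $(z_{ij})$ with rows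 in $I$ and columns in $J$. Discriminant: if an algebra $S$ is free of rank $N$ over a central subalgebra $C$, the embedding $S\hookrightarrow M_N(C)$ (left multiplication in a $C$-basis) composed with the matrix trace gives $\mathrm{tr}:S\to C$, and $d(S/C):=\det([\mathrm{tr}(y_iy_j)]_{i,j=1}^N)$ for a $C$-basis $\{y_i\}$, well defined up to units of $C$. The notation $a=_{\mathbb{K}^\times}b$ means $a=ub$ with $u\in\mathbb{K}^\times$ (these are the units of $C_\epsilon[M_n]$). *)

theory Defs
  imports
    "HOL-Algebra.Algebra"
    "HOL-Combinatorics.Permutations"
    "HOL-Library.Poly_Mapping"
begin

section \<open>Quantum matrices\<close>

text \<open>Words form a (noncommutative) monoid, written additively so that
  \<open>'a gen_word \<Rightarrow>\<^sub>0 'b\<close>, with the convolution product of finitely supported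
  functions, is the free associative algebra over \<open>'b\<close> on the letters \<open>'a\<close>.\<close>

datatype 'a gen_word = Gen_Word (letters: "'a list")

instantiation gen_word :: (type) monoid_add
begin

definition "0 = Gen_Word []"

definition "u + v = Gen_Word (letters u @ letters v)"

instance
  by standard (simp_all add: zero_gen_word_def plus_gen_word_def)

end

text \<open>The Laurent polynomial ring \<open>\<bbbK>[q, q\<^sup>-\<^sup>1]\<close> is the group ring of the integers:
  \<open>single k c\<close> is \<open>c q\<^sup>k\<close>.\<close>

type_synonym 'k laurent = "int \<Rightarrow>\<^sub>0 'k"

definition q_pow :: "int \<Rightarrow> 'k::comm_ring_1 laurent" where
  "q_pow k = Poly_Mapping.single k 1"

definition laurent_const :: "'k::comm_ring_1 \<Rightarrow> 'k laurent" where
  "laurent_const c = Poly_Mapping.single 0 c"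

type_synonym 'k free_elem = "(nat \<times> nat) gen_word \<Rightarrow>\<^sub>0 'k laurent"

definition free_scalar :: "'k::comm_ring_1 laurent \<Rightarrow> 'k free_elem" where
  "free_scalar a = Poly_Mapping.single 0 a"

definition free_gen :: "nat \<Rightarrow> nat \<Rightarrow> 'k::comm_ring_1 free_elem" where
  "free_gen i j = Poly_Mapping.single (Gen_Word [(i, j)]) 1"

text \<open>The free \<open>\<bbbK>[q, q\<^sup>-\<^sup>1]\<close>-algebra on \<open>x\<^sub>i\<^sub>j\<close> with \<open>1 \<le> i, j \<le> n\<close>.\<close>

definition free_alg :: "nat \<Rightarrow> 'k::comm_ring_1 free_elem ring" where
  "free_alg n =
    \<lparr>carrier = {f. \<forall>w \<in> Poly_Mapping.keys f. set (letters w) \<subseteq> {1..n} \<times> {1..n}},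
     monoid.mult = (*), one = 1, ring.zero = 0, add = (+)\<rparr>"

definition qmat_relations :: "nat \<Rightarrow> 'k::comm_ring_1 free_elem set" where
  "qmat_relations n =
     {free_gen i j * free_gen k j - free_scalar (q_pow 1) * (free_gen k j * free_gen i j) | i j k.
        {i, j, k} \<subseteq> {1..n} \<and> i < k} \<union>
     {free_gen i j * free_gen i r - free_scalar (q_pow 1) * (free_gen i r * free_gen i j) | i j r.
        {i, j, r} \<subseteq> {1..n} \<and> j < r} \<union>
     {free_gen i j * free_gen k r - free_gen k r * free_gen i j | i j k r.
        {i, j, k, r} \<subseteq> {1..n} \<and> i < k \<and> j > r} \<union>
     {free_gen i j * free_gen k r - free_gen k r * free_gen i j
        - free_scalar (q_pow 1 - q_pow (- 1)) * (free_gen i r * free_gen k j) | i j k r.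
        {i, j, k, r} \<subseteq> {1..n} \<and> i < k \<and> j < r}"

definition qmat_ideal :: "nat \<Rightarrow> 'k::comm_ring_1 free_elem set" where
  "qmat_ideal n = Idl\<^bsub>free_alg n\<^esub> (qmat_relations n)"

definition R_q :: "nat \<Rightarrow> 'k::comm_ring_1 free_elem set ring" where
  "R_q n = free_alg n Quot qmat_ideal n"

definition Rq_proj :: "nat \<Rightarrow> 'k::comm_ring_1 free_elem \<Rightarrow> 'k free_elem set" where
  "Rq_proj n f = qmat_ideal n +>\<^bsub>free_alg n\<^esub> f"

text \<open>\<open>(q - \<epsilon>) R\<^sub>q[M\<^sub>n]\<close>, a two-sided ideal because \<open>q\<close> is central.\<close>

definition specialization_ideal :: "nat \<Rightarrow> 'k::comm_ring_1 \<Rightarrow> 'k free_elem set set" where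
  "specialization_ideal n \<epsilon> =
     Rq_proj n (free_scalar (q_pow 1 - laurent_const \<epsilon>)) <#\<^bsub>R_q n\<^esub> carrier (R_q n)"

definition R_eps :: "nat \<Rightarrow> 'k::comm_ring_1 \<Rightarrow> 'k free_elem set set ring" where
  "R_eps n \<epsilon> = R_q n Quot specialization_ideal n \<epsilon>"

definition sigma_proj :: "nat \<Rightarrow> 'k::comm_ring_1 \<Rightarrow> 'k free_elem set \<Rightarrow> 'k free_elem set set" where
  "sigma_proj n \<epsilon> r = specialization_ideal n \<epsilon> +>\<^bsub>R_q n\<^esub> r"

text \<open>The structure map \<open>\<bbbK> \<rightarrow> R\<^sub>\<epsilon>[M\<^sub>n]\<close> of the \<open>\<bbbK>\<close>-algebra \<open>R\<^sub>\<epsilon>[M\<^sub>n]\<close>.\<close>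

definition eps_scalar :: "nat \<Rightarrow> 'k::comm_ring_1 \<Rightarrow> 'k \<Rightarrow> 'k free_elem set set" where
  "eps_scalar n \<epsilon> c = sigma_proj n \<epsilon> (Rq_proj n (free_scalar (laurent_const c)))"

definition z_gen :: "nat \<Rightarrow> nat \<Rightarrow> 'k::comm_ring_1 \<Rightarrow> nat \<Rightarrow> nat \<Rightarrow> 'k free_elem set set" where
  "z_gen n l \<epsilon> i j = sigma_proj n \<epsilon> (Rq_proj n (free_gen i j)) [^]\<^bsub>R_eps n \<epsilon>\<^esub> l"

text \<open>The \<open>\<bbbK>\<close>-subalgebra generated by the \<open>z\<^sub>i\<^sub>j\<close> is the subring generated by them together
  with the scalars.\<close>

definition C_eps :: "nat \<Rightarrow> nat \<Rightarrow> 'k::comm_ring_1 \<Rightarrow> 'k free_elem set set set" where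
  "C_eps n l \<epsilon> = generate_ring (R_eps n \<epsilon>)
     (range (eps_scalar n \<epsilon>) \<union> {z_gen n l \<epsilon> i j | i j. i \<in> {1..n} \<and> j \<in> {1..n}})"

abbreviation C_eps_ring :: "nat \<Rightarrow> nat \<Rightarrow> 'k::comm_ring_1 \<Rightarrow> 'k free_elem set set ring" where
  "C_eps_ring n l \<epsilon> \<equiv> (R_eps n \<epsilon>)\<lparr>carrier := C_eps n l \<epsilon>\<rparr>"


section \<open>Determinants and minors over a commutative ring with carrier\<close>

definition ring_det :: "('a, 'm) ring_scheme \<Rightarrow> nat set \<Rightarrow> (nat \<Rightarrow> nat \<Rightarrow> 'a) \<Rightarrow> 'a" where
  "ring_det A I M =
     (\<Oplus>\<^bsub>A\<^esub>p \<in> {p. p permutes I}. [sign p] \<cdot>\<^bsub>A\<^esub> (\<Otimes>\<^bsub>A\<^esub>i \<in> I. M i (p i)))"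

text \<open>Rows and columns are listed in increasing order; meaningful for finite \<open>I\<close> and \<open>J\<close> of equal
  cardinality.\<close>

definition ring_minor ::
    "('a, 'm) ring_scheme \<Rightarrow> (nat \<Rightarrow> nat \<Rightarrow> 'a) \<Rightarrow> nat set \<Rightarrow> nat set \<Rightarrow> 'a" where
  "ring_minor A M I J =
     ring_det A {..<card I} (\<lambda>a b. M (sorted_list_of_set I ! a) (sorted_list_of_set J ! b))"


section \<open>Discriminants\<close>

text \<open>Below, \<open>S\<close> is a ring and \<open>C\<close> the carrier of a central subring of \<open>S\<close>.\<close>

definition is_basis :: "('a, 'm) ring_scheme \<Rightarrow> 'a set \<Rightarrow> nat \<Rightarrow> (nat \<Rightarrow> 'a) \<Rightarrow> bool" where
  "is_basis S C N y \<longleftrightarrow>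
     y \<in> {1..N} \<rightarrow> carrier S \<and>
     (\<forall>s \<in> carrier S. \<exists>!c. c \<in> {1..N} \<rightarrow>\<^sub>E C \<and> s = (\<Oplus>\<^bsub>S\<^esub>i \<in> {1..N}. c i \<otimes>\<^bsub>S\<^esub> y i))"

definition basis_coords ::
    "('a, 'm) ring_scheme \<Rightarrow> 'a set \<Rightarrow> nat \<Rightarrow> (nat \<Rightarrow> 'a) \<Rightarrow> 'a \<Rightarrow> nat \<Rightarrow> 'a" where
  "basis_coords S C N y s =
     (THE c. c \<in> {1..N} \<rightarrow>\<^sub>E C \<and> s = (\<Oplus>\<^bsub>S\<^esub>i \<in> {1..N}. c i \<otimes>\<^bsub>S\<^esub> y i))"

definition left_mult_matrix ::
    "('a, 'm) ring_scheme \<Rightarrow> 'a set \<Rightarrow> nat \<Rightarrow> (nat \<Rightarrow> 'a) \<Rightarrow> 'a \<Rightarrow> nat \<Rightarrow> nat \<Rightarrow> 'a" where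
  "left_mult_matrix S C N b s i j = basis_coords S C N b (s \<otimes>\<^bsub>S\<^esub> b j) i"

definition regular_trace ::
    "('a, 'm) ring_scheme \<Rightarrow> 'a set \<Rightarrow> nat \<Rightarrow> (nat \<Rightarrow> 'a) \<Rightarrow> 'a \<Rightarrow> 'a" where
  "regular_trace S C N b s = (\<Oplus>\<^bsub>S\<lparr>carrier := C\<rparr>\<^esub>i \<in> {1..N}. left_mult_matrix S C N b s i i)"

text \<open>The basis \<open>b\<close> is used for the trace, the basis \<open>y\<close> for the Gram matrix.\<close>

definition discriminant ::
    "('a, 'm) ring_scheme \<Rightarrow> 'a set \<Rightarrow> nat \<Rightarrow> (nat \<Rightarrow> 'a) \<Rightarrow> (nat \<Rightarrow> 'a) \<Rightarrow> 'a" where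
  "discriminant S C N b y =
     ring_det (S\<lparr>carrier := C\<rparr>) {1..N} (\<lambda>i j. regular_trace S C N b (y i \<otimes>\<^bsub>S\<^esub> y j))"

end

theory Submission
  imports Defs "Jordan_Normal_Form.Determinant" "HOL-Library.Product_Lexorder"
begin

text \<open>
  The generators are realised inside a quantum torus with generators \<open>t\<^sub>i\<^sub>j\<close>, acting on its own
  underlying space of Laurent polynomials, so that \<open>x\<^sub>i\<^sub>j\<close> is \<open>t\<^sub>i\<^sub>j\<close> plus terms in
  lexicographically later variables (Cauchon's restoration). By this triangularity ordered monomials
  stay independent, so the realisation is faithful and the monomials with exponents below \<open>l\<close> form a
  basis over the centre of the torus whose transition matrix to the torus monomials is unitriangular.
  Hence the discriminant equals that of the torus, namely
  \<open>\<Prod> t\<^sub>i\<^sub>j\<close> raised to the power \<open>l L\<close>, up to scalars: a change of basis contributes only a unit of the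
  central subalgebra, and such units are scalars because the \<open>z\<^sub>i\<^sub>j\<close> have positive degree.
  Finally, \<open>l\<close>-th powers turn the quantum restoration into the same recursion for commuting variables,
  and there each of the corner minors in the formula is the product of the \<open>t\<^sub>i\<^sub>j\<^sup>l\<close> along its
  diagonal. These diagonals partition the matrix.
\<close>

\<comment> \<open>In the Laurent polynomial ring every \<open>t_ij^l\<close> is a unit, so a
  discriminant known only up to units there would say nothing. Hence determinants are kept exact:
  passing from ordered monomials to torus monomials has determinant 1, and units are discarded only
  inside \<open>C_eps\<close>, where they are scalars. Coordinates are taken over the Laurent
  polynomials in the \<open>t_ij^l\<close>. The centre of the torus can be larger, but over this
  central subring the torus is free on the exponents in \<open>[0, l)\<close>, and the trace of a
  monomial is zero or \<open>l^(n^2)\<close> times that monomial. Pairing \<open>a\<close> with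
  \<open>-a\<close> modulo \<open>l\<close> makes the Gram matrix monomial. Its exponents add up to
  twice the sum of all box exponents, which is \<open>l^(n^2) (l - 1) = l L\<close> in each
  coordinate. Characteristic 0 keeps the factor \<open>l^(n^2)\<close> nonzero. Freeness is proved
  along the way: straightening gives spanning, leading terms in the torus give independence. Linear
  operators are convenient because they form a ring at once, and applying one to 1 reads off its
  coordinates.\<close>
alias keys = Poly_Mapping.keys
alias lookup = Poly_Mapping.lookup
alias single = Poly_Mapping.single


section \<open>Linear operators on Laurent polynomials\<close>

type_synonym expo = "nat \<times> nat \<Rightarrow>\<^sub>0 int"
type_synonym 'k lau = "expo \<Rightarrow>\<^sub>0 'k"

text \<open>Scalars enter as multiplication by the constants \<open>single 0 c\<close>, so linearity
  is expressed inside the ring of Laurent polynomials, without a separate module structure.\<close>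

typedef (overloaded) 'k linop =
  "{f :: 'k::comm_ring_1 lau \<Rightarrow> 'k lau. (\<forall>u v. f (u + v) = f u + f v) \<and>
      (\<forall>c u. f (single 0 c * u) = single 0 c * f u)}"
  morphisms app Linop
  by (rule exI[of _ "\<lambda>u. u"]) auto

setup_lifting type_definition_linop

lemma app_add [simp]: "app f (u + v) = app f u + app f v"
  using app[of f] by auto

lemma app_scalar [simp]: "app f (single 0 c * u) = single 0 c * app f u"
  using app[of f] by auto

lemma app_zero [simp]: "app f 0 = 0"
  using app_add[of f 0 0] by simp

lemma app_sum: "app f (\<Sum>x\<in>A. g x) = (\<Sum>x\<in>A. app f (g x))"
  by (induction A rule: infinite_finite_induct) auto

instantiation linop :: (comm_ring_1) ring_1
begin

lift_definition zero_linop :: "'a linop" is "\<lambda>_. 0" by simp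
lift_definition one_linop :: "'a linop" is "\<lambda>u. u" by simp
lift_definition plus_linop :: "'a linop \<Rightarrow> 'a linop \<Rightarrow> 'a linop" is "\<lambda>f g u. f u + g u"
  by (auto simp: algebra_simps)
lift_definition minus_linop :: "'a linop \<Rightarrow> 'a linop \<Rightarrow> 'a linop" is "\<lambda>f g u. f u - g u"
  by (auto simp: algebra_simps)
lift_definition uminus_linop :: "'a linop \<Rightarrow> 'a linop" is "\<lambda>f u. - f u"
  by (auto simp: algebra_simps)
lift_definition times_linop :: "'a linop \<Rightarrow> 'a linop \<Rightarrow> 'a linop" is "\<lambda>f g u. f (g u)"
  by auto

instance
proof
  show "(0::'a linop) \<noteq> 1"
    by transfer (metis zero_neq_one)
qed (transfer; simp add: algebra_simps fun_eq_iff; fail)+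

end

lemma app_plus [simp]: "app (f + g) u = app f u + app g u"
  by transfer simp
lemma app_minus [simp]: "app (f - g) u = app f u - app g u"
  by transfer simp
lemma app_uminus [simp]: "app (- f) u = - app f u"
  by transfer simp
lemma app_times [simp]: "app (f * g) u = app f (app g u)"
  by transfer simp
lemma app_0 [simp]: "app 0 u = 0"
  by transfer simp
lemma app_1 [simp]: "app 1 u = u"
  by transfer simp
lemma app_sum_op: "app (\<Sum>x\<in>A. f x) u = (\<Sum>x\<in>A. app (f x) u)"
  by (induction A rule: infinite_finite_induct) auto

lemma linop_eqI: "(\<And>u. app f u = app g u) \<Longrightarrow> f = g"
  by transfer auto

lemma poly_mapping_as_sum:
  "u = (\<Sum>b\<in>keys u. single b (lookup u b))"
proof (rule poly_mapping_eqI)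
  fix k
  have "lookup (\<Sum>b\<in>keys u. single b (lookup u b)) k
      = (\<Sum>b\<in>keys u. if b = k then lookup u b else 0)"
    unfolding lookup_sum by (rule sum.cong) (auto simp: lookup_single when_def)
  then show "lookup u k =
      lookup (\<Sum>b\<in>keys u. single b (lookup u b)) k"
    by (simp add: in_keys_iff)
qed

lemma linop_eqI_single:
  fixes f g :: "'k::comm_ring_1 linop"
  assumes "\<And>b. app f (single b 1) = app g (single b 1)"
  shows "f = g"
proof (rule linop_eqI)
  fix u
  have "app h u = (\<Sum>b\<in>keys u. single 0 (lookup u b) *
      app h (single b 1))" for h :: "'k linop"
  proof -
    have "app h u = app h (\<Sum>b\<in>keys u. single b (lookup u b))"
      using poly_mapping_as_sum[of u] by simp
    also have "\<dots> = (\<Sum>b\<in>keys u.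
        app h (single 0 (lookup u b) * single b 1))"
      by (simp add: app_sum mult_single)
    finally show ?thesis by simp
  qed
  then show "app f u = app g u" using assms by simp
qed

definition mulop :: "'k::comm_ring_1 lau \<Rightarrow> 'k linop" where
  "mulop g = Linop (\<lambda>u. g * u)"

lemma app_mulop [simp]: "app (mulop g) u = g * u"
  unfolding mulop_def by (subst Linop_inverse) (auto simp: algebra_simps)

lemma mulop_0 [simp]: "mulop 0 = 0" and mulop_1 [simp]: "mulop 1 = 1"
  and mulop_add: "mulop (g + h) = mulop g + mulop h"
  and mulop_mult: "mulop (g * h) = mulop g * mulop h"
  and mulop_uminus: "mulop (- g) = - mulop g"
  by (rule linop_eqI; simp add: algebra_simps)+

lemma mulop_commute: "mulop g * mulop h = mulop h * mulop g"
  by (rule linop_eqI; simp add: algebra_simps)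

lemma mulop_sum: "mulop (\<Sum>x\<in>A. g x) = (\<Sum>x\<in>A. mulop (g x))"
  by (induction A rule: infinite_finite_induct) (auto simp: mulop_add)

lemma mulop_power: "mulop (g ^ k) = mulop g ^ k"
  by (induction k) (auto simp: mulop_mult)

definition scal :: "'k::comm_ring_1 \<Rightarrow> 'k linop" where
  "scal c = mulop (single 0 c)"

lemma app_scal [simp]: "app (scal c) u = single 0 c * u"
  by (simp add: scal_def)

lemma scal_0 [simp]: "scal 0 = 0" and scal_1 [simp]: "scal 1 = 1"
  by (simp_all add: scal_def)

lemma scal_add: "scal (c + d) = scal c + scal d"
  by (simp add: scal_def single_add mulop_add)

lemma scal_mult: "scal (c * d) = scal c * scal d"
  by (simp add: scal_def mulop_mult[symmetric] mult_single)

lemma scal_uminus: "scal (- c) = - scal c"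
  by (simp add: scal_def single_uminus mulop_uminus)

lemma scal_diff: "scal (c - d) = scal c - scal d"
  using scal_add[of c "-d"] by (simp add: scal_uminus)

lemma scal_commute: "f * scal c = scal c * f"
  by (rule linop_eqI) simp

lemma scal_left_commute: "f * (scal c * g) = scal c * (f * g)"
  by (simp only: mult.assoc[symmetric] scal_commute)

lemma scal_scal: "scal c * (scal d * f) = scal (c * d) * f"
  by (simp add: scal_mult mult.assoc)

definition monom_ext :: "(expo \<Rightarrow> 'k::comm_ring_1 lau) \<Rightarrow> 'k linop" where
  "monom_ext h = Linop (\<lambda>u. \<Sum>b\<in>keys u. single 0 (lookup u b) * h b)"

lemma app_monom_ext:
  fixes h :: "expo \<Rightarrow> 'k::comm_ring_1 lau"
  shows "app (monom_ext h) u = (\<Sum>b\<in>keys u. single 0 (lookup u b) * h b)"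
  unfolding monom_ext_def
proof (subst Linop_inverse, intro CollectI conjI allI)
  fix v w :: "'k lau" and c :: 'k
  show "(\<Sum>b\<in>keys (v + w). single 0 (lookup (v + w) b) * h b) =
     (\<Sum>b\<in>keys v. single 0 (lookup v b) * h b) +
     (\<Sum>b\<in>keys w. single 0 (lookup w b) * h b)"
    by (rule setsum_keys_plus_distrib) (auto simp: single_add algebra_simps)
  have lk: "lookup (single 0 c * v) b = c * lookup v b" for b
    by (simp flip: mult_map_scale_conv_mult add: map.rep_eq when_def)
  have "(\<Sum>b\<in>keys (single 0 c * v).
        single 0 (lookup (single 0 c * v) b) * h b) =
      (\<Sum>b\<in>keys v. single 0 (c * lookup v b) * h b)"
    by (rule sum.mono_neutral_cong_left) (auto simp: lk in_keys_iff)
  also have "\<dots> = single 0 c *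
      (\<Sum>b\<in>keys v. single 0 (lookup v b) * h b)"
    by (simp add: sum_distrib_left mult.assoc[symmetric] mult_single)
  finally show "(\<Sum>b\<in>keys (single 0 c * v).
        single 0 (lookup (single 0 c * v) b) * h b) =
     single 0 c *
      (\<Sum>b\<in>keys v. single 0 (lookup v b) * h b)" .
qed simp

lemma app_monom_ext_single [simp]:
  "app (monom_ext h) (single b c) = single 0 c * h b"
  by (cases "c = 0"; simp add: app_monom_ext)

section \<open>The quantum torus\<close>

locale qtorus =
  fixes n l :: nat and \<epsilon> :: "'k::field_char_0"
  assumes l_gt: "l > 2" and l_odd: "odd l" and eps_l: "\<epsilon> ^ l = 1"
    and eps_prim: "\<And>k. 0 < k \<Longrightarrow> k < l \<Longrightarrow> \<epsilon> ^ k \<noteq> 1" and n_pos: "n > 0"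
begin

lemma eps_nz [simp]: "\<epsilon> \<noteq> 0"
  using eps_l l_gt by (auto simp: power_0_left)

definition idx :: "(nat \<times> nat) set" where "idx = {1..n} \<times> {1..n}"

lemma finite_idx [simp]: "finite idx"
  by (simp add: idx_def)

text \<open>Commutation depends only on the antisymmetrised values:
  \<open>t_k t_k' = \<epsilon> t_k' t_k\<close> when \<open>k < k'\<close> share a row or a column,
  and all other pairs commute. These are the relations of quantum matrices with the correction term
  removed.\<close>

definition cocyc :: "nat \<times> nat \<Rightarrow> nat \<times> nat \<Rightarrow> int" where
  "cocyc k k' = (if k' < k \<and> (fst k = fst k' \<or> snd k = snd k') then - 1 else 0)"

definition \<beta> :: "expo \<Rightarrow> expo \<Rightarrow> int" where
  "\<beta> a b = (\<Sum>k\<in>idx. \<Sum>k'\<in>idx. cocyc k k' * lookup a k * lookup b k')"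

lemma \<beta>_add_left: "\<beta> (a + a') b = \<beta> a b + \<beta> a' b"
  and \<beta>_add_right: "\<beta> a (b + b') = \<beta> a b + \<beta> a b'"
  by (simp_all add: \<beta>_def lookup_add algebra_simps sum.distrib)

lemma \<beta>_0_left [simp]: "\<beta> 0 b = 0" and \<beta>_0_right [simp]: "\<beta> a 0 = 0"
  by (simp_all add: \<beta>_def)

lemma \<beta>_single:
  assumes "k \<in> idx" "k' \<in> idx"
  shows "\<beta> (single k x) (single k' y) = cocyc k k' * x * y"
proof -
  have "\<beta> (single k x) (single k' y) =
      (\<Sum>j\<in>idx. \<Sum>j'\<in>idx. if j' = k' then if j = k then cocyc k k' * x * y else 0 else 0)"
    unfolding \<beta>_def by (intro sum.cong refl) (auto simp: lookup_single when_def)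
  then show ?thesis using assms by simp
qed

text \<open>The cocycle is normalised so that products of generators in increasing lexicographic order
  carry no power of \<open>\<epsilon>\<close>.\<close>

definition tm :: "expo \<Rightarrow> 'k linop" where
  "tm a = monom_ext (\<lambda>b. single (a + b) (\<epsilon> powi \<beta> a b))"

lemma app_tm [simp]:
  "app (tm a) (single b c) = single (a + b) (c * \<epsilon> powi \<beta> a b)"
  by (simp add: tm_def mult_single)

lemma tm_0 [simp]: "tm 0 = 1"
  by (rule linop_eqI_single) simp

text \<open>On a monomial with exponent \<open>c\<close> both sides pick up the power
  \<open>\<beta> a b + \<beta> a c + \<beta> b c\<close> of \<epsilon>, by additivity of \<beta> in
  each argument.\<close>

lemma tm_mult: "tm a * tm b = scal (\<epsilon> powi \<beta> a b) * tm (a + b)"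
  by (rule linop_eqI_single)
    (simp add: mult_single \<beta>_add_left \<beta>_add_right power_int_add algebra_simps)

section \<open>Commutation up to powers of \<epsilon>\<close>

definition qc :: "int \<Rightarrow> 'k linop \<Rightarrow> 'k linop \<Rightarrow> bool" where
  "qc k f g \<longleftrightarrow> f * g = scal (\<epsilon> powi k) * (g * f)"

lemma qc_sym: "qc k f g \<Longrightarrow> qc (- k) g f"
  by (simp add: qc_def scal_scal power_int_minus)

lemma qc_mult_right: "qc k f g \<Longrightarrow> qc m f h \<Longrightarrow> qc (k + m) f (g * h)"
proof -
  assume a: "qc k f g" "qc m f h"
  have "f * (g * h) = (f * g) * h" by (simp add: mult.assoc)
  also have "\<dots> = scal (\<epsilon> powi k) * (g * (f * h))"
    using a by (simp add: qc_def mult.assoc)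
  also have "\<dots> = scal (\<epsilon> powi k) * (scal (\<epsilon> powi m) * (g * h * f))"
    using a by (simp add: qc_def mult.assoc scal_left_commute[of g])
  finally show ?thesis by (simp add: qc_def scal_scal power_int_add)
qed

lemma qc_mult_left: "qc k f h \<Longrightarrow> qc m g h \<Longrightarrow> qc (k + m) (f * g) h"
proof -
  assume "qc k f h" "qc m g h"
  then have "qc (- k + - m) h (f * g)" by (intro qc_mult_right qc_sym)
  from qc_sym[OF this] show ?thesis by (simp add: algebra_simps)
qed

lemma qc_0_iff: "qc 0 f g \<longleftrightarrow> f * g = g * f"
  by (simp add: qc_def)

lemma qc_zero_right: "qc k f 0" and qc_zero_left: "qc k 0 f"
  by (simp_all add: qc_def)

lemma qc_add_right: "qc k f g \<Longrightarrow> qc k f h \<Longrightarrow> qc k f (g + h)"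
  by (simp add: qc_def distrib_left distrib_right)

lemma qc_add_left: "qc k f h \<Longrightarrow> qc k g h \<Longrightarrow> qc k (f + g) h"
  by (simp add: qc_def distrib_left distrib_right)

lemma qc_sum_right: "(\<And>x. x \<in> A \<Longrightarrow> qc k f (g x)) \<Longrightarrow> qc k f (\<Sum>x\<in>A. g x)"
  by (induction A rule: infinite_finite_induct) (auto simp: qc_zero_right intro!: qc_add_right)

lemma qc_sum_left: "(\<And>x. x \<in> A \<Longrightarrow> qc k (g x) f) \<Longrightarrow> qc k (\<Sum>x\<in>A. g x) f"
  by (induction A rule: infinite_finite_induct) (auto simp: qc_zero_left intro!: qc_add_left)

lemma qc_tm: "qc (\<beta> a b - \<beta> b a) (tm a) (tm b)"
  by (simp add: qc_def tm_mult scal_scal power_int_diff add.commute[of b a])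

definition tg :: "nat \<times> nat \<Rightarrow> 'k linop" where "tg k = tm (single k 1)"
definition tinv :: "nat \<times> nat \<Rightarrow> 'k linop" where "tinv k = tm (single k (- 1))"

lemma cocyc_same [simp]: "cocyc k k = 0"
  by (simp add: cocyc_def)

lemma tg_tinv: "k \<in> idx \<Longrightarrow> tg k * tinv k = 1" and tinv_tg: "k \<in> idx \<Longrightarrow> tinv k * tg k = 1"
  by (simp_all add: tg_def tinv_def tm_mult \<beta>_single single_add[symmetric])

lemma qc_tg_tg: "k \<in> idx \<Longrightarrow> k' \<in> idx \<Longrightarrow> qc (cocyc k k' - cocyc k' k) (tg k) (tg k')"
  using qc_tm[of "single k 1" "single k' 1"] by (simp add: \<beta>_single tg_def)

lemma qc_inv_right:
  assumes "qc k f g" "g * g' = 1" "g' * g = 1"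
  shows "qc (- k) f g'"
proof -
  have "qc (- k) g f" using assms by (simp add: qc_sym)
  then have "g * f = scal (\<epsilon> powi (- k)) * (f * g)" by (simp add: qc_def)
  then have "g' * (g * f) * g' = g' * (scal (\<epsilon> powi (- k)) * (f * g)) * g'" by simp
  also have "\<dots> = scal (\<epsilon> powi (- k)) * (g' * (f * (g * g')))"
    by (simp only: mult.assoc scal_left_commute[of g'])
  also have "g' * (g * f) * g' = f * g'" using assms by (simp add: mult.assoc[symmetric])
  finally show ?thesis using assms by (simp add: qc_def)
qed

text \<open>Exponents of either sign occur, so this is the subtorus on the variables in
  \<open>A\<close>. Adding one term at a time lets linear statements be proved on the monomials
  \<open>tm a\<close> alone.\<close>

inductive_set Tspan :: "(nat \<times> nat) set \<Rightarrow> 'k linop set" for A where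
  Tspan_0: "0 \<in> Tspan A"
| Tspan_step: "keys a \<subseteq> A \<Longrightarrow> f \<in> Tspan A \<Longrightarrow> scal c * tm a + f \<in> Tspan A"

lemma Tspan_mono: "f \<in> Tspan A \<Longrightarrow> A \<subseteq> B \<Longrightarrow> f \<in> Tspan B"
  by (induction rule: Tspan.induct) (auto intro: Tspan.intros)

lemma Tspan_tm: "keys a \<subseteq> A \<Longrightarrow> scal c * tm a \<in> Tspan A"
  using Tspan_step[OF _ Tspan_0, of a A c] by simp

lemma Tspan_add: "f \<in> Tspan A \<Longrightarrow> g \<in> Tspan A \<Longrightarrow> f + g \<in> Tspan A"
  by (induction rule: Tspan.induct) (auto simp: add.assoc intro: Tspan.intros)

lemma Tspan_scal: "f \<in> Tspan A \<Longrightarrow> scal c * f \<in> Tspan A"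
  by (induction rule: Tspan.induct) (auto simp: distrib_left scal_scal intro: Tspan.intros)

lemma Tspan_tm_mult:
  assumes "keys a \<subseteq> A" "f \<in> Tspan A"
  shows "tm a * f \<in> Tspan A"
  using assms(2)
proof (induction rule: Tspan.induct)
  case (Tspan_step b f c)
  have "keys (a + b) \<subseteq> A" using Poly_Mapping.keys_add[of a b] assms Tspan_step by blast
  then have "tm a * (scal c * tm b) \<in> Tspan A"
    by (simp add: scal_left_commute[of "tm a"] tm_mult scal_scal Tspan_tm)
  then show ?case using Tspan_step by (simp add: distrib_left Tspan_add)
qed (simp add: Tspan_0)

lemma Tspan_mult: "f \<in> Tspan A \<Longrightarrow> g \<in> Tspan A \<Longrightarrow> f * g \<in> Tspan A"
  by (induction rule: Tspan.induct)
    (auto simp: distrib_right mult.assoc Tspan_0 intro!: Tspan_add Tspan_scal Tspan_tm_mult)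

lemma Tspan_sum: "(\<And>x. x \<in> B \<Longrightarrow> g x \<in> Tspan A) \<Longrightarrow> (\<Sum>x\<in>B. g x) \<in> Tspan A"
  by (induction B rule: infinite_finite_induct) (auto intro: Tspan_add Tspan_0)

lemma Tspan_1: "1 \<in> Tspan A"
  using Tspan_tm[of 0 A 1] by simp

lemma Tspan_tg: "k \<in> A \<Longrightarrow> tg k \<in> Tspan A" and Tspan_tinv: "k \<in> A \<Longrightarrow> tinv k \<in> Tspan A"
  using Tspan_tm[of _ A 1] by (simp_all add: tg_def tinv_def)


section \<open>Row-by-row restoration of the generators\<close>

lemma qcD: "qc k f g \<Longrightarrow> f * g = scal (\<epsilon> powi k) * (g * f)"
  by (simp add: qc_def)

lemma qcD2: "qc k f g \<Longrightarrow> f * (g * h) = scal (\<epsilon> powi k) * (g * (f * h))"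
  by (simp only: qc_def mult.assoc[symmetric])

lemma scal_merge: "scal c * f + scal d * f = scal (c + d) * f"
  by (simp add: scal_add distrib_right)

text \<open>\<open>xg m\<close> is the matrix of generators for the first \<open>m\<close> rows. Adding a row \<open>t\<close> replaces
  \<open>x\<^sub>i\<^sub>j\<close> by \<open>\<Sum>\<^sub>s\<^sub>\<ge>\<^sub>j x\<^sub>i\<^sub>s t\<^sub>s\<^sup>-\<^sup>1 t\<^sub>j\<close>, which performs all of Cauchon's restoration steps
  with pivots in that row at once.\<close>

fun xg :: "nat \<Rightarrow> nat \<Rightarrow> nat \<Rightarrow> 'k linop" where
  "xg 0 i j = 0"
| "xg (Suc m) i j = (if i = Suc m then tg (Suc m, j)
     else (\<Sum>s\<in>{j..n}. xg m i s * tinv (Suc m, s)) * tg (Suc m, j))"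

lemma idx_iff: "(i, j) \<in> idx \<longleftrightarrow> 1 \<le> i \<and> i \<le> n \<and> 1 \<le> j \<and> j \<le> n"
  by (auto simp: idx_def)

lemma qc_inv_tg_right: "k \<in> idx \<Longrightarrow> qc x f (tg k) \<Longrightarrow> qc (- x) f (tinv k)"
  by (rule qc_inv_right[OF _ tg_tinv tinv_tg])

lemma qc_tinv_tg:
  "k \<in> idx \<Longrightarrow> k' \<in> idx \<Longrightarrow> qc (cocyc k' k - cocyc k k') (tinv k) (tg k')"
  using qc_sym[OF qc_inv_tg_right[OF _ qc_tg_tg[of k' k]]] by simp

text \<open>In each summand \<open>x_iu t_u^-1\<close> the contributions of column \<open>u\<close>
  cancel. Hence an entry of column \<open>s\<close> passes a variable of a later row exactly as the
  final factor \<open>t_s\<close> does.\<close>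

lemma qc_xg_tg:
  assumes "i \<in> {1..m}" "m < m'" "m' \<le> n" "s \<in> {1..n}" "r \<in> {1..n}"
  shows "qc (if s = r then 1 else 0) (xg m i s) (tg (m', r))"
  using assms
proof (induction m arbitrary: i s)
  case (Suc m)
  show ?case
  proof (cases "i = Suc m")
    case True
    have "qc (cocyc (Suc m, s) (m', r) - cocyc (m', r) (Suc m, s)) (tg (Suc m, s)) (tg (m', r))"
      by (rule qc_tg_tg) (use Suc in \<open>auto simp: idx_iff\<close>)
    then show ?thesis using True Suc by (auto simp: cocyc_def)
  next
    case False
    have "qc 0 (xg m i u * tinv (Suc m, u)) (tg (m', r))" if "u \<in> {s..n}" for u
    proof -
      have "qc (if u = r then 1 else 0) (xg m i u) (tg (m', r))"
        by (rule Suc.IH) (use that Suc False in auto)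
      moreover have "qc (cocyc (m', r) (Suc m, u) - cocyc (Suc m, u) (m', r))
          (tinv (Suc m, u)) (tg (m', r))"
        by (rule qc_tinv_tg) (use Suc that in \<open>auto simp: idx_iff\<close>)
      ultimately have "qc ((if u = r then 1 else 0) +
          (cocyc (m', r) (Suc m, u) - cocyc (Suc m, u) (m', r)))
          (xg m i u * tinv (Suc m, u)) (tg (m', r))"
        by (rule qc_mult_left)
      then show ?thesis using Suc by (auto simp: cocyc_def split: if_splits)
    qed
    then have "qc 0 (\<Sum>u\<in>{s..n}. xg m i u * tinv (Suc m, u)) (tg (m', r))"
      by (rule qc_sum_left)
    moreover have "qc (cocyc (Suc m, s) (m', r) - cocyc (m', r) (Suc m, s)) (tg (Suc m, s)) (tg (m', r))"
      by (rule qc_tg_tg) (use Suc in \<open>auto simp: idx_iff\<close>)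
    ultimately have "qc (0 + (cocyc (Suc m, s) (m', r) - cocyc (m', r) (Suc m, s)))
       ((\<Sum>u\<in>{s..n}. xg m i u * tinv (Suc m, u)) * tg (Suc m, s)) (tg (m', r))"
      by (rule qc_mult_left)
    then show ?thesis using False Suc by (auto simp: cocyc_def split: if_splits)
  qed
qed auto

text \<open>Restricted to the first \<open>m\<close> rows, so that the relations can be established
  by adding one row at a time.\<close>

definition qmat :: "nat \<Rightarrow> (nat \<Rightarrow> nat \<Rightarrow> 'k linop) \<Rightarrow> bool" where
  "qmat m x \<longleftrightarrow>
    (\<forall>i j k. i \<in> {1..m} \<longrightarrow> k \<in> {1..m} \<longrightarrow> j \<in> {1..n} \<longrightarrow> i < k \<longrightarrow> qc 1 (x i j) (x k j)) \<and>
    (\<forall>i j r. i \<in> {1..m} \<longrightarrow> j \<in> {1..n} \<longrightarrow> r \<in> {1..n} \<longrightarrow> j < r \<longrightarrow> qc 1 (x i j) (x i r)) \<and>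
    (\<forall>i j k r. i \<in> {1..m} \<longrightarrow> k \<in> {1..m} \<longrightarrow> j \<in> {1..n} \<longrightarrow> r \<in> {1..n} \<longrightarrow> i < k \<longrightarrow> r < j \<longrightarrow>
       qc 0 (x i j) (x k r)) \<and>
    (\<forall>i j k r. i \<in> {1..m} \<longrightarrow> k \<in> {1..m} \<longrightarrow> j \<in> {1..n} \<longrightarrow> r \<in> {1..n} \<longrightarrow> i < k \<longrightarrow> j < r \<longrightarrow>
       x i j * x k r - x k r * x i j = scal (\<epsilon> - inverse \<epsilon>) * (x i r * x k j))"

text \<open>Here \<open>Y1 + y\<close> and \<open>V1 + v\<close> are the partial sums of two rows from column \<open>j\<close> on, split at
  column \<open>r\<close>; \<open>tj\<close> and \<open>tr\<close> are the entries of the new row.\<close>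

lemma two_row_step:
  assumes "qc (- 1) tj y" "qc (- 1) tj v" "qc 1 tj tr" "qc 1 tr Y1" "qc 1 tr V1"
    "qc (- 1) tr y" "qc (- 1) tr v" "qc (- 1) y V1" "qc 1 y v"
    and Y1v: "Y1 * v = scal \<epsilon> * (v * Y1) + scal (\<epsilon>\<^sup>2 - 1) * (y * V1)"
  shows "(Y1 + y) * tj * (v * tr) - v * tr * ((Y1 + y) * tj)
       = scal (\<epsilon> - inverse \<epsilon>) * (y * tr * ((V1 + v) * tj))" (is ?A)
    and "qc 0 (y * tr) ((V1 + v) * tj)" (is ?B)
proof -
  define P1 P2 P3 where "P1 = v * (Y1 * (tr * tj))" and "P2 = V1 * (y * (tr * tj))"
    and "P3 = v * (y * (tr * tj))"
  have Y1v': "Y1 * (v * z) = scal \<epsilon> * (v * (Y1 * z)) + scal (\<epsilon>\<^sup>2 - 1) * (y * (V1 * z))" for z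
    by (simp only: mult.assoc[symmetric] Y1v distrib_right)
  note rules = assms(1-9)[THEN qcD] assms(1-9)[THEN qcD2] Y1v'
    scal_left_commute[of y] scal_left_commute[of v] scal_left_commute[of Y1]
    scal_left_commute[of V1] scal_left_commute[of tj] scal_left_commute[of tr] scal_scal
  have E1: "(Y1 + y) * tj * (v * tr) = scal \<epsilon> * P1 + scal (\<epsilon> - inverse \<epsilon>) * P2 + scal \<epsilon> * P3"
    by (simp add: P1_def P2_def P3_def mult.assoc distrib_left distrib_right rules
          power_int_minus field_simps power2_eq_square)
  have E2: "v * tr * ((Y1 + y) * tj) = scal \<epsilon> * P1 + scal (inverse \<epsilon>) * P3"
    by (simp add: P1_def P2_def P3_def mult.assoc distrib_left distrib_right rules power_int_minus)
  have E3: "y * tr * ((V1 + v) * tj) = P2 + P3"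
    by (simp add: P1_def P2_def P3_def mult.assoc distrib_left distrib_right rules power_int_minus)
  have E4: "(V1 + v) * tj * (y * tr) = P2 + P3"
    by (simp add: P1_def P2_def P3_def mult.assoc distrib_left distrib_right rules power_int_minus)
  show ?A unfolding E1 E2 E3 by (simp add: distrib_left scal_diff left_diff_distrib)
  show ?B unfolding qc_0_iff E3 E4 ..
qed


definition wg :: "nat \<Rightarrow> nat \<Rightarrow> nat \<Rightarrow> 'k linop" where
  "wg m i s = xg m i s * tinv (Suc m, s)"

lemma qc_xg_tinv:
  assumes "i \<in> {1..m}" "Suc m \<le> n" "s \<in> {1..n}" "r \<in> {1..n}"
  shows "qc (if s = r then - 1 else 0) (xg m i s) (tinv (Suc m, r))"
  using qc_inv_tg_right[OF _ qc_xg_tg[of i m "Suc m" s r]] assms by (auto simp: idx_iff split: if_splits)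

lemma qc_tinv_tinv_row:
  assumes "m \<in> {1..n}" "s \<in> {1..n}" "u \<in> {1..n}"
  shows "qc (if s < u then 1 else if u < s then - 1 else 0) (tinv (m, s)) (tinv (m, u))"
proof -
  have "qc (- (cocyc (m, u) (m, s) - cocyc (m, s) (m, u))) (tinv (m, s)) (tinv (m, u))"
    by (intro qc_inv_tg_right qc_tinv_tg) (use assms in \<open>auto simp: idx_iff\<close>)
  then show ?thesis by (auto simp: cocyc_def split: if_splits)
qed

text \<open>An entry meets the inverse belonging to the other factor nontrivially only for
  \<open>s = u\<close>, and there the two contributions are opposite. Beyond \<open>x\<close> only
  the commutation of the two inverses remains.\<close>

lemma qc_wg_wg:
  assumes "i \<in> {1..m}" "k \<in> {1..m}" "Suc m \<le> n" "s \<in> {1..n}" "u \<in> {1..n}"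
    and "qc x (xg m i s) (xg m k u)"
  shows "qc (x + (if s < u then 1 else if u < s then - 1 else 0)) (wg m i s) (wg m k u)"
proof -
  have 1: "qc (if s = u then - 1 else 0) (xg m i s) (tinv (Suc m, u))"
    using assms by (intro qc_xg_tinv) auto
  have "qc (if u = s then - 1 else 0) (xg m k u) (tinv (Suc m, s))"
    using assms by (intro qc_xg_tinv) auto
  from qc_sym[OF this] have 2: "qc (- (if u = s then - 1 else 0)) (tinv (Suc m, s)) (xg m k u)" .
  have 3: "qc (if s < u then 1 else if u < s then - 1 else 0) (tinv (Suc m, s)) (tinv (Suc m, u))"
    using assms by (intro qc_tinv_tinv_row) auto
  have "qc ((x + (if s = u then - 1 else 0)) + ((- (if u = s then - 1 else 0)) +
      (if s < u then 1 else if u < s then - 1 else 0))) (wg m i s) (wg m k u)"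
    unfolding wg_def by (intro qc_mult_left qc_mult_right 1 2 3 assms)
  then show ?thesis by (simp split: if_splits)
qed

text \<open>Moving the inverse of column \<open>s\<close> past that of column \<open>u\<close>
  multiplies the relation between the generators by \<epsilon>, which turns the coefficient
  \<open>\<epsilon> - inverse \<epsilon>\<close> into \<open>\<epsilon>^2 - 1\<close>.\<close>

lemma wg_cross:
  assumes "i \<in> {1..m}" "k \<in> {1..m}" "Suc m \<le> n" "s \<in> {1..n}" "u \<in> {1..n}" "s < u"
    and rel: "xg m i s * xg m k u - xg m k u * xg m i s = scal (\<epsilon> - inverse \<epsilon>) * (xg m i u * xg m k s)"
  shows "wg m i s * wg m k u = scal \<epsilon> * (wg m k u * wg m i s) + scal (\<epsilon>\<^sup>2 - 1) * (wg m i u * wg m k s)"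
proof -
  let ?T = "\<lambda>s. tinv (Suc m, s)"
  have c1: "?T s * (xg m k u * z) = xg m k u * (?T s * z)" for z
    using qcD2[OF qc_sym[OF qc_xg_tinv[of k m u s]]] assms by simp
  have c2: "?T u * (xg m i s * z) = xg m i s * (?T u * z)" for z
    using qcD2[OF qc_sym[OF qc_xg_tinv[of i m s u]]] assms by simp
  have c3: "?T u * (xg m k s * z) = xg m k s * (?T u * z)" for z
    using qcD2[OF qc_sym[OF qc_xg_tinv[of k m s u]]] assms by simp
  have c4: "?T s * ?T u = scal \<epsilon> * (?T u * ?T s)"
    using qcD[OF qc_tinv_tinv_row[of "Suc m" s u]] assms by simp
  have rel': "xg m i s * (xg m k u * z) = xg m k u * (xg m i s * z)
      + scal (\<epsilon> - inverse \<epsilon>) * (xg m i u * (xg m k s * z))" for z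
    using arg_cong[OF rel, of "\<lambda>y. y * z"] by (simp add: algebra_simps)
  have e: "\<epsilon> * (\<epsilon> - inverse \<epsilon>) = \<epsilon>\<^sup>2 - 1" by (simp add: field_simps power2_eq_square)
  show ?thesis
    by (simp add: wg_def mult.assoc c1 c2 c3 c4 rel' scal_left_commute[of "xg m _ _"] distrib_left
        scal_scal e)
qed

definition yg :: "nat \<Rightarrow> nat \<Rightarrow> nat \<Rightarrow> 'k linop" where
  "yg m i j = (\<Sum>s\<in>{j..n}. wg m i s)"

lemma xg_Suc: "i \<noteq> Suc m \<Longrightarrow> xg (Suc m) i j = yg m i j * tg (Suc m, j)"
  by (simp add: yg_def wg_def)

lemma yg_rec: "j \<le> n \<Longrightarrow> yg m i j = wg m i j + yg m i (Suc j)"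
  by (simp add: yg_def sum.atLeast_Suc_atMost)

lemma yg_split: "j \<le> r \<Longrightarrow> r \<le> n \<Longrightarrow> yg m i j = (\<Sum>s\<in>{j..<r}. wg m i s) + yg m i r"
  unfolding yg_def by (subst sum.union_disjoint[symmetric]) (auto intro!: sum.cong)

lemma qc_tg_wg:
  assumes "i \<in> {1..m}" "Suc m \<le> n" "s \<in> {1..n}" "r \<in> {1..n}"
  shows "qc (if s < r then 1 else - 1) (tg (Suc m, r)) (wg m i s)"
proof -
  have "qc ((if s = r then 1 else 0) + (cocyc (Suc m, r) (Suc m, s) - cocyc (Suc m, s) (Suc m, r)))
     (wg m i s) (tg (Suc m, r))"
    unfolding wg_def
    by (intro qc_mult_left qc_xg_tg qc_tinv_tg) (use assms in \<open>auto simp: idx_iff\<close>)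
  from qc_sym[OF this] show ?thesis by (auto simp: cocyc_def split: if_splits)
qed

text \<open>Downward induction on the column, starting from the empty sum. When
  \<open>(w + y) (w' + y')\<close> is expanded, the cross term \<open>w y'\<close> leaves a surplus
  \<open>(\<epsilon>^2 - 1) y w'\<close>. Together with \<open>y w'\<close> this is
  \<open>\<epsilon>^2 y w' = \<epsilon> w' y\<close>, the term that the other side requires.\<close>

lemma qc_yg_same_col:
  assumes q: "qmat m (xg m)" and ik: "i \<in> {1..m}" "k \<in> {1..m}" "i < k" "Suc m \<le> n" and j: "1 \<le> j" "j \<le> Suc n"
  shows "qc 1 (yg m i j) (yg m k j)"
  using j(2,1)
proof (induction rule: inc_induct)
  case (step j)
  then have j: "j \<in> {1..n}" by auto
  have ww: "qc 1 (wg m i j) (wg m k j)"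
    using qc_wg_wg[of i m k j j 1] q ik j by (auto simp: qmat_def)
  have wv: "wg m i j * yg m k (Suc j) = scal \<epsilon> * (yg m k (Suc j) * wg m i j)
      + scal (\<epsilon>\<^sup>2 - 1) * (yg m i (Suc j) * wg m k j)"
  proof -
    have "wg m i j * wg m k u = scal \<epsilon> * (wg m k u * wg m i j) + scal (\<epsilon>\<^sup>2 - 1) * (wg m i u * wg m k j)"
      if "u \<in> {Suc j..n}" for u
      by (rule wg_cross) (use that q ik j in \<open>auto simp: qmat_def\<close>)
    then show ?thesis
      by (simp add: yg_def sum_distrib_left sum_distrib_right sum.distrib)
  qed
  have "qc (- 1) (wg m i u) (wg m k j)" if "u \<in> {Suc j..n}" for u
    using qc_wg_wg[of i m k u j 0] that q ik j by (auto simp: qmat_def)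
  then have yw: "qc (- 1) (yg m i (Suc j)) (wg m k j)"
    unfolding yg_def by (rule qc_sum_left)
  have "qc 1 (yg m i (Suc j)) (yg m k (Suc j))" using step by simp
  note rules = this[THEN qcD] ww[THEN qcD] yw[THEN qcD] wv
  show ?case
    using j by (simp add: qc_def yg_rec[of j] distrib_left distrib_right rules scal_scal
        add.assoc scal_merge field_simps power2_eq_square)
qed (simp add: yg_def qc_zero_left)

text \<open>A relation between columns \<open>j < r\<close> is checked after splitting the partial
  sum from \<open>j\<close> at \<open>r\<close>. All pieces then commute up to powers of \<epsilon>,
  except that the head of one row and the tail of another obey the summed form of
  \<open>wg_cross\<close>.\<close>

lemma qmat_step:
  assumes q: "qmat m (xg m)" and m: "Suc m \<le> n"
  shows "qmat (Suc m) (xg (Suc m))"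
proof -
  let ?x = "xg (Suc m)" and ?t = "\<lambda>j. tg (Suc m, j)"
  have tt: "qc 1 (?t j) (?t r)" if "j \<in> {1..n}" "r \<in> {1..n}" "j < r" for j r
    using qc_tg_tg[of "(Suc m, j)" "(Suc m, r)"] that m by (auto simp: idx_iff cocyc_def)
  have ty: "qc (- 1) (?t j) (yg m i r)" if "i \<in> {1..m}" "j \<in> {1..n}" "r \<in> {1..n}" "j \<le> r" for i j r
    unfolding yg_def
  proof (rule qc_sum_right)
    fix s assume "s \<in> {r..n}"
    then show "qc (- 1) (?t j) (wg m i s)" using qc_tg_wg[of i m s j] that m by auto
  qed
  have ty1: "qc 1 (?t r) (\<Sum>s\<in>{j..<r}. wg m i s)"
    if "i \<in> {1..m}" "j \<in> {1..n}" "r \<in> {1..n}" for i j r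
  proof (rule qc_sum_right)
    fix s assume "s \<in> {j..<r}"
    then show "qc 1 (?t r) (wg m i s)" using qc_tg_wg[of i m s r] that m by auto
  qed
  have xt_same: "qc 1 (?x i j) (?x (Suc m) j)" if "i \<in> {1..m}" "j \<in> {1..n}" for i j
  proof -
    have "qc (1 + 0) (yg m i j * ?t j) (?t j)"
      using ty[of i j j] that by (intro qc_mult_left) (auto dest: qc_sym simp: qc_0_iff)
    then show ?thesis using that by (simp add: xg_Suc del: xg.simps(2)) (simp add: xg_Suc)
  qed
  have last: "?x (Suc m) j = ?t j" for j by simp
  have y_same: "qc 1 (yg m i j) (yg m k j)" if "i \<in> {1..m}" "k \<in> {1..m}" "i < k" "j \<in> {1..n}" for i j k
    using qc_yg_same_col[OF q] that m by simp
  have same_col: "qc 1 (?x i j) (?x k j)" if "i \<in> {1..m}" "k \<in> {1..m}" "i < k" "j \<in> {1..n}" for i j k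
  proof -
    \<comment> \<open>The four summands are the exponents of \<open>y\<close> with
      \<open>y'\<close>, of \<open>y\<close> with \<open>t_j\<close>, of \<open>t_j\<close> with
      \<open>y'\<close>, and of \<open>t_j\<close> with itself.\<close>
    have "qc ((1 + - (- 1)) + (- 1 + 0)) (yg m i j * ?t j) (yg m k j * ?t j)"
      by (intro qc_mult_left qc_mult_right qc_sym[OF ty] y_same ty) (use that in \<open>auto simp: qc_0_iff\<close>)
    then show ?thesis using that by (simp add: xg_Suc del: xg.simps(2))
  qed
  have same_row: "qc 1 (?x i j) (?x i r)" if "i \<in> {1..m}" "j \<in> {1..n}" "r \<in> {1..n}" "j < r" for i j r
  proof -
    define Y1 where "Y1 = (\<Sum>s\<in>{j..<r}. wg m i s)"
    have sp: "yg m i j = Y1 + yg m i r" using that yg_split[of j r m i] by (simp add: Y1_def)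
    have "qc (1 + (if s < u then 1 else if u < s then - 1 else 0)) (wg m i s) (wg m i u)"
      if "s \<in> {j..<r}" "u \<in> {r..n}" for s u
      by (rule qc_wg_wg)
        (use that \<open>j \<in> {1..n}\<close> \<open>r \<in> {1..n}\<close> \<open>i \<in> {1..m}\<close> m q in \<open>auto simp: qmat_def\<close>)
    \<comment> \<open>The exponent 2 combines 1 from the row relation of the old entries with 1 from
      the inverses.\<close>
    then have "qc 2 (wg m i s) (wg m i u)" if "s \<in> {j..<r}" "u \<in> {r..n}" for s u
      using that by fastforce
    then have Y1y: "qc 2 Y1 (yg m i r)"
      unfolding Y1_def yg_def by (intro qc_sum_left qc_sum_right)
    have c: "qc (- 1) (?t j) (yg m i r)" "qc 1 (?t r) Y1" "qc (- 1) (?t r) (yg m i r)" "qc 1 (?t j) (?t r)"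
      using ty[of i j r] ty[of i r r] ty1[of i j r] tt that by (auto simp: Y1_def)
    note rules = c[THEN qcD] c[THEN qcD2] Y1y[THEN qcD] Y1y[THEN qcD2]
      scal_left_commute[of Y1] scal_left_commute[of "yg m i r"] scal_left_commute[of "?t _"] scal_scal
    have "(Y1 + yg m i r) * ?t j * (yg m i r * ?t r)
        = scal \<epsilon> * (yg m i r * ?t r * ((Y1 + yg m i r) * ?t j))"
      by (simp add: mult.assoc distrib_left distrib_right rules power_int_minus power2_eq_square)
    then show ?thesis using that unfolding qc_def by (simp add: xg_Suc sp del: xg.simps(2))
  qed
  have two: "qc 0 (?x i r) (?x k j)"
    "?x i j * ?x k r - ?x k r * ?x i j = scal (\<epsilon> - inverse \<epsilon>) * (?x i r * ?x k j)"
    if "i \<in> {1..m}" "k \<in> {1..m}" "i < k" "j \<in> {1..n}" "r \<in> {1..n}" "j < r" for i j k r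
  proof -
    define Y1 where "Y1 = (\<Sum>s\<in>{j..<r}. wg m i s)"
    define V1 where "V1 = (\<Sum>s\<in>{j..<r}. wg m k s)"
    have sp: "yg m i j = Y1 + yg m i r" "yg m k j = V1 + yg m k r"
      using that yg_split[of j r m i] yg_split[of j r m k] by (simp_all add: Y1_def V1_def)
    have "wg m i s * wg m k u = scal \<epsilon> * (wg m k u * wg m i s) + scal (\<epsilon>\<^sup>2 - 1) * (wg m i u * wg m k s)"
      if "s \<in> {j..<r}" "u \<in> {r..n}" for s u
      by (rule wg_cross)
        (use that \<open>j \<in> {1..n}\<close> \<open>r \<in> {1..n}\<close> \<open>i \<in> {1..m}\<close> \<open>k \<in> {1..m}\<close> \<open>i < k\<close> m q in
          \<open>auto simp: qmat_def\<close>)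
    then have "(\<Sum>s\<in>{j..<r}. \<Sum>u\<in>{r..n}. wg m i s * wg m k u) =
        (\<Sum>s\<in>{j..<r}. \<Sum>u\<in>{r..n}. scal \<epsilon> * (wg m k u * wg m i s)
          + scal (\<epsilon>\<^sup>2 - 1) * (wg m i u * wg m k s))"
      by (intro sum.cong refl) auto
    moreover have "(\<Sum>s\<in>{j..<r}. \<Sum>u\<in>{r..n}. scal c * (wg m a u * wg m b s)) = scal c * (yg m a r * (\<Sum>s\<in>{j..<r}. wg m b s))"
      for c a b
      unfolding yg_def sum_product unfolding sum_distrib_left by (rule sum.swap)
    ultimately have Y1v: "Y1 * yg m k r = scal \<epsilon> * (yg m k r * Y1) + scal (\<epsilon>\<^sup>2 - 1) * (yg m i r * V1)"
      by (simp only: Y1_def V1_def sum.distrib) (simp only: yg_def sum_product)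
    have "qc (- 1) (wg m i s) (wg m k u)" if "u \<in> {j..<r}" "s \<in> {r..n}" for s u
      using qc_wg_wg[of i m k s u 0] that \<open>j \<in> {1..n}\<close> \<open>r \<in> {1..n}\<close> \<open>i \<in> {1..m}\<close> \<open>k \<in> {1..m}\<close> \<open>i < k\<close> m q
      by (auto simp: qmat_def)
    then have yV1: "qc (- 1) (yg m i r) V1"
      unfolding V1_def yg_def by (intro qc_sum_left qc_sum_right)
    have c: "qc (- 1) (?t j) (yg m i r)" "qc (- 1) (?t j) (yg m k r)" "qc 1 (?t j) (?t r)"
      "qc 1 (?t r) Y1" "qc 1 (?t r) V1" "qc (- 1) (?t r) (yg m i r)" "qc (- 1) (?t r) (yg m k r)"
      using ty[of i j r] ty[of i r r] ty[of k j r] ty[of k r r] ty1[of i j r] ty1[of k j r] tt that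
      by (auto simp: Y1_def V1_def)
    have yv: "qc 1 (yg m i r) (yg m k r)" using y_same that by simp
    from two_row_step[OF c yV1 yv Y1v]
    show "qc 0 (?x i r) (?x k j)"
      "?x i j * ?x k r - ?x k r * ?x i j = scal (\<epsilon> - inverse \<epsilon>) * (?x i r * ?x k j)"
      using that by (simp_all add: xg_Suc sp del: xg.simps(2))
  qed
  have last_far: "qc 0 (?x i r) (?t j)"
    and last_cross: "?x i j * ?t r - ?t r * ?x i j = scal (\<epsilon> - inverse \<epsilon>) * (?x i r * ?t j)"
    if "i \<in> {1..m}" "j \<in> {1..n}" "r \<in> {1..n}" "j < r" for i j r
  proof -
    define Y1 where "Y1 = (\<Sum>s\<in>{j..<r}. wg m i s)"
    have sp: "yg m i j = Y1 + yg m i r" using that yg_split[of j r m i] by (simp add: Y1_def)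
    have c: "qc (- 1) (?t j) (yg m i r)" "qc 1 (?t r) Y1" "qc (- 1) (?t r) (yg m i r)" "qc 1 (?t j) (?t r)"
      using ty[of i j r] ty[of i r r] ty1[of i j r] tt that by (auto simp: Y1_def)
    have "qc (- (- 1) + - 1) (yg m i r * ?t r) (?t j)"
      by (intro qc_mult_left qc_sym[OF c(1)] qc_sym[OF c(4)])
    then show "qc 0 (?x i r) (?t j)" using that by (simp add: xg_Suc del: xg.simps(2))
    note rules = c[THEN qcD] c[THEN qcD2]
      scal_left_commute[of Y1] scal_left_commute[of "yg m i r"] scal_left_commute[of "?t _"] scal_scal
    have "(Y1 + yg m i r) * ?t j * ?t r - ?t r * ((Y1 + yg m i r) * ?t j)
        = scal (\<epsilon> - inverse \<epsilon>) * (yg m i r * ?t r * ?t j)"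
      by (simp add: mult.assoc distrib_left distrib_right rules power_int_minus scal_diff left_diff_distrib)
    then show "?x i j * ?t r - ?t r * ?x i j = scal (\<epsilon> - inverse \<epsilon>) * (?x i r * ?t j)"
      using that by (simp add: xg_Suc sp del: xg.simps(2))
  qed
  have row: "i \<in> {1..Suc m} \<longleftrightarrow> i \<in> {1..m} \<or> i = Suc m" for i by auto
  show ?thesis
    unfolding qmat_def
  proof (intro conjI allI impI)
    fix i j k assume "i \<in> {1..Suc m}" "k \<in> {1..Suc m}" "j \<in> {1..n}" "i < k"
    then show "qc 1 (?x i j) (?x k j)"
      using same_col[of i k j] xt_same[of i j] unfolding row by (auto simp del: xg.simps(2))
  next
    fix i j r assume "i \<in> {1..Suc m}" "j \<in> {1..n}" "r \<in> {1..n}" "j < r"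
    then show "qc 1 (?x i j) (?x i r)"
      using same_row[of i j r] tt[of j r] unfolding row by (auto simp: last simp del: xg.simps(2))
  next
    fix i j k r assume "i \<in> {1..Suc m}" "k \<in> {1..Suc m}" "j \<in> {1..n}" "r \<in> {1..n}" "i < k" "r < j"
    then show "qc 0 (?x i j) (?x k r)"
      using two(1)[of i k r j] last_far[of i r j] unfolding row by (auto simp: last simp del: xg.simps(2))
  next
    fix i j k r assume "i \<in> {1..Suc m}" "k \<in> {1..Suc m}" "j \<in> {1..n}" "r \<in> {1..n}" "i < k" "j < r"
    then show "?x i j * ?x k r - ?x k r * ?x i j = scal (\<epsilon> - inverse \<epsilon>) * (?x i r * ?x k j)"
      using two(2)[of i k j r] last_cross[of i j r] unfolding row by (auto simp: last simp del: xg.simps(2))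
  qed
qed

lemma qmat_xg: "m \<le> n \<Longrightarrow> qmat m (xg m)"
proof (induction m)
  case (Suc m)
  then show ?case by (intro qmat_step) auto
qed (simp add: qmat_def)

end

section \<open>Gaussian binomial coefficients at roots of unity\<close>

fun qbinom :: "'a::comm_ring_1 \<Rightarrow> nat \<Rightarrow> nat \<Rightarrow> 'a" where
  "qbinom Q m 0 = 1"
| "qbinom Q 0 (Suc k) = 0"
| "qbinom Q (Suc m) (Suc k) = qbinom Q m k + Q ^ Suc k * qbinom Q m (Suc k)"

lemma qbinom_eq_0: "m < k \<Longrightarrow> qbinom Q m k = 0"
  by (induction Q m k rule: qbinom.induct) auto

lemma qbinom_self [simp]: "qbinom Q m m = 1"
  by (induction m) (auto simp: qbinom_eq_0)

text \<open>A division-free form of the product formula for Gaussian binomials, which stays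
  meaningful at roots of unity, where the factors of that formula may vanish.\<close>

lemma qbinom_absorb: "(1 - Q ^ Suc k) * qbinom Q (Suc m) (Suc k) = (1 - Q ^ Suc m) * qbinom Q m k"
proof (induction m arbitrary: k)
  case 0
  show ?case by (cases k) (auto simp: qbinom_eq_0)
next
  case (Suc m)
  have IH: "Q ^ Suc k * ((1 - Q ^ Suc k) * qbinom Q (Suc m) (Suc k))
      = Q ^ Suc k * ((1 - Q ^ Suc m) * qbinom Q m k)" for k
    using Suc by simp
  show ?case
  proof (cases k)
    case 0
    have "(1 - Q) * qbinom Q (Suc m) (Suc 0) = 1 - Q ^ Suc m" using Suc[of 0] by simp
    then have "Q * ((1 - Q) * qbinom Q (Suc m) (Suc 0)) = Q * (1 - Q ^ Suc m)" by simp
    then show ?thesis using 0 by (simp add: algebra_simps del: qbinom.simps(3)) (simp add: algebra_simps)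
  next
    case (Suc k')
    have 1: "(1 - Q ^ k) * qbinom Q (Suc m) k = (1 - Q ^ Suc m) * qbinom Q m k'"
      using Suc.IH[of k'] Suc by simp
    have 2: "qbinom Q (Suc m) k = qbinom Q m k' + Q ^ k * qbinom Q m k" using Suc by simp
    have 3: "Q ^ k * ((1 - Q ^ Suc m) * qbinom Q m k) = (Q ^ k - Q ^ Suc m) * qbinom Q (Suc m) k"
    proof -
      have "Q ^ k * ((1 - Q ^ Suc m) * qbinom Q m k)
         = (1 - Q ^ Suc m) * (qbinom Q (Suc m) k - qbinom Q m k')" using 2 by (simp add: algebra_simps)
      also have "\<dots> = (1 - Q ^ Suc m) * qbinom Q (Suc m) k - (1 - Q ^ k) * qbinom Q (Suc m) k"
        using 1 by (simp add: right_diff_distrib)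
      finally show ?thesis by (simp add: algebra_simps)
    qed
    have "(1 - Q ^ Suc k) * qbinom Q (Suc (Suc m)) (Suc k)
        = (1 - Q ^ Suc k) * qbinom Q (Suc m) k + Q ^ Suc k * ((1 - Q ^ Suc k) * qbinom Q (Suc m) (Suc k))"
      by (subst qbinom.simps(3)) (simp only: algebra_simps)
    also have "\<dots> = (1 - Q ^ Suc k) * qbinom Q (Suc m) k + Q * (Q ^ k * ((1 - Q ^ Suc m) * qbinom Q m k))"
      unfolding IH by (simp only: power_Suc mult.assoc)
    also have "\<dots> = (1 - Q ^ Suc (Suc m)) * qbinom Q (Suc m) k"
      unfolding 3 by (simp add: algebra_simps del: qbinom.simps(3))
    finally show ?thesis .
  qed
qed

text \<open>At a primitive root the right side of the absorption identity is zero, while its factor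
  \<open>1 - Q ^ k\<close> on the left is not.\<close>

lemma qbinom_vanish:
  fixes Q :: "'a::idom"
  assumes "Q ^ m = 1" "\<And>k. 0 < k \<Longrightarrow> k < m \<Longrightarrow> Q ^ k \<noteq> 1" "0 < k" "k < m"
  shows "qbinom Q m k = 0"
proof -
  obtain k' m' where "k = Suc k'" "m = Suc m'" using assms by (metis gr0_implies_Suc less_trans)
  then have "(1 - Q ^ k) * qbinom Q m k = 0"
    using qbinom_absorb[of Q k' m'] assms(1) by (simp only: ) simp
  moreover have "1 - Q ^ k \<noteq> 0" using assms(2)[of k] assms(3,4) by simp
  ultimately show ?thesis by simp
qed

section \<open>\<open>l\<close>-th powers and the commutative restoration\<close>

context qtorus
begin

lemma eps_powi_dvd: "int l dvd k \<Longrightarrow> \<epsilon> powi k = 1"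
  by (auto simp: dvd_def power_int_mult eps_l)

text \<open>Oddness of \<open>l\<close> excludes \<open>2 * k = l\<close>; if \<open>2 * k\<close>
  exceeds \<open>l\<close>, the exponent reduces to \<open>2 * k - l\<close>, which lies strictly
  between 0 and \<open>l\<close>.\<close>

lemma eps2_prim: "0 < k \<Longrightarrow> k < l \<Longrightarrow> (\<epsilon>\<^sup>2) ^ k \<noteq> 1"
proof
  assume k: "0 < k" "k < l" and e: "(\<epsilon>\<^sup>2) ^ k = 1"
  then have e: "\<epsilon> ^ (2 * k) = 1" by (simp add: power_mult)
  show False
  proof (cases "2 * k < l")
    case False
    then have "l < 2 * k" using l_odd by (metis dvd_triv_left linorder_neqE_nat)
    then have "\<epsilon> ^ (2 * k) = \<epsilon> ^ (2 * k - l) * \<epsilon> ^ l" by (simp flip: power_add)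
    then show False using e eps_l eps_prim[of "2 * k - l"] k \<open>l < 2 * k\<close> by auto
  qed (use e eps_prim[of "2 * k"] k in auto)
qed

lemma qc_power_right: "qc k f g \<Longrightarrow> qc (int m * k) f (g ^ m)"
proof (induction m)
  case (Suc m)
  then have "qc (k + int m * k) f (g * g ^ m)" by (intro qc_mult_right) auto
  then show ?case by (simp add: algebra_simps)
qed (simp add: qc_def)

text \<open>Moving \<open>f\<close> to the right past \<open>g ^ k\<close> produces
  \<open>(\<epsilon>^2) ^ k\<close>, so the coefficients obey the Pascal recursion that defines
  \<open>qbinom\<close>.\<close>

lemma qc_binomial:
  assumes "qc 2 f g"
  shows "(f + g) ^ m = (\<Sum>k\<le>m. scal (qbinom (\<epsilon>\<^sup>2) m k) * (g ^ k * f ^ (m - k)))"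
proof (induction m)
  case (Suc m)
  have fg: "f * (g ^ k * z) = scal ((\<epsilon>\<^sup>2) ^ k) * (g ^ k * (f * z))" for k z
    using qcD2[OF qc_power_right[OF assms, of k], of z]
    by (simp add: power_int_mult mult.commute[of "int k"])
  let ?b = "qbinom (\<epsilon>\<^sup>2)"
  have "(f + g) ^ Suc m = (\<Sum>k\<le>m. f * (scal (?b m k) * (g ^ k * f ^ (m - k))))
      + (\<Sum>k\<le>m. g * (scal (?b m k) * (g ^ k * f ^ (m - k))))"
    by (simp add: Suc distrib_right sum_distrib_left sum.distrib)
  also have "(\<Sum>k\<le>m. f * (scal (?b m k) * (g ^ k * f ^ (m - k))))
      = (\<Sum>k\<le>m. scal ((\<epsilon>\<^sup>2) ^ k * ?b m k) * (g ^ k * f ^ (Suc m - k)))"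
    by (intro sum.cong refl)
      (simp add: scal_left_commute[of f] fg scal_scal Suc_diff_le mult.commute)
  also have "\<dots> = (\<Sum>k\<le>Suc m. scal ((\<epsilon>\<^sup>2) ^ k * ?b m k) * (g ^ k * f ^ (Suc m - k)))"
    by (simp add: qbinom_eq_0)
  also have "\<dots> = f ^ Suc m + (\<Sum>k\<le>m. scal ((\<epsilon>\<^sup>2) ^ Suc k * ?b m (Suc k)) * (g ^ Suc k * f ^ (m - k)))"
    by (subst sum.atMost_Suc_shift) simp
  also have "(\<Sum>k\<le>m. g * (scal (?b m k) * (g ^ k * f ^ (m - k))))
      = (\<Sum>k\<le>m. scal (?b m k) * (g ^ Suc k * f ^ (m - k)))"
    by (intro sum.cong refl) (simp add: scal_left_commute[of g] mult.assoc)
  also have "f ^ Suc m + (\<Sum>k\<le>m. scal ((\<epsilon>\<^sup>2) ^ Suc k * ?b m (Suc k)) * (g ^ Suc k * f ^ (m - k))) +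
      (\<Sum>k\<le>m. scal (?b m k) * (g ^ Suc k * f ^ (m - k)))
     = f ^ Suc m + (\<Sum>k\<le>m. scal (?b (Suc m) (Suc k)) * (g ^ Suc k * f ^ (m - k)))"
    by (simp add: add.assoc sum.distrib[symmetric] scal_merge add.commute del: power_Suc)
  also have "\<dots> = (\<Sum>k\<le>Suc m. scal (?b (Suc m) k) * (g ^ k * f ^ (Suc m - k)))"
    by (subst sum.atMost_Suc_shift) simp
  finally show ?case .
qed simp

text \<open>A Frobenius identity at a root of unity: all inner coefficients of the binomial formula
  vanish.\<close>

lemma qc_add_power_l:
  assumes "qc 2 f g" shows "(f + g) ^ l = f ^ l + g ^ l"
proof -
  have "(f + g) ^ l = (\<Sum>k\<le>l. scal (qbinom (\<epsilon>\<^sup>2) l k) * (g ^ k * f ^ (l - k)))"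
    by (rule qc_binomial[OF assms])
  also have "\<dots> = (\<Sum>k\<in>{0, l}. scal (qbinom (\<epsilon>\<^sup>2) l k) * (g ^ k * f ^ (l - k)))"
  proof (rule sum.mono_neutral_right)
    have "qbinom (\<epsilon>\<^sup>2) l k = 0" if "0 < k" "k < l" for k
      using that eps_l by (intro qbinom_vanish eps2_prim) (auto simp: power_mult[symmetric] mult.commute[of 2] power_mult)
    then show "\<forall>k\<in>{..l} - {0, l}. scal (qbinom (\<epsilon>\<^sup>2) l k) * (g ^ k * f ^ (l - k)) = 0"
      by auto
  qed auto
  finally show ?thesis using l_gt by simp
qed

lemma qc_mult_power:
  assumes "qc k f g"
  shows "(f * g) ^ m = scal (\<epsilon> powi (- k * int (\<Sum>i<m. i))) * (f ^ m * g ^ m)"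
proof (induction m)
  case (Suc m)
  have gf: "g * (f ^ m * z) = scal (\<epsilon> powi (- k * int m)) * (f ^ m * (g * z))" for z
    using qcD2[OF qc_power_right[OF qc_sym[OF assms], of m], of z] by (simp add: mult.commute)
  have "(f * g) ^ Suc m = scal (\<epsilon> powi (- k * int (\<Sum>i<m. i))) * (f * (g * (f ^ m * g ^ m)))"
    by (simp add: Suc scal_left_commute[of g] scal_left_commute[of f] mult.assoc)
  also have "\<dots> = scal (\<epsilon> powi (- k * int (\<Sum>i<m. i)) * \<epsilon> powi (- k * int m)) * (f ^ Suc m * g ^ Suc m)"
    by (simp add: gf scal_left_commute[of f] scal_scal mult.assoc)
  also have "\<epsilon> powi (- k * int (\<Sum>i<m. i)) * \<epsilon> powi (- k * int m) = \<epsilon> powi (- k * int (\<Sum>i<Suc m. i))"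
    by (subst power_int_add[symmetric]) (simp_all add: algebra_simps)
  finally show ?case .
qed simp

text \<open>Reordering produces \<epsilon> to a multiple of \<open>l * (l - 1) div 2\<close>, and
  this is divisible by \<open>l\<close> because \<open>l\<close> is odd.\<close>

lemma qc_mult_power_l:
  assumes "qc k f g" shows "(f * g) ^ l = f ^ l * g ^ l"
proof -
  have "(\<Sum>i<l. i) = l * (l - 1) div 2"
    using Sum_Ico_nat[of 0 l] by (simp add: atLeast0LessThan)
  also have "\<dots> = l * ((l - 1) div 2)"
    using l_odd by (intro div_mult_swap[symmetric]) simp
  finally have "int l dvd - k * int (\<Sum>i<l. i)" by simp
  then show ?thesis using qc_mult_power[OF assms, of l] by (simp add: eps_powi_dvd)
qed

definition tau :: "nat \<times> nat \<Rightarrow> 'k lau" where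
  "tau k = single (single k (int l)) 1"
definition taui :: "nat \<times> nat \<Rightarrow> 'k lau" where
  "taui k = single (single k (- int l)) 1"

lemma tau_taui [simp]: "tau k * taui k = 1"
  by (simp add: tau_def taui_def mult_single single_add[symmetric])

text \<open>The cocycle contributes only powers of \<open>\<epsilon> ^ l = 1\<close>.\<close>

lemma tm_lattice:
  assumes "\<And>k. int l dvd lookup a k"
  shows "tm a = mulop (single a 1)"
proof (rule linop_eqI_single)
  fix b
  have "int l dvd \<beta> a b"
    unfolding \<beta>_def by (intro dvd_sum) (auto intro: assms dvd_mult dvd_mult2)
  then show "app (tm a) (single b 1) = app (mulop (single a 1)) (single b 1)"
    by (simp add: eps_powi_dvd mult_single)
qed

lemma tm_single_power:
  "k \<in> idx \<Longrightarrow> tm (single k x) ^ m = tm (single k (int m * x))"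
  by (induction m) (simp_all add: tm_mult \<beta>_single single_add[symmetric] algebra_simps)

lemma tg_power_l: "k \<in> idx \<Longrightarrow> tg k ^ l = mulop (tau k)"
  and tinv_power_l: "k \<in> idx \<Longrightarrow> tinv k ^ l = mulop (taui k)"
  unfolding tg_def tinv_def tau_def taui_def
  by (simp_all add: tm_single_power, (subst tm_lattice; simp add: lookup_single when_def)+)

text \<open>The recursion of \<open>xg\<close> with every \<open>tg\<close> and \<open>tinv\<close>
  replaced by the multiplier of its \<open>l\<close>-th power.\<close>

fun zeta :: "nat \<Rightarrow> nat \<Rightarrow> nat \<Rightarrow> 'k lau" where
  "zeta 0 i j = 0"
| "zeta (Suc m) i j = (if i = Suc m then tau (Suc m, j)
     else (\<Sum>s\<in>{j..n}. zeta m i s * taui (Suc m, s)) * tau (Suc m, j))"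

text \<open>The \<open>l\<close>-th power passes through each operation of the recursion: through
  products because the factors commute up to a power of \<epsilon>, and through the sum because each
  term commutes with the tail after it with exponent 2.\<close>

lemma xg_power_l:
  assumes "i \<in> {1..m}" "m \<le> n" "j \<in> {1..n}"
  shows "xg m i j ^ l = mulop (zeta m i j)"
  using assms
proof (induction m arbitrary: i j)
  case (Suc m)
  show ?case
  proof (cases "i = Suc m")
    case True
    then show ?thesis using Suc tg_power_l by (simp add: idx_iff)
  next
    case False
    then have i: "i \<in> {1..m}" using Suc by auto
    have w: "wg m i s ^ l = mulop (zeta m i s * taui (Suc m, s))" if "s \<in> {1..n}" for s
    proof -
      have "wg m i s ^ l = xg m i s ^ l * tinv (Suc m, s) ^ l"
        unfolding wg_def by (rule qc_mult_power_l, rule qc_xg_tinv) (use i Suc that in auto)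
      then show ?thesis using Suc i that tinv_power_l[of "(Suc m, s)"] by (simp add: mulop_mult idx_iff)
    qed
    have y: "yg m i j ^ l = mulop (\<Sum>s\<in>{j..n}. zeta m i s * taui (Suc m, s))"
      if "1 \<le> j" "j \<le> Suc n" for j
      using that(2,1)
    proof (induction rule: inc_induct)
      case base
      then show ?case using l_gt by (simp add: yg_def power_0_left)
    next
      case (step j)
      have "qc 2 (wg m i j) (wg m i u)" if "u \<in> {Suc j..n}" for u
        using qc_wg_wg[of i m i j u 1] qmat_xg[of m] i Suc.prems step that by (auto simp: qmat_def)
      then have "qc 2 (wg m i j) (yg m i (Suc j))"
        unfolding yg_def by (rule qc_sum_right)
      then have "yg m i j ^ l = wg m i j ^ l + yg m i (Suc j) ^ l"
        using step by (simp add: yg_rec qc_add_power_l)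
      then show ?case using step w[of j] by (simp add: sum.atLeast_Suc_atMost mulop_add)
    qed
    have "qc (- 1) (tg (Suc m, j)) (wg m i s)" if "s \<in> {j..n}" for s
      using qc_tg_wg[of i m s j] that i Suc.prems by auto
    then have "qc (- 1) (tg (Suc m, j)) (yg m i j)" unfolding yg_def by (rule qc_sum_right)
    from qc_mult_power_l[OF qc_sym[OF this]]
    have "xg (Suc m) i j ^ l = yg m i j ^ l * tg (Suc m, j) ^ l" using False by (simp add: xg_Suc del: xg.simps(2))
    then show ?thesis using False y[of j] Suc.prems tg_power_l[of "(Suc m, j)"]
      by (simp add: mulop_mult idx_iff)
  qed
qed simp

section \<open>Leading terms of the generators\<close>

definition above :: "nat \<times> nat \<Rightarrow> (nat \<times> nat) set" where
  "above k = {k' \<in> idx. k < k'}"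

text \<open>In the recursion the summand \<open>s = j\<close> returns the old entry, since
  \<open>t_j^-1 t_j\<close> cancels. Every other summand involves only later columns of row
  \<open>i\<close> or later rows, hence lexicographically later variables.\<close>

lemma xg_leading:
  assumes "i \<in> {1..m}" "m \<le> n" "j \<in> {1..n}"
  shows "xg m i j - tg (i, j) \<in> Tspan (above (i, j))"
  using assms
proof (induction m arbitrary: i j)
  case (Suc m)
  show ?case
  proof (cases "i = Suc m")
    case True
    then show ?thesis by (simp add: Tspan_0)
  next
    case False
    then have i: "i \<in> {1..m}" using Suc by auto
    have tj: "tg (Suc m, j) \<in> Tspan (above (i, j))"
      using i Suc.prems by (intro Tspan_tg) (auto simp: above_def idx_iff)
    have rest: "wg m i s * tg (Suc m, j) \<in> Tspan (above (i, j))" if s: "s \<in> {Suc j..n}" for s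
    proof -
      have "xg m i s - tg (i, s) \<in> Tspan (above (i, s))" using Suc i s by auto
      then have "xg m i s - tg (i, s) \<in> Tspan (above (i, j))"
        by (rule Tspan_mono) (use s in \<open>auto simp: above_def\<close>)
      moreover have "tg (i, s) \<in> Tspan (above (i, j))"
        using i Suc.prems s by (intro Tspan_tg) (auto simp: above_def idx_iff)
      ultimately have "(xg m i s - tg (i, s)) + tg (i, s) \<in> Tspan (above (i, j))" by (rule Tspan_add)
      moreover have "tinv (Suc m, s) \<in> Tspan (above (i, j))"
        using i Suc.prems s by (intro Tspan_tinv) (auto simp: above_def idx_iff)
      ultimately show ?thesis using tj by (simp add: wg_def Tspan_mult)
    qed
    have "xg (Suc m) i j = wg m i j * tg (Suc m, j) + (\<Sum>s\<in>{Suc j..n}. wg m i s * tg (Suc m, j))"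
      using False Suc.prems by (simp add: xg_Suc yg_rec distrib_right sum_distrib_right del: xg.simps(2)) (simp add: yg_def sum_distrib_right)
    also have "wg m i j * tg (Suc m, j) = xg m i j"
      using Suc.prems by (simp add: wg_def mult.assoc tinv_tg idx_iff)
    finally have "xg (Suc m) i j - tg (i, j) = (xg m i j - tg (i, j)) +
        (\<Sum>s\<in>{Suc j..n}. wg m i s * tg (Suc m, j))" by simp
    moreover have "xg m i j - tg (i, j) \<in> Tspan (above (i, j))" using Suc i by auto
    ultimately show ?thesis by (simp only:) (intro Tspan_add Tspan_sum rest)
  qed
qed simp

end

section \<open>Minors of the commutative restoration\<close>

lemma index_mult_mat_sum:
  "i < m \<Longrightarrow> j < r \<Longrightarrow> (mat m k f * mat k r g) $$ (i, j) = (\<Sum>s<k. f (i, s) * g (s, j))"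
  by (simp add: scalar_prod_def lessThan_atLeast0)

lemma det_lower_triangular_prod:
  assumes "\<And>i j. i < j \<Longrightarrow> j < k \<Longrightarrow> f (i, j) = 0"
  shows "det (mat k k f :: 'a::idom mat) = (\<Prod>i<k. f (i, i))"
proof -
  have "det (mat k k f) = prod_list (diag_mat (mat k k f))"
    by (rule det_lower_triangular[of k]) (use assms in auto)
  then show ?thesis by (simp add: prod_list_diag_prod lessThan_atLeast0)
qed

context qtorus
begin

lemma zeta_Suc: "i \<noteq> Suc m \<Longrightarrow> zeta (Suc m) i j = (\<Sum>s\<in>{j..n}. zeta m i s * taui (Suc m, s)) * tau (Suc m, j)"
  by simp

text \<open>Adding row \<open>m\<close> factors the matrix as \<open>W * T\<close>. Here
  \<open>T\<close> is lower triangular, its column \<open>b\<close> being constantly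
  \<open>tau (m, c + b)\<close> on and below the diagonal. \<open>W\<close> carries the previous
  block, scaled by the inverses of the new row, in its upper left corner and has last row
  \<open>0, ..., 0, 1\<close>. The inverses cancel against the determinant of \<open>T\<close> up to
  the factor of the last column.\<close>

lemma zeta_minor_bottom:
  assumes "k \<le> m" "1 \<le> c" "c + k \<le> Suc n"
  shows "det (mat k k (\<lambda>(a, b). zeta m (m - k + 1 + a) (c + b))) = (\<Prod>a<k. tau (m - k + 1 + a, c + a))"
  using assms
proof (induction k arbitrary: m)
  case (Suc k)
  then obtain m' where m: "m = Suc m'" by (cases m) auto
  define i0 where "i0 = m' - k + 1"
  have i0: "m - Suc k + 1 = i0" "i0 + k = Suc m'" using Suc.prems m by (auto simp: i0_def)
  have IH: "det (mat k k (\<lambda>(a, b). zeta m' (i0 + a) (c + b))) = (\<Prod>a<k. tau (i0 + a, c + a))"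
    using Suc.IH[of m'] Suc.prems m by (simp add: i0_def)
  \<comment> \<open>All columns from \<open>c + k\<close> to \<open>n\<close> are collected in the
    last column of \<open>W\<close>, where they do not influence the determinant.\<close>
  define yz where "yz a = (\<Sum>s\<in>{c + k..n}. zeta m' (i0 + a) s * taui (m, s))" for a
  define Z where "Z = mat k k (\<lambda>(a, b). zeta m' (i0 + a) (c + b))"
  define D where "D = mat k k (\<lambda>(a, b). if a = b then taui (m, c + b) else 0)"
  define W where "W = four_block_mat (Z * D) (mat k 1 (\<lambda>(a, b). yz a)) (0\<^sub>m 1 k) (1\<^sub>m 1)"
  define T where "T = mat (Suc k) (Suc k) (\<lambda>(s, b). if b \<le> s then tau (m, c + b) else 0)"
  have car: "Z \<in> carrier_mat k k" "D \<in> carrier_mat k k" "W \<in> carrier_mat (Suc k) (Suc k)"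
    "T \<in> carrier_mat (Suc k) (Suc k)"
    by (auto simp: Z_def D_def W_def T_def)
  have ZD: "(Z * D) $$ (a, s) = zeta m' (i0 + a) (c + s) * taui (m, c + s)" if "a < k" "s < k" for a s
  proof -
    have "(Z * D) $$ (a, s) = (\<Sum>u<k. zeta m' (i0 + a) (c + u) * (if u = s then taui (m, c + s) else 0))"
      unfolding Z_def D_def using that by (subst index_mult_mat_sum) auto
    also have "\<dots> = (\<Sum>u<k. if u = s then zeta m' (i0 + a) (c + s) * taui (m, c + s) else 0)"
      by (intro sum.cong) auto
    finally show ?thesis using that by simp
  qed
  have "det W = det (Z * D) * det (1\<^sub>m 1 :: 'k lau mat)"
    unfolding W_def by (rule det_four_block_mat_lower_left_zero) (use car in auto)
  then have "det W = (\<Prod>a<k. tau (i0 + a, c + a)) * (\<Prod>a<k. taui (m, c + a))"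
    using car IH by (simp add: det_mult) (simp add: Z_def D_def det_lower_triangular_prod)
  moreover have "det T = (\<Prod>a<Suc k. tau (m, c + a))"
    unfolding T_def by (subst det_lower_triangular_prod) auto
  moreover have "mat (Suc k) (Suc k) (\<lambda>(a, b). zeta m (m - Suc k + 1 + a) (c + b)) = W * T"
  proof (rule eq_matI)
    fix a b assume "a < dim_row (W * T)" "b < dim_col (W * T)"
    then have ab: "a < Suc k" "b < Suc k" using car by auto
    have "(W * T) $$ (a, b) = (\<Sum>s<Suc k. W $$ (a, s) * (if b \<le> s then tau (m, c + b) else 0))"
      using ab car by (simp add: scalar_prod_def lessThan_atLeast0 T_def)
    also have "\<dots> = (\<Sum>s\<in>{b..<Suc k}. W $$ (a, s) * tau (m, c + b))"
      by (rule sum.mono_neutral_cong_right) auto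
    also have "\<dots> = (\<Sum>s\<in>{b..<Suc k}. W $$ (a, s)) * tau (m, c + b)"
      by (rule sum_distrib_right[symmetric])
    also have "\<dots> = zeta m (i0 + a) (c + b)"
    proof (cases "a = k")
      case True
      have "(\<Sum>s\<in>{b..<Suc k}. W $$ (a, s)) = (\<Sum>s\<in>{b..<Suc k}. if s = k then 1 else 0)"
        by (intro sum.cong) (auto simp: W_def True Z_def D_def)
      then show ?thesis using ab True i0 m by simp
    next
      case False
      then have a: "a < k" using ab by simp
      have "(\<Sum>s\<in>{b..<Suc k}. W $$ (a, s)) = (\<Sum>s\<in>{b..<k}. W $$ (a, s)) + W $$ (a, k)"
        using ab by simp
      also have "(\<Sum>s\<in>{b..<k}. W $$ (a, s)) = (\<Sum>s\<in>{b..<k}. zeta m' (i0 + a) (c + s) * taui (m, c + s))"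
        by (intro sum.cong refl) (use a ZD car in \<open>auto simp: W_def\<close>)
      also have "\<dots> = (\<Sum>s\<in>{c + b..<c + k}. zeta m' (i0 + a) s * taui (m, s))"
        by (simp add: sum.shift_bounds_nat_ivl add.commute[of c])
      also have "W $$ (a, k) = yz a" using a car by (auto simp: W_def)
      also have "(\<Sum>s\<in>{c + b..<c + k}. zeta m' (i0 + a) s * taui (m, s)) + yz a
          = (\<Sum>s\<in>{c + b..n}. zeta m' (i0 + a) s * taui (m, s))"
        unfolding yz_def using ab Suc.prems
        by (subst sum.union_disjoint[symmetric]) (auto intro!: sum.cong)
      finally show ?thesis using a i0 m by (simp add: zeta_Suc)
    qed
    finally show "mat (Suc k) (Suc k) (\<lambda>(a, b). zeta m (m - Suc k + 1 + a) (c + b)) $$ (a, b) = (W * T) $$ (a, b)"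
      using ab i0(1) by simp
  qed (use car in auto)
  ultimately have "det (mat (Suc k) (Suc k) (\<lambda>(a, b). zeta m (m - Suc k + 1 + a) (c + b)))
      = (\<Prod>a<k. tau (i0 + a, c + a)) * ((\<Prod>a<k. taui (m, c + a)) * (\<Prod>a<k. tau (m, c + a))) * tau (m, c + k)"
    using car by (simp add: det_mult mult.assoc)
  also have "(\<Prod>a<k. taui (m, c + a)) * (\<Prod>a<k. tau (m, c + a)) = 1"
    by (subst prod.distrib[symmetric]) (simp add: mult.commute[of "taui _"])
  finally show ?case unfolding i0(1) by (simp add: i0(2) m)
qed simp

text \<open>The columns end at \<open>n\<close>, so no tail is left over: the new row acts on them
  by a triangular matrix whose entries are \<open>taui\<close> times \<open>tau\<close>, with ones
  on the diagonal.\<close>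

lemma zeta_minor_right_Suc:
  assumes "i0 + k \<le> Suc m" "k \<le> n"
  shows "det (mat k k (\<lambda>(a, b). zeta (Suc m) (i0 + a) (n - k + 1 + b)))
    = det (mat k k (\<lambda>(a, b). zeta m (i0 + a) (n - k + 1 + b)))"
proof -
  define d where "d = n - k + 1"
  have d: "d + k = Suc n" using assms by (simp add: d_def)
  define T where "T = (\<lambda>(s, b). if b \<le> s then taui (Suc m, d + s) * tau (Suc m, d + b) else 0)"
  have "mat k k (\<lambda>(a, b). zeta (Suc m) (i0 + a) (d + b))
      = mat k k (\<lambda>(a, b). zeta m (i0 + a) (d + b)) * mat k k T"
  proof (rule eq_matI)
    fix a b assume "a < dim_row (mat k k (\<lambda>(a, b). zeta m (i0 + a) (d + b)) * mat k k T)"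
      "b < dim_col (mat k k (\<lambda>(a, b). zeta m (i0 + a) (d + b)) * mat k k T)"
    then have ab: "a < k" "b < k" by auto
    have "(mat k k (\<lambda>(a, b). zeta m (i0 + a) (d + b)) * mat k k T) $$ (a, b)
        = (\<Sum>s<k. zeta m (i0 + a) (d + s) * T (s, b))"
      using ab by (subst index_mult_mat_sum) auto
    also have "\<dots> = (\<Sum>s\<in>{b..<k}. zeta m (i0 + a) (d + s) * taui (Suc m, d + s) * tau (Suc m, d + b))"
      unfolding T_def by (rule sum.mono_neutral_cong_right) auto
    also have "\<dots> = (\<Sum>s\<in>{b..<k}. zeta m (i0 + a) (d + s) * taui (Suc m, d + s)) * tau (Suc m, d + b)"
      by (rule sum_distrib_right[symmetric])
    also have "(\<Sum>s\<in>{b..<k}. zeta m (i0 + a) (d + s) * taui (Suc m, d + s))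
        = (\<Sum>s\<in>{d + b..<d + k}. zeta m (i0 + a) s * taui (Suc m, s))"
      by (simp add: sum.shift_bounds_nat_ivl add.commute[of d])
    also have "{d + b..<d + k} = {d + b..n}" unfolding d by auto
    finally show "mat k k (\<lambda>(a, b). zeta (Suc m) (i0 + a) (d + b)) $$ (a, b)
        = (mat k k (\<lambda>(a, b). zeta m (i0 + a) (d + b)) * mat k k T) $$ (a, b)"
      using ab assms by (simp add: zeta_Suc)
  qed auto
  moreover have "det (mat k k T) = 1"
    unfolding T_def by (subst det_lower_triangular_prod) (auto simp: mult.commute[of "taui _"])
  ultimately show ?thesis unfolding d_def[symmetric] by (simp add: det_mult[where n = k])
qed

lemma zeta_minor_right:
  assumes "i0 + k \<le> Suc m" "k \<le> n" "m \<le> m'"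
  shows "det (mat k k (\<lambda>(a, b). zeta m' (i0 + a) (n - k + 1 + b)))
    = det (mat k k (\<lambda>(a, b). zeta m (i0 + a) (n - k + 1 + b)))"
  using assms(3)
proof (induction rule: dec_induct)
  case (step m')
  then show ?case using zeta_minor_right_Suc[of i0 k m'] assms by simp
qed simp

lemma zeta_minor_SW:
  "k \<le> n \<Longrightarrow> det (mat k k (\<lambda>(a, b). zeta n (n - k + 1 + a) (1 + b))) = (\<Prod>a<k. tau (n - k + 1 + a, 1 + a))"
  by (rule zeta_minor_bottom) auto

text \<open>Rows after the \<open>k\<close>-th leave this minor unchanged, and within the first
  \<open>k\<close> rows it is a bottom minor.\<close>

lemma zeta_minor_NE:
  assumes "k \<le> n"
  shows "det (mat k k (\<lambda>(a, b). zeta n (1 + a) (n - k + 1 + b))) = (\<Prod>a<k. tau (1 + a, n - k + 1 + a))"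
  using zeta_minor_right[of 1 k k n] zeta_minor_bottom[of k k "n - k + 1"] assms by simp

text \<open>The \<open>k\<close>-th factor runs along the diagonal \<open>i - j = n - k\<close> in
  the first product and along \<open>j - i = n - k\<close> in the second. The main diagonal belongs
  to the first only, hence the upper limit \<open>n - 1\<close>.\<close>

lemma prod_idx_diagonals:
  fixes f :: "nat \<times> nat \<Rightarrow> 'a::comm_monoid_mult"
  shows "(\<Prod>k\<in>{1..n}. \<Prod>a<k. f (n - k + 1 + a, 1 + a)) *
    (\<Prod>k\<in>{1..n - 1}. \<Prod>a<k. f (1 + a, n - k + 1 + a)) = (\<Prod>p\<in>idx. f p)"
proof -
  have "(\<Prod>k\<in>{1..n}. \<Prod>a<k. f (n - k + 1 + a, 1 + a)) = (\<Prod>p\<in>{p \<in> idx. snd p \<le> fst p}. f p)"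
    by (subst prod.Sigma, simp, simp,
        rule prod.reindex_bij_witness[where j = "\<lambda>(k, a). (n - k + 1 + a, 1 + a)" and i = "\<lambda>(i, j). (n + j - i, j - 1)"])
      (auto simp: idx_def)
  moreover have "(\<Prod>k\<in>{1..n - 1}. \<Prod>a<k. f (1 + a, n - k + 1 + a)) = (\<Prod>p\<in>{p \<in> idx. fst p < snd p}. f p)"
    by (subst prod.Sigma, simp, simp,
        rule prod.reindex_bij_witness[where j = "\<lambda>(k, a). (1 + a, n - k + 1 + a)" and i = "\<lambda>(i, j). (n + i - j, i - 1)"])
      (auto simp: idx_def)
  moreover have "idx = {p \<in> idx. snd p \<le> fst p} \<union> {p \<in> idx. fst p < snd p}" by auto
  then have "(\<Prod>p\<in>idx. f p) = (\<Prod>p\<in>{p \<in> idx. snd p \<le> fst p}. f p) * (\<Prod>p\<in>{p \<in> idx. fst p < snd p}. f p)"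
    by (subst (1) \<open>idx = _\<close>, subst prod.union_disjoint) auto
  ultimately show ?thesis by simp
qed

end

section \<open>Leading exponents of ordered words\<close>

lemma lookup_scalar_mult [simp]:
  "lookup (single 0 c * u) b = c * lookup u b"
  by (simp flip: mult_map_scale_conv_mult add: map.rep_eq when_def)

text \<open>The generators satisfy \<open>x\<^sub>k = t\<^sub>k + r\<close> where \<open>r\<close> involves only later variables, so the
  leading exponent of an ordered word is its content. The first exponent that drops stays
  nonnegative, which keeps the comparison valid after reduction modulo \<open>l\<close>.\<close>

definition drops :: "expo \<Rightarrow> expo \<Rightarrow> bool" where
  "drops e a \<longleftrightarrow> (\<exists>k. (\<forall>k'<k. lookup e k' = lookup a k') \<and>
     0 \<le> lookup e k \<and> lookup e k < lookup a k)"

lemma drops_less: "drops e a \<Longrightarrow> e < a"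
  unfolding drops_def less_poly_mapping.rep_eq less_fun_def by auto

definition word_content :: "(nat \<times> nat) list \<Rightarrow> expo" where
  "word_content w = sum_list (map (\<lambda>k. single k 1) w)"

lemma word_content_simps [simp]: "word_content [] = 0" "word_content (k # w) = single k 1 + word_content w"
  "word_content (v @ w) = word_content v + word_content w"
  by (simp_all add: word_content_def)

lemma lookup_word_content: "lookup (word_content w) k = int (count (mset w) k)"
  by (induction w) (auto simp: lookup_add lookup_single when_def)

lemma keys_word_content: "keys (word_content w) = set w"
  by (auto simp: in_keys_iff lookup_word_content count_eq_zero_iff)

lemma word_content_inj: "sorted v \<Longrightarrow> sorted w \<Longrightarrow> word_content v = word_content w \<Longrightarrow> v = w"
proof -
  assume s: "sorted v" "sorted w" and c: "word_content v = word_content w"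
  have "count (mset v) k = count (mset w) k" for k
    using arg_cong[OF c, of "\<lambda>a. lookup a k"] by (simp add: lookup_word_content)
  then have "mset v = mset w" by (rule multiset_eqI)
  then show "v = w" using s by (metis properties_for_sort sorted_sort_id)
qed

context qtorus
begin

definition xgen :: "nat \<times> nat \<Rightarrow> 'k linop" where "xgen k = xg n (fst k) (snd k)"

definition xw :: "(nat \<times> nat) list \<Rightarrow> 'k linop" where "xw w = prod_list (map xgen w)"

lemma xw_simps [simp]: "xw [] = 1" "xw (k # w) = xgen k * xw w" "xw (v @ w) = xw v * xw w"
  by (simp_all add: xw_def)

text \<open>\<open>cocyc k j'\<close> vanishes unless \<open>j' < k\<close>, so on monomials in
  variables from \<open>k\<close> on no power of \<epsilon> arises.\<close>

lemma app_tg_shift: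
  assumes "k \<in> idx" "\<And>e. e \<in> keys u \<Longrightarrow> keys e \<subseteq> {k'. k \<le> k'}"
  shows "app (tg k) u = single (single k 1) 1 * u"
proof -
  have b: "\<beta> (single k 1) e = 0" if "e \<in> keys u" for e
    unfolding \<beta>_def
  proof (intro sum.neutral ballI)
    fix j j' assume "j \<in> idx" "j' \<in> idx"
    show "cocyc j j' * lookup (single k 1) j * lookup e j' = 0"
    proof (cases "j' < k")
      case True
      then have "j' \<notin> keys e" using assms(2)[OF that] by auto
      then show ?thesis by (simp add: in_keys_iff)
    qed (auto simp: cocyc_def lookup_single when_def)
  qed
  have "app (tg k) u = app (tg k) (\<Sum>e\<in>keys u. single e (lookup u e))"
    using poly_mapping_as_sum[of u] by simp
  also have "\<dots> = (\<Sum>e\<in>keys u. single (single k 1) 1 *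
      single e (lookup u e))"
    by (simp add: app_sum tg_def b mult_single)
  also have "\<dots> = single (single k 1) 1 * u"
    using poly_mapping_as_sum[of u] by (simp flip: sum_distrib_left)
  finally show ?thesis .
qed

lemma keys_app_tm: "keys (app (tm a) u) \<subseteq> (+) a ` keys u"
proof -
  have "app (tm a) u = app (tm a) (\<Sum>e\<in>keys u. single e (lookup u e))"
    using poly_mapping_as_sum[of u] by simp
  also have "\<dots> = (\<Sum>e\<in>keys u. single (a + e) (lookup u e * \<epsilon> powi \<beta> a e))"
    by (simp add: app_sum)
  also have "keys \<dots> \<subseteq> (\<Union>e\<in>keys u. {a + e})"
    by (rule order.trans[OF keys_sum]) auto
  finally show ?thesis by auto
qed

lemma keys_app_Tspan:
  assumes "f \<in> Tspan A" "e \<in> keys (app f u)"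
  shows "\<exists>a b. e = a + b \<and> keys a \<subseteq> A \<and> b \<in> keys u"
  using assms
proof (induction rule: Tspan.induct)
  case (Tspan_step a f c)
  have "e \<in> keys (single 0 c * app (tm a) u) \<or> e \<in> keys (app f u)"
    using Tspan_step.prems Poly_Mapping.keys_add[of "single 0 c * app (tm a) u" "app f u"] by auto
  moreover have "keys (single 0 c * app (tm a) u) \<subseteq> keys (app (tm a) u)"
    by (auto simp: in_keys_iff)
  ultimately show ?case using Tspan_step keys_app_tm[of a u] by blast
qed simp

lemma xgen_leading: "k \<in> idx \<Longrightarrow> xgen k - tg k \<in> Tspan (above k)"
  using xg_leading[of "fst k" n "snd k"] by (auto simp: xgen_def idx_def)

text \<open>Write the generator of the first letter \<open>y\<close> as \<open>t_y + r\<close>. The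
  summand \<open>t_y\<close> shifts all exponents and preserves their drops. The summand
  \<open>r\<close> involves later variables only, so it leaves the exponent of \<open>y\<close> at
  least one below the content. The bound \<open>x\<close> carries through the induction that the
  tail uses no variable before \<open>y\<close>.\<close>

lemma xw_leading:
  assumes "sorted w" "set w \<subseteq> idx" "set w \<subseteq> {k'. x \<le> k'}"
  shows "\<exists>g. app (xw w) 1 = single (word_content w) 1 + g \<and>
    (\<forall>e\<in>keys g. drops e (word_content w) \<and> keys e \<subseteq> {k \<in> idx. x \<le> k})"
  using assms
proof (induction w arbitrary: x)
  case (Cons y w)
  have y: "y \<in> idx" "x \<le> y" using Cons.prems by auto
  obtain g where g: "app (xw w) 1 = single (word_content w) 1 + g"
    "\<And>e. e \<in> keys g \<Longrightarrow> drops e (word_content w)"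
    "\<And>e. e \<in> keys g \<Longrightarrow> keys e \<subseteq> {k \<in> idx. y \<le> k}"
  proof -
    have "sorted w" "\<forall>k\<in>set w. y \<le> k" "set w \<subseteq> idx" using Cons.prems(1,2) by simp_all
    then have "\<exists>g. app (xw w) 1 = single (word_content w) 1 + g \<and>
        (\<forall>e\<in>keys g. drops e (word_content w) \<and> keys e \<subseteq> {k \<in> idx. y \<le> k})"
      by (intro Cons.IH) blast+
    then show ?thesis using that by blast
  qed
  define r where "r = xgen y - tg y"
  have r: "r \<in> Tspan (above y)" using xgen_leading y by (simp add: r_def)
  define u where "u = single (word_content w) 1 + g"
  have ukeys: "e = word_content w \<or> e \<in> keys g" if "e \<in> keys u" for e
    using that Poly_Mapping.keys_add[of "single (word_content w) 1" g] by (auto simp: u_def)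
  have cw: "keys (word_content w) \<subseteq> {k \<in> idx. y \<le> k}"
    using Cons.prems by (auto simp: keys_word_content)
  have ukeys2: "keys e \<subseteq> {k \<in> idx. y \<le> k}" if "e \<in> keys u" for e
    using ukeys[OF that] cw g(3) by auto
  have low: "lookup e k' = 0" if "keys e \<subseteq> {k \<in> idx. y \<le> k}" "k' < y" for e :: expo and k'
    using that by (auto simp: in_keys_iff)
  \<comment> \<open>Nothing in the tail precedes \<open>y\<close>, so the first drop of
    \<open>e\<close> occurs at \<open>y\<close> or later, and it lands on a nonnegative
    value.\<close>
  have uy: "0 \<le> lookup e y \<and> lookup e y \<le> lookup (word_content w) y"
    if "e \<in> keys u" for e
    using ukeys[OF that]
  proof
    assume e: "e \<in> keys g"
    from g(2)[OF e] obtain k where k: "\<forall>k'<k. lookup e k' = lookup (word_content w) k'"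
      "0 \<le> lookup e k" "lookup e k < lookup (word_content w) k"
      by (auto simp: drops_def)
    have "\<not> k < y" using low[OF g(3)[OF e], of k] low[OF cw, of k] k by auto
    show ?thesis
    proof (cases "k = y")
      case False
      then have "y < k" using \<open>\<not> k < y\<close> by (metis linorder_neqE)
      then have "lookup e y = lookup (word_content w) y" using k(1) by blast
      then show ?thesis by (simp add: lookup_word_content)
    qed (use k in auto)
  qed (simp add: lookup_word_content)
  define h where "h = single (single y 1) 1 * g + app r u"
  have "app (xw (y # w)) 1 = app (tg y) u + app r u"
    by (simp add: g(1) u_def r_def)
  also have "app (tg y) u = single (single y 1) 1 * u"
    using y ukeys2 by (intro app_tg_shift) auto
  finally have eq: "app (xw (y # w)) 1 = single (word_content (y # w)) 1 + h"
    by (simp add: u_def h_def distrib_left mult_single)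
  have "drops e (word_content (y # w)) \<and> keys e \<subseteq> {k \<in> idx. x \<le> k}"
    if "e \<in> keys h" for e
  proof -
    from that consider "e \<in> keys (single (single y 1) 1 * g)"
      | "e \<in> keys (app r u)"
      using Poly_Mapping.keys_add[of "single (single y 1) 1 * g" "app r u"]
      by (auto simp: h_def)
    then show ?thesis
    proof cases
      case 1
      then obtain b where b: "e = single y 1 + b" "b \<in> keys g"
        using keys_mult[of "single (single y (1::int)) (1::'k)" g] by auto
      from g(2)[OF b(2)] obtain k where k: "\<forall>k'<k. lookup b k' = lookup (word_content w) k'"
        "0 \<le> lookup b k" "lookup b k < lookup (word_content w) k"
        by (auto simp: drops_def)
      have "drops e (word_content (y # w))"
        unfolding drops_def b(1)
        by (rule exI[of _ k]) (use k in \<open>auto simp: lookup_add lookup_single when_def\<close>)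
      moreover have "keys e \<subseteq> {k \<in> idx. x \<le> k}"
        using Poly_Mapping.keys_add[of "single y 1" b] g(3)[OF b(2)] y b(1) by auto
      ultimately show ?thesis ..
    next
      case 2
      then obtain a b where ab: "e = a + b" "keys a \<subseteq> above y" "b \<in> keys u"
        using keys_app_Tspan[OF r] by blast
      have a0: "lookup a k = 0" if "k \<le> y" for k
        using ab(2) that by (auto simp: above_def in_keys_iff)
      have "drops e (word_content (y # w))"
        unfolding drops_def ab(1)
      proof (intro exI[of _ y] conjI allI impI)
        show "lookup (a + b) k' = lookup (word_content (y # w)) k'" if "k' < y" for k'
          using a0[of k'] low[OF ukeys2[OF ab(3)] that] low[OF cw that] that
          by (simp add: lookup_add lookup_single)
        show "0 \<le> lookup (a + b) y"
          "lookup (a + b) y < lookup (word_content (y # w)) y"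
          using a0[of y] uy[OF ab(3)] by (auto simp: lookup_add lookup_single)
      qed
      moreover have "keys e \<subseteq> {k \<in> idx. x \<le> k}"
        using Poly_Mapping.keys_add[of a b] ab ukeys2[OF ab(3)] y
        by (fastforce simp: above_def)
      ultimately show ?thesis ..
    qed
  qed
  then show ?case using eq by blast
qed (auto intro: exI[of _ 0])

definition ordered_words :: "(nat \<times> nat) list set" where
  "ordered_words = {w. sorted w \<and> set w \<subseteq> idx}"

lemma xw_coeff:
  assumes "w \<in> ordered_words"
  shows "lookup (app (xw w) 1) (word_content w) = 1"
    and "e \<in> keys (app (xw w) 1) \<Longrightarrow> e = word_content w \<or> drops e (word_content w)"
    and "e \<in> keys (app (xw w) 1) \<Longrightarrow> keys e \<subseteq> idx"
proof -
  obtain g where g: "app (xw w) 1 = single (word_content w) 1 + g"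
    "\<And>e. e \<in> keys g \<Longrightarrow> drops e (word_content w)"
    "\<And>e. e \<in> keys g \<Longrightarrow> keys e \<subseteq> idx"
    using xw_leading[of w "(0, 0)"] assms by (auto simp: ordered_words_def less_eq_prod_def subset_iff)
  have "word_content w \<notin> keys g" using g(2)[of "word_content w"] drops_less by blast
  then show "lookup (app (xw w) 1) (word_content w) = 1"
    by (simp add: g(1) lookup_add in_keys_iff)
  assume "e \<in> keys (app (xw w) 1)"
  then have "e = word_content w \<or> e \<in> keys g"
    using Poly_Mapping.keys_add[of "single (word_content w) 1" g] by (auto simp: g(1))
  then show "e = word_content w \<or> drops e (word_content w)" "keys e \<subseteq> idx"
    using g assms by (auto simp: keys_word_content ordered_words_def)
qed

text \<open>Among the words with nonzero coefficient take one of largest content. No other such word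
  contributes at that exponent, because its exponents are bounded by its own content, which is
  different and not larger.\<close>

lemma xw_independent:
  assumes fin: "finite W" and W: "W \<subseteq> ordered_words"
    and z: "(\<Sum>w\<in>W. scal (c w) * xw w) = 0" and "w \<in> W"
  shows "c w = 0"
proof (rule ccontr)
  assume "c w \<noteq> 0"
  define W' where "W' = {w \<in> W. c w \<noteq> 0}"
  have ne: "finite (word_content ` W')" "word_content ` W' \<noteq> {}"
    using fin \<open>w \<in> W\<close> \<open>c w \<noteq> 0\<close> by (auto simp: W'_def)
  then have "Max (word_content ` W') \<in> word_content ` W'" by (rule Max_in)
  then obtain v where v: "v \<in> W'" "word_content v = Max (word_content ` W')" by auto
  have le: "word_content w' \<le> word_content v" if "w' \<in> W'" for w'
    using that ne v by simp
  have "0 = lookup (app (\<Sum>w\<in>W. scal (c w) * xw w) 1) (word_content v)"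
    by (simp add: z)
  also have "\<dots> = (\<Sum>w\<in>W. c w * lookup (app (xw w) 1) (word_content v))"
    by (simp add: app_sum_op lookup_sum)
  also have "\<dots> = (\<Sum>w\<in>{v}. c w * lookup (app (xw w) 1) (word_content v))"
  proof (rule sum.mono_neutral_right)
    show "\<forall>w\<in>W - {v}. c w * lookup (app (xw w) 1) (word_content v) = 0"
    proof
      fix w' assume w': "w' \<in> W - {v}"
      show "c w' * lookup (app (xw w') 1) (word_content v) = 0"
      proof (rule ccontr)
        assume "\<not> ?thesis"
        then have "w' \<in> W'" and "word_content v \<in> keys (app (xw w') 1)"
          using w' by (auto simp: W'_def in_keys_iff)
        then have "word_content v = word_content w' \<or> word_content v < word_content w'"
          using xw_coeff(2)[of w' "word_content v"] drops_less w' W by blast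
        moreover have "word_content v \<noteq> word_content w'"
          using word_content_inj[of v w'] w' v W by (auto simp: W'_def ordered_words_def)
        ultimately show False using le[OF \<open>w' \<in> W'\<close>] by simp
      qed
    qed
  qed (use fin v in \<open>auto simp: W'_def\<close>)
  also have "\<dots> = c v" using xw_coeff(1)[of v] v W by (auto simp: W'_def)
  finally show False using v by (simp add: W'_def)
qed

end

section \<open>The specialised algebra inside the torus\<close>

definition hom_ext :: "('b::zero \<Rightarrow> 'c::ring_1) \<Rightarrow> ('w \<Rightarrow> 'c) \<Rightarrow> ('w \<Rightarrow>\<^sub>0 'b) \<Rightarrow> 'c" where
  "hom_ext cf h f = (\<Sum>w\<in>keys f. cf (lookup f w) * h w)"

lemma hom_ext_single: "cf 0 = 0 \<Longrightarrow> hom_ext cf h (single w a) = cf a * h w"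
  by (cases "a = 0") (simp_all add: hom_ext_def)

lemma hom_ext_add:
  assumes "cf 0 = 0" "\<And>a b. cf (a + b) = cf a + cf b"
  shows "hom_ext cf h (f + g) = hom_ext cf h f + hom_ext cf h g"
  unfolding hom_ext_def by (rule setsum_keys_plus_distrib) (simp_all add: assms algebra_simps)

lemma hom_ext_sum:
  assumes "cf 0 = 0" "\<And>a b. cf (a + b) = cf a + cf b"
  shows "hom_ext cf h (\<Sum>x\<in>A. f x) = (\<Sum>x\<in>A. hom_ext cf h (f x))"
  by (induction A rule: infinite_finite_induct)
    (simp_all add: hom_ext_add[OF assms], simp_all add: hom_ext_def)

lemma poly_mapping_mult_as_sum:
  fixes f g :: "'w::monoid_add \<Rightarrow>\<^sub>0 'b::ring_1"
  shows "f * g = (\<Sum>u\<in>keys f. \<Sum>v\<in>keys g.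
    single (u + v) (lookup f u * lookup g v))"
proof -
  have "f * g = (\<Sum>u\<in>keys f. single u (lookup f u)) *
      (\<Sum>v\<in>keys g. single v (lookup g v))"
    using poly_mapping_as_sum[of f] poly_mapping_as_sum[of g] by simp
  then show ?thesis by (simp add: sum_product mult_single)
qed

lemma hom_ext_mult:
  fixes f g :: "'w::monoid_add \<Rightarrow>\<^sub>0 'b::ring_1"
  assumes cf: "cf 0 = 0" "\<And>a b. cf (a + b) = cf a + cf b" "\<And>a b. cf (a * b) = cf a * cf b"
    and h: "\<And>u v. h (u + v) = h u * h v" and comm: "\<And>u a. h u * cf a = cf a * h u"
  shows "hom_ext cf h (f * g) = hom_ext cf h f * hom_ext cf h g"
proof -
  have "hom_ext cf h (f * g) = (\<Sum>u\<in>keys f. \<Sum>v\<in>keys g.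
      cf (lookup f u * lookup g v) * h (u + v))"
    by (subst poly_mapping_mult_as_sum) (simp add: hom_ext_sum[OF cf(1,2)] hom_ext_single[where cf = cf, OF cf(1)])
  also have "\<dots> = (\<Sum>u\<in>keys f. \<Sum>v\<in>keys g.
      (cf (lookup f u) * h u) * (cf (lookup g v) * h v))"
    by (intro sum.cong refl) (metis cf(3) h comm mult.assoc)
  finally show ?thesis by (simp add: hom_ext_def sum_product)
qed

text \<open>Centrality of \<open>a\<close> turns its one-sided multiples into a two-sided ideal; it
  is applied with the class of \<open>q - \<epsilon>\<close>.\<close>

lemma (in ring) ideal_central_multiples:
  assumes a: "a \<in> carrier R" and central: "\<And>x. x \<in> carrier R \<Longrightarrow> a \<otimes> x = x \<otimes> a"
  shows "ideal (a <# carrier R) R"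
proof (rule idealI)
  have in_iff: "y \<in> a <# carrier R \<longleftrightarrow> (\<exists>x\<in>carrier R. y = a \<otimes> x)" for y
    by (auto simp: l_coset_def)
  show "subgroup (a <# carrier R) (add_monoid R)"
  proof (rule add.subgroupI)
    show "a <# carrier R \<subseteq> carrier R" using a by (auto simp: in_iff)
    show "a <# carrier R \<noteq> {}" using in_iff by blast
    show "\<ominus> y \<in> a <# carrier R" if "y \<in> a <# carrier R" for y
      using that a unfolding in_iff by (metis a_inv_closed r_minus)
    show "y \<oplus> z \<in> a <# carrier R" if "y \<in> a <# carrier R" "z \<in> a <# carrier R" for y z
      using that a unfolding in_iff by (metis add.m_closed r_distr)
  qed
  show "x \<otimes> y \<in> a <# carrier R" if "y \<in> a <# carrier R" "x \<in> carrier R" for x y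
    using that a unfolding in_iff by (metis central m_assoc m_closed)
  show "y \<otimes> x \<in> a <# carrier R" if "y \<in> a <# carrier R" "x \<in> carrier R" for x y
    using that a unfolding in_iff by (metis m_assoc m_closed)
qed (rule ring_axioms)

lemma carrier_FactRing: "carrier (R Quot I) = (\<lambda>a. I +>\<^bsub>R\<^esub> a) ` carrier R"
  by (auto simp: FactRing_def A_RCOSETS_def RCOSETS_def a_r_coset_def)

context qtorus
begin

section \<open>Evaluation of the free algebra in the torus\<close>

definition evq :: "'k laurent \<Rightarrow> 'k" where
  "evq = hom_ext (\<lambda>c. c) (\<lambda>k. \<epsilon> powi k)"

lemma evq_add: "evq (p + r) = evq p + evq r"
  unfolding evq_def by (rule hom_ext_add) auto
lemma evq_mult: "evq (p * r) = evq p * evq r"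
  unfolding evq_def by (rule hom_ext_mult) (auto simp: power_int_add)
lemma evq_0 [simp]: "evq 0 = 0"
  by (simp add: evq_def hom_ext_def)
lemma evq_q_pow [simp]: "evq (q_pow k) = \<epsilon> powi k"
  by (simp add: evq_def q_pow_def hom_ext_single)
lemma evq_const [simp]: "evq (laurent_const c) = c"
  by (simp add: evq_def laurent_const_def hom_ext_single)
lemma evq_minus: "evq (p - r) = evq p - evq r"
  using evq_add[of "p - r" r] by simp

definition Phi :: "'k free_elem \<Rightarrow> 'k linop" where
  "Phi = hom_ext (\<lambda>p. scal (evq p)) (\<lambda>w. xw (letters w))"

lemma Phi_add: "Phi (f + g) = Phi f + Phi g"
  unfolding Phi_def by (rule hom_ext_add) (auto simp: evq_add scal_add)
lemma Phi_mult: "Phi (f * g) = Phi f * Phi g"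
  unfolding Phi_def
  by (rule hom_ext_mult) (simp_all add: evq_add scal_add evq_mult scal_mult plus_gen_word_def scal_commute[of "xw _"])
lemma Phi_0 [simp]: "Phi 0 = 0"
  by (simp add: Phi_def hom_ext_def)
lemma Phi_minus: "Phi (f - g) = Phi f - Phi g"
  using Phi_add[of "f - g" g] by simp
lemma Phi_gen [simp]: "Phi (free_gen i j) = xgen (i, j)"
  using evq_const[of 1] by (simp add: Phi_def free_gen_def hom_ext_single laurent_const_def)
lemma Phi_scalar [simp]: "Phi (free_scalar p) = scal (evq p)"
  by (simp add: Phi_def free_scalar_def hom_ext_single zero_gen_word_def)

lemma Phi_relations:
  assumes "f \<in> qmat_relations n" shows "Phi f = 0"
proof -
  note q = qmat_xg[OF order.refl, unfolded qmat_def]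
  note Q1 = q[THEN conjunct1, rule_format] and Q2 = q[THEN conjunct2, THEN conjunct1, rule_format]
    and Q3 = q[THEN conjunct2, THEN conjunct2, THEN conjunct1, rule_format]
    and Q4 = q[THEN conjunct2, THEN conjunct2, THEN conjunct2, rule_format]
  have q1: "xgen (i, j) * xgen (k, j) = scal \<epsilon> * (xgen (k, j) * xgen (i, j))"
    if "{i, j, k} \<subseteq> {1..n}" "i < k" for i j k using Q1[of i k j] that by (simp add: xgen_def qc_def)
  have q2: "xgen (i, j) * xgen (i, r) = scal \<epsilon> * (xgen (i, r) * xgen (i, j))"
    if "{i, j, r} \<subseteq> {1..n}" "j < r" for i j r using Q2[of i j r] that by (simp add: xgen_def qc_def)
  have q3: "xgen (i, j) * xgen (k, r) - xgen (k, r) * xgen (i, j) = 0"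
    if "{i, j, k, r} \<subseteq> {1..n}" "i < k" "j > r" for i j k r using Q3[of i k j r] that by (simp add: xgen_def qc_0_iff)
  have q4: "xgen (i, j) * xgen (k, r) - xgen (k, r) * xgen (i, j)
      = scal (\<epsilon> - inverse \<epsilon>) * (xgen (i, r) * xgen (k, j))"
    if "{i, j, k, r} \<subseteq> {1..n}" "i < k" "j < r" for i j k r using Q4[of i k j r] that by (simp add: xgen_def)
  show ?thesis
    using assms unfolding qmat_relations_def
    by (elim UnE CollectE exE conjE)
      (simp_all only: Phi_minus Phi_mult Phi_gen Phi_scalar evq_minus evq_q_pow q1 q2 q3 q4
        power_int_1_right power_int_minus diff_self)
qed

abbreviation FA :: "'k free_elem ring" where "FA \<equiv> free_alg n"
abbreviation "SR \<equiv> R_eps n \<epsilon>"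

lemma FA_carrier: "f \<in> carrier FA \<longleftrightarrow> (\<forall>w\<in>keys f. set (letters w) \<subseteq> idx)"
  by (simp add: free_alg_def idx_def)

lemma FA_simps [simp]: "f \<otimes>\<^bsub>FA\<^esub> g = f * g" "f \<oplus>\<^bsub>FA\<^esub> g = f + g" "\<zero>\<^bsub>FA\<^esub> = 0" "\<one>\<^bsub>FA\<^esub> = 1"
  by (simp_all add: free_alg_def)

lemma FA_add: "f \<in> carrier FA \<Longrightarrow> g \<in> carrier FA \<Longrightarrow> f + g \<in> carrier FA"
  using Poly_Mapping.keys_add[of f g] unfolding FA_carrier by blast
lemma FA_uminus: "f \<in> carrier FA \<Longrightarrow> - f \<in> carrier FA"
  unfolding FA_carrier by (simp add: in_keys_iff)
lemma FA_minus: "f \<in> carrier FA \<Longrightarrow> g \<in> carrier FA \<Longrightarrow> f - g \<in> carrier FA"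
  using FA_add[of f "- g"] FA_uminus by simp
lemma FA_mult: "f \<in> carrier FA \<Longrightarrow> g \<in> carrier FA \<Longrightarrow> f * g \<in> carrier FA"
  using keys_mult[of f g] unfolding FA_carrier by (fastforce simp: plus_gen_word_def)
lemma FA_scalar: "free_scalar p \<in> carrier FA"
  unfolding FA_carrier free_scalar_def by (auto simp: zero_gen_word_def)
lemma FA_0: "0 \<in> carrier FA" and FA_1: "1 \<in> carrier FA"
  unfolding FA_carrier by (auto simp: zero_gen_word_def)
lemma FA_gen: "(i, j) \<in> idx \<Longrightarrow> free_gen i j \<in> carrier FA"
  unfolding FA_carrier free_gen_def by auto

lemma ring_FA: "ring FA"
proof (rule ringI)
  show "abelian_group FA"
  proof (rule abelian_groupI)
    show "\<exists>y\<in>carrier FA. y \<oplus>\<^bsub>FA\<^esub> x = \<zero>\<^bsub>FA\<^esub>" if "x \<in> carrier FA" for x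
      using FA_uminus[OF that] by (intro bexI[of _ "- x"]) auto
  qed (auto simp: FA_add FA_0 add.commute)
  show "monoid FA"
    by (rule monoidI) (auto simp: FA_mult FA_1 mult.assoc)
qed (auto simp: distrib_left distrib_right)

interpretation FA: ring FA by (rule ring_FA)

lemma FA_a_inv: "f \<in> carrier FA \<Longrightarrow> \<ominus>\<^bsub>FA\<^esub> f = - f"
  by (rule FA.minus_equality) (auto simp: FA_uminus)

lemma FA_a_minus: "f \<in> carrier FA \<Longrightarrow> g \<in> carrier FA \<Longrightarrow> f \<ominus>\<^bsub>FA\<^esub> g = f - g"
  by (simp add: a_minus_def FA_a_inv)

lemma qmat_relations_carrier: "qmat_relations n \<subseteq> carrier FA"
  unfolding qmat_relations_def
  by (auto intro!: FA_minus FA_mult FA_gen FA_scalar simp: idx_def)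

lemma ideal_qmat: "ideal (qmat_ideal n) FA"
  unfolding qmat_ideal_def by (rule FA.genideal_ideal[OF qmat_relations_carrier])

lemma Phi_qmat_ideal: "f \<in> qmat_ideal n \<Longrightarrow> Phi f = 0"
proof -
  have "ideal {f \<in> carrier FA. Phi f = 0} FA"
  proof (rule idealI[OF ring_FA])
    show "subgroup {f \<in> carrier FA. Phi f = 0} (add_monoid FA)"
      by (rule FA.add.subgroupI)
        (use FA_0 Phi_minus[of 0] in \<open>auto simp: FA_a_inv FA_uminus FA_add Phi_add\<close>)
  qed (auto simp: Phi_mult FA_mult)
  from FA.genideal_minimal[OF this, of "qmat_relations n"] Phi_relations qmat_relations_carrier
  show "f \<in> qmat_ideal n \<Longrightarrow> Phi f = 0" unfolding qmat_ideal_def by blast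
qed

interpretation qmat: ideal "qmat_ideal n" FA by (rule ideal_qmat)

lemma ring_Rq: "ring (R_q n :: 'k free_elem set ring)"
  unfolding R_q_def by (rule qmat.quotient_is_ring)

interpretation Rq: ring "R_q n :: 'k free_elem set ring" by (rule ring_Rq)

lemma Rq_proj_hom: "Rq_proj n \<in> Ring.ring_hom FA (R_q n)"
  using qmat.rcos_ring_hom by (simp add: R_q_def Rq_proj_def[abs_def])

lemma Rq_carrier: "carrier (R_q n) = Rq_proj n ` carrier FA"
  by (simp add: R_q_def Rq_proj_def[abs_def] carrier_FactRing)

definition qe :: "'k free_elem" where "qe = free_scalar (q_pow 1 - laurent_const \<epsilon>)"

lemma free_scalar_commute: "free_scalar p * f = f * free_scalar (p :: 'k laurent)"
proof -
  have "free_scalar p * f = (\<Sum>u\<in>keys f. free_scalar p * single u (lookup f u))"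
    using poly_mapping_as_sum[of f] by (simp flip: sum_distrib_left)
  also have "\<dots> = (\<Sum>u\<in>keys f. single u (lookup f u) * free_scalar p)"
    by (intro sum.cong refl) (simp add: free_scalar_def mult_single mult.commute)
  also have "\<dots> = f * free_scalar p"
    using poly_mapping_as_sum[of f] by (simp flip: sum_distrib_right)
  finally show ?thesis .
qed

lemma ideal_spec: "ideal (specialization_ideal n \<epsilon>) (R_q n)"
  unfolding specialization_ideal_def
proof (rule Rq.ideal_central_multiples)
  show "Rq_proj n (free_scalar (q_pow 1 - laurent_const \<epsilon>)) \<in> carrier (R_q n)"
    using FA_scalar by (auto simp: Rq_carrier)
  fix x :: "'k free_elem set" assume "x \<in> carrier (R_q n)"
  then obtain f where "f \<in> carrier FA" "x = Rq_proj n f" by (auto simp: Rq_carrier)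
  then show "Rq_proj n (free_scalar (q_pow 1 - laurent_const \<epsilon>)) \<otimes>\<^bsub>R_q n\<^esub> x
      = x \<otimes>\<^bsub>R_q n\<^esub> Rq_proj n (free_scalar (q_pow 1 - laurent_const \<epsilon>))"
    using ring_hom_mult[OF Rq_proj_hom, of f] ring_hom_mult[OF Rq_proj_hom, of _ f] FA_scalar
    by (metis FA_simps(1) free_scalar_commute)
qed

interpretation spec: ideal "specialization_ideal n \<epsilon>" "R_q n" by (rule ideal_spec)

lemma ring_SR: "ring SR"
  unfolding R_eps_def by (rule spec.quotient_is_ring)

sublocale SR: ring SR by (rule ring_SR)

definition cl :: "'k free_elem \<Rightarrow> 'k free_elem set set" where
  "cl f = sigma_proj n \<epsilon> (Rq_proj n f)"

lemma cl_hom: "cl \<in> Ring.ring_hom FA SR"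
proof -
  have "sigma_proj n \<epsilon> \<in> Ring.ring_hom (R_q n) SR"
    using spec.rcos_ring_hom by (simp add: R_eps_def sigma_proj_def[abs_def])
  from ring_hom_trans[OF Rq_proj_hom this] show ?thesis by (simp add: cl_def[abs_def] comp_def)
qed

lemma SR_carrier: "carrier SR = cl ` carrier FA"
proof -
  have "carrier SR = sigma_proj n \<epsilon> ` carrier (R_q n)"
    by (simp add: R_eps_def sigma_proj_def[abs_def] carrier_FactRing)
  then show ?thesis by (simp add: Rq_carrier cl_def image_image)
qed

lemma cl_closed: "f \<in> carrier FA \<Longrightarrow> cl f \<in> carrier SR"
  by (simp add: SR_carrier)
lemma cl_mult: "f \<in> carrier FA \<Longrightarrow> g \<in> carrier FA \<Longrightarrow> cl (f * g) = cl f \<otimes>\<^bsub>SR\<^esub> cl g"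
  using ring_hom_mult[OF cl_hom] by simp
lemma cl_add: "f \<in> carrier FA \<Longrightarrow> g \<in> carrier FA \<Longrightarrow> cl (f + g) = cl f \<oplus>\<^bsub>SR\<^esub> cl g"
  using ring_hom_add[OF cl_hom] by simp
lemma cl_1: "cl 1 = \<one>\<^bsub>SR\<^esub>"
  using ring_hom_one[OF cl_hom] by simp
lemma cl_0: "cl 0 = \<zero>\<^bsub>SR\<^esub>"
  using ring_hom_zero[OF cl_hom ring_FA ring_SR] by simp
lemma cl_uminus: "f \<in> carrier FA \<Longrightarrow> cl (- f) = \<ominus>\<^bsub>SR\<^esub> cl f"
proof -
  assume f: "f \<in> carrier FA"
  have "cl (- f) \<oplus>\<^bsub>SR\<^esub> cl f = \<zero>\<^bsub>SR\<^esub>"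
    using cl_add[OF FA_uminus[OF f] f] by (simp add: cl_0)
  from SR.minus_equality[OF this cl_closed[OF f] cl_closed[OF FA_uminus[OF f]]] show ?thesis by simp
qed
lemma cl_minus: "f \<in> carrier FA \<Longrightarrow> g \<in> carrier FA \<Longrightarrow> cl (f - g) = cl f \<ominus>\<^bsub>SR\<^esub> cl g"
  using cl_add[of f "- g"] by (simp add: cl_uminus FA_uminus a_minus_def)

lemma cl_eq_iff: "f \<in> carrier FA \<Longrightarrow> g \<in> carrier FA \<Longrightarrow> cl f = cl g \<longleftrightarrow> cl (f - g) = \<zero>\<^bsub>SR\<^esub>"
  by (simp add: cl_minus cl_closed SR.r_right_minus_eq)

text \<open>Unfolding the two quotients, \<open>f\<close> equals \<open>q - \<epsilon>\<close> times
  some \<open>g\<close> modulo the ideal of relations, and \<open>Phi\<close> kills both.\<close>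

lemma cl_eq_0_Phi:
  assumes f: "f \<in> carrier FA" and z: "cl f = \<zero>\<^bsub>SR\<^esub>"
  shows "Phi f = 0"
proof -
  have pf: "Rq_proj n f \<in> carrier (R_q n)" using f by (simp add: Rq_carrier)
  have "specialization_ideal n \<epsilon> +>\<^bsub>R_q n\<^esub> Rq_proj n f = specialization_ideal n \<epsilon>"
    using z by (simp add: cl_def sigma_proj_def R_eps_def FactRing_def)
  then have "Rq_proj n f \<in> specialization_ideal n \<epsilon>"
    using pf by (rule spec.rcos_const_imp_mem[rotated])
  then obtain x where x: "x \<in> carrier (R_q n)" "Rq_proj n f = Rq_proj n qe \<otimes>\<^bsub>R_q n\<^esub> x"
    unfolding specialization_ideal_def l_coset_def qe_def by blast
  then obtain g where g: "g \<in> carrier FA" "x = Rq_proj n g" unfolding Rq_carrier by blast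
  have qg: "qe * g \<in> carrier FA" using g by (simp add: FA_mult FA_scalar qe_def)
  have "Rq_proj n f = Rq_proj n (qe * g)"
    using x g ring_hom_mult[OF Rq_proj_hom, of qe g] by (simp add: FA_scalar qe_def)
  then have "f \<ominus>\<^bsub>FA\<^esub> qe * g \<in> qmat_ideal n"
    using FA.quotient_eq_iff_same_a_r_cos[OF ideal_qmat f qg] by (simp add: Rq_proj_def)
  then have "Phi (f - qe * g) = 0" using f qg by (simp add: FA_a_minus Phi_qmat_ideal)
  then show ?thesis by (simp add: Phi_minus Phi_mult qe_def evq_minus)
qed

end

section \<open>Straightening to ordered words\<close>

lemma not_sorted_adjacent:
  fixes w :: "'a::linorder list"
  assumes "\<not> sorted w"
  shows "\<exists>u a b v. w = u @ [a, b] @ v \<and> b < a"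
proof -
  obtain i where i: "Suc i < length w" "w ! Suc i < w ! i"
    using assms by (auto simp: sorted_iff_nth_Suc not_le)
  have "w = take i w @ [w ! i, w ! Suc i] @ drop (Suc (Suc i)) w"
    using i by (simp add: Cons_nth_drop_Suc)
  then show ?thesis using i by blast
qed

context qtorus
begin

definition mon :: "(nat \<times> nat) list \<Rightarrow> 'k free_elem" where
  "mon w = single (Gen_Word w) 1"

lemma mon_append: "mon (u @ v) = mon u * mon v"
  by (simp add: mon_def mult_single plus_gen_word_def)

lemma mon_gen: "free_gen i j = mon [(i, j)]"
  by (simp add: mon_def free_gen_def)

lemma mon_pair: "mon [a, b] = mon [a] * mon [b]"
  using mon_append[of "[a]" "[b]"] by simp

lemma FA_mon: "set w \<subseteq> idx \<Longrightarrow> mon w \<in> carrier FA"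
  by (simp add: FA_carrier mon_def)

lemma Phi_mon [simp]: "Phi (mon w) = xw w"
  using evq_const[of 1] by (simp add: Phi_def mon_def hom_ext_single laurent_const_def)

definition scF :: "'k \<Rightarrow> 'k free_elem" where
  "scF c = free_scalar (laurent_const c)"

lemma FA_scF: "scF c \<in> carrier FA" by (simp add: scF_def FA_scalar)
lemma scF_1 [simp]: "scF 1 = 1" by (simp add: scF_def free_scalar_def laurent_const_def)
lemma scF_0 [simp]: "scF 0 = 0" by (simp add: scF_def free_scalar_def laurent_const_def)
lemma scF_mult: "scF (c * d) = scF c * scF d"
  by (simp add: scF_def free_scalar_def laurent_const_def mult_single)
lemma scF_uminus: "scF (- c) = - scF c"
  by (simp add: scF_def free_scalar_def laurent_const_def single_uminus)
lemma scF_commute: "scF c * f = f * scF c"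
  by (simp add: scF_def free_scalar_commute)
lemma Phi_scF [simp]: "Phi (scF c) = scal c" by (simp add: scF_def)

text \<open>The double quotient becomes one kernel in the free algebra, so that rewriting can be
  carried out on representatives.\<close>

definition clker :: "'k free_elem set" where
  "clker = {f \<in> carrier FA. cl f = \<zero>\<^bsub>SR\<^esub>}"

lemma clker_add: "f \<in> clker \<Longrightarrow> g \<in> clker \<Longrightarrow> f + g \<in> clker"
  by (simp add: clker_def cl_add FA_add)
lemma clker_uminus: "f \<in> clker \<Longrightarrow> - f \<in> clker"
  by (simp add: clker_def cl_uminus FA_uminus)
lemma clker_minus: "f \<in> clker \<Longrightarrow> g \<in> clker \<Longrightarrow> f - g \<in> clker"
  using clker_add[of f "- g"] clker_uminus by simp
lemma clker_mult_left: "f \<in> clker \<Longrightarrow> g \<in> carrier FA \<Longrightarrow> g * f \<in> clker"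
  by (simp add: clker_def cl_mult FA_mult cl_closed)
lemma clker_mult_right: "f \<in> clker \<Longrightarrow> g \<in> carrier FA \<Longrightarrow> f * g \<in> clker"
  by (simp add: clker_def cl_mult FA_mult cl_closed)
lemma cl_eq_iff_clker: "f \<in> carrier FA \<Longrightarrow> g \<in> carrier FA \<Longrightarrow> cl f = cl g \<longleftrightarrow> f - g \<in> clker"
  by (simp add: cl_eq_iff clker_def FA_minus)
lemma clker_0: "0 \<in> clker" by (simp add: clker_def FA_0 cl_0)

lemma clker_relation: "f \<in> qmat_relations n \<Longrightarrow> f \<in> clker"
proof -
  assume f: "f \<in> qmat_relations n"
  then have fc: "f \<in> carrier FA" using qmat_relations_carrier by blast
  have fi: "f \<in> qmat_ideal n"
    unfolding qmat_ideal_def using ring.genideal_self[OF ring_FA qmat_relations_carrier] f by blast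
  have zi: "(0 :: 'k free_elem) \<in> qmat_ideal n"
    using additive_subgroup.zero_closed[OF ideal.axioms(1)[OF ideal_qmat]] by simp
  have "Rq_proj n f = Rq_proj n 0"
    unfolding Rq_proj_def
    using ring.a_rcos_zero[OF ring_FA ideal_qmat fi] ring.a_rcos_zero[OF ring_FA ideal_qmat zi] by simp
  then have "cl f = cl 0" by (simp add: cl_def)
  then show ?thesis using fc by (simp add: clker_def cl_0)
qed

lemma clker_qe: "qe \<in> clker"
proof -
  have 1: "Rq_proj n qe \<in> specialization_ideal n \<epsilon>"
  proof -
    have "Rq_proj n qe = Rq_proj n qe \<otimes>\<^bsub>R_q n\<^esub> Rq_proj n (1 :: 'k free_elem)"
      using ring_hom_mult[OF Rq_proj_hom, of qe 1] by (simp add: FA_1 FA_scalar qe_def)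
    moreover have "Rq_proj n (1 :: 'k free_elem) \<in> carrier (R_q n)" using FA_1 unfolding Rq_carrier by blast
    ultimately show ?thesis unfolding specialization_ideal_def l_coset_def qe_def by blast
  qed
  have "specialization_ideal n \<epsilon> +>\<^bsub>R_q n\<^esub> Rq_proj n qe = specialization_ideal n \<epsilon>"
    using ring.a_rcos_zero[OF ring_Rq ideal_spec 1] .
  then have "cl qe = \<zero>\<^bsub>SR\<^esub>"
    by (simp add: cl_def sigma_proj_def R_eps_def FactRing_def)
  then show ?thesis by (simp add: clker_def qe_def FA_scalar)
qed

lemma free_scalar_add: "free_scalar (p + r) = free_scalar p + free_scalar (r :: 'k laurent)"
  and free_scalar_mult: "free_scalar (p * r) = free_scalar p * free_scalar (r :: 'k laurent)"
  and free_scalar_minus: "free_scalar (p - r) = free_scalar p - free_scalar (r :: 'k laurent)"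
  by (simp_all add: free_scalar_def single_add mult_single single_diff)

lemma q_pow_add: "q_pow (a + b) = q_pow a * (q_pow b :: 'k laurent)"
  by (simp add: q_pow_def mult_single)

lemma clker_q_pow: "free_scalar (q_pow k) - scF (\<epsilon> powi k) \<in> clker"
proof (induction k rule: int_induct[where k = 0])
  case base
  have "free_scalar (q_pow 0) = (1 :: 'k free_elem)" by (simp add: q_pow_def free_scalar_def)
  then show ?case by (simp add: clker_0)
next
  case (step1 i)
  have q: "free_scalar (q_pow 1) - scF \<epsilon> \<in> clker"
    using clker_qe by (simp add: qe_def free_scalar_minus scF_def)
  have "free_scalar (q_pow (i + 1)) - scF (\<epsilon> powi (i + 1)) =
     (free_scalar (q_pow i) - scF (\<epsilon> powi i)) * free_scalar (q_pow 1)
     + scF (\<epsilon> powi i) * (free_scalar (q_pow 1) - scF \<epsilon>)"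
    by (simp add: q_pow_add free_scalar_mult power_int_add scF_mult left_diff_distrib right_diff_distrib)
  also have "\<dots> \<in> clker"
    by (intro clker_add clker_mult_left clker_mult_right step1 q FA_scalar FA_scF)
  finally show ?case .
next
  case (step2 i)
  have q: "free_scalar (q_pow 1) - scF \<epsilon> \<in> clker"
    using clker_qe by (simp add: qe_def free_scalar_minus scF_def)
  have e1: "free_scalar (q_pow i) = free_scalar (q_pow (i - 1)) * free_scalar (q_pow 1 :: 'k laurent)"
    using q_pow_add[of "i - 1" 1] by (simp flip: free_scalar_mult)
  have e2: "\<epsilon> powi i * inverse \<epsilon> = \<epsilon> powi (i - 1)"
    by (simp add: power_int_diff divide_inverse)
  have e3: "scF \<epsilon> * scF (inverse \<epsilon>) = 1" by (simp flip: scF_mult)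
  \<comment> \<open>This rests on \<open>(q^i - \<epsilon>^i) \<epsilon>^-1 - q^(i-1) (q -
    \<epsilon>) \<epsilon>^-1 = q^(i-1) - \<epsilon>^(i-1)\<close>.\<close>
  have "(free_scalar (q_pow i) - scF (\<epsilon> powi i)) * scF (inverse \<epsilon>)
     - free_scalar (q_pow (i - 1)) * (free_scalar (q_pow 1) - scF \<epsilon>) * scF (inverse \<epsilon>) \<in> clker"
    by (intro clker_minus clker_mult_left clker_mult_right step2 q FA_scalar FA_scF)
  also have "(free_scalar (q_pow i) - scF (\<epsilon> powi i)) * scF (inverse \<epsilon>)
     - free_scalar (q_pow (i - 1)) * (free_scalar (q_pow 1) - scF \<epsilon>) * scF (inverse \<epsilon>)
     = free_scalar (q_pow (i - 1)) - scF (\<epsilon> powi (i - 1))"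
    by (simp add: e1 left_diff_distrib right_diff_distrib mult.assoc e3 e2 flip: scF_mult)
  finally show ?case .
qed

lemma clker_scalar: "free_scalar p - scF (evq p) \<in> clker"
proof -
  have single: "free_scalar (single k c) - scF (evq (single k c)) \<in> clker" for k c
  proof -
    have e: "single k c = laurent_const c * q_pow k"
      by (simp add: laurent_const_def q_pow_def mult_single)
    have "scF c * (free_scalar (q_pow k) - scF (\<epsilon> powi k)) \<in> clker"
      by (intro clker_mult_left clker_q_pow FA_scF)
    then show ?thesis
      by (simp add: e evq_mult scF_mult free_scalar_mult right_diff_distrib) (simp add: scF_def)
  qed
  have sum: "free_scalar (\<Sum>x\<in>A. f x) - scF (evq (\<Sum>x\<in>A. f x)) \<in> clker"
    if "\<And>x. x \<in> A \<Longrightarrow> free_scalar (f x) - scF (evq (f x)) \<in> clker" for A :: "int set" and f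
    using that
  proof (induction A rule: infinite_finite_induct)
    case (insert x A)
    have "(free_scalar (f x) - scF (evq (f x))) + (free_scalar (\<Sum>x\<in>A. f x) - scF (evq (\<Sum>x\<in>A. f x))) \<in> clker"
      using insert by (intro clker_add) auto
    moreover have "scF (c + d) = scF c + scF d" for c d
      by (simp add: scF_def laurent_const_def free_scalar_def single_add)
    ultimately show ?case using insert by (simp add: free_scalar_add evq_add algebra_simps)
  qed (simp_all add: clker_0 free_scalar_def)
  show ?thesis by (subst (1 2) poly_mapping_as_sum[of p]) (intro sum single)
qed

lemma qmat_relations_mon:
  "{i, j, k} \<subseteq> {1..n} \<Longrightarrow> i < k \<Longrightarrow>
    mon [(i, j)] * mon [(k, j)] - free_scalar (q_pow 1) * (mon [(k, j)] * mon [(i, j)]) \<in> qmat_relations n"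
  "{i, j, r} \<subseteq> {1..n} \<Longrightarrow> j < r \<Longrightarrow>
    mon [(i, j)] * mon [(i, r)] - free_scalar (q_pow 1) * (mon [(i, r)] * mon [(i, j)]) \<in> qmat_relations n"
  "{i, j, k, r} \<subseteq> {1..n} \<Longrightarrow> i < k \<Longrightarrow> j > r \<Longrightarrow>
    mon [(i, j)] * mon [(k, r)] - mon [(k, r)] * mon [(i, j)] \<in> qmat_relations n"
  "{i, j, k, r} \<subseteq> {1..n} \<Longrightarrow> i < k \<Longrightarrow> j < r \<Longrightarrow>
    mon [(i, j)] * mon [(k, r)] - mon [(k, r)] * mon [(i, j)]
      - free_scalar (q_pow 1 - q_pow (- 1)) * (mon [(i, r)] * mon [(k, j)]) \<in> qmat_relations n"
  unfolding qmat_relations_def mon_gen[symmetric] by blast+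

text \<open>One shape covers all four relations: the descent \<open>a, b\<close> becomes the ascent
  \<open>b, a\<close> plus a word whose first letter lies below \<open>a\<close>, so that the
  rewriting in \<open>reducible_mon\<close> terminates. Where there is no correction term, the
  second word is \<open>b, b\<close> with coefficient 0.\<close>

lemma cl_swap:
  assumes ab: "a \<in> idx" "b \<in> idx" "b < a"
  shows "\<exists>c1 c2 e f. e \<in> idx \<and> f \<in> idx \<and> e < a \<and>
    mon [a, b] - (scF c1 * mon [b, a] + scF c2 * mon [e, f]) \<in> clker"
proof -
  obtain k r i j where a: "a = (k, r)" and b: "b = (i, j)" by (cases a, cases b) auto
  have mem: "{i, j, k, r} \<subseteq> {1..n}" using ab by (auto simp: a b idx_def)
  have qcomm: ?thesis if "mon [b] * mon [a] - free_scalar (q_pow 1) * (mon [a] * mon [b]) \<in> qmat_relations n"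
  proof -
    let ?A = "mon [b] * mon [a]" and ?B = "mon [a] * mon [b]"
    \<comment> \<open>Scaling by \<open>inverse \<epsilon>\<close> solves the relation for the
      descent; the second term trades \<open>q\<close> for \<epsilon>.\<close>
    have "- (scF (inverse \<epsilon>) * (?A - free_scalar (q_pow 1) * ?B))
        - scF (inverse \<epsilon>) * ((free_scalar (q_pow 1) - scF (\<epsilon> powi 1)) * ?B) \<in> clker"
      using ab by (intro clker_minus clker_uminus clker_mult_left clker_mult_right clker_q_pow
          clker_relation[OF that] FA_scF FA_mult FA_mon) auto
    moreover have "scF (inverse \<epsilon>) * (scF \<epsilon> * ?B) = ?B"
      by (simp flip: scF_mult mult.assoc)
    ultimately have "mon [a, b] - (scF (inverse \<epsilon>) * mon [b, a] + scF 0 * mon [b, b]) \<in> clker"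
      by (simp add: mon_pair left_diff_distrib right_diff_distrib)
    then show ?thesis using ab by blast
  qed
  consider "i = k" "j < r" | "i < k" "j = r" | "i < k" "r < j" | "i < k" "j < r"
    using ab(3) linorder_less_linear[of r j] linorder_less_linear[of i k] by (auto simp: a b less_prod_def)
  then show ?thesis
  proof cases
    case 1
    show ?thesis
      by (rule qcomm) (use 1 mem qmat_relations_mon(2)[of i j r] in \<open>simp add: a b\<close>)
  next
    case 2
    show ?thesis
      by (rule qcomm) (use 2 mem qmat_relations_mon(1)[of i j k] in \<open>simp add: a b\<close>)
  next
    case 3
    have "mon [b] * mon [a] - mon [a] * mon [b] \<in> qmat_relations n"
      using 3 mem qmat_relations_mon(3)[of i j k r] by (simp add: a b)
    from clker_uminus[OF clker_relation[OF this]]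
    have "mon [a, b] - (scF 1 * mon [b, a] + scF 0 * mon [b, b]) \<in> clker"
      by (simp add: mon_pair)
    then show ?thesis using ab by blast
  next
    case 4
    define e f where "e = (i, r)" and "f = (k, j)"
    have ef: "e \<in> idx" "f \<in> idx" "e < a" using mem 4 by (auto simp: e_def f_def idx_def a less_prod_def)
    let ?A = "mon [b] * mon [a]" and ?B = "mon [a] * mon [b]" and ?P = "mon [e] * mon [f]"
      and ?p = "q_pow 1 - q_pow (- 1) :: 'k laurent"
    have "?A - ?B - free_scalar ?p * ?P \<in> qmat_relations n"
      using 4 mem qmat_relations_mon(4)[of i j k r] by (simp add: a b e_def f_def)
    then have "- (?A - ?B - free_scalar ?p * ?P) - (free_scalar ?p - scF (evq ?p)) * ?P \<in> clker"
      using ef by (intro clker_minus clker_uminus clker_mult_right clker_relation clker_scalar FA_mult FA_mon) auto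
    then have "mon [a, b] - (scF 1 * mon [b, a] + scF (- evq ?p) * mon [e, f]) \<in> clker"
      by (simp add: mon_pair left_diff_distrib right_diff_distrib scF_uminus algebra_simps)
    then show ?thesis using ef by blast
  qed
qed

text \<open>Coefficients are constants because \<open>q\<close> has been evaluated; with arbitrary
  Laurent coefficients a class modulo \<open>q - \<epsilon>\<close> would have many normal
  forms.\<close>

definition normal_forms :: "'k free_elem set" where
  "normal_forms = {g. \<forall>w\<in>keys g. letters w \<in> ordered_words \<and>
     lookup g w \<in> range laurent_const}"

lemma normal_forms_FA: "g \<in> normal_forms \<Longrightarrow> g \<in> carrier FA"
  by (auto simp: normal_forms_def FA_carrier ordered_words_def)

lemma laurent_const_0 [simp]: "laurent_const 0 = 0"
  by (simp add: laurent_const_def)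

lemma normal_forms_lookup: "g \<in> normal_forms \<Longrightarrow> lookup g w \<in> range laurent_const"
  by (cases "w \<in> keys g") (auto simp: normal_forms_def in_keys_iff intro: range_eqI[of _ _ 0])

lemma normal_forms_add: "f \<in> normal_forms \<Longrightarrow> g \<in> normal_forms \<Longrightarrow> f + g \<in> normal_forms"
proof -
  assume fg: "f \<in> normal_forms" "g \<in> normal_forms"
  have "lookup (f + g) w \<in> range laurent_const" for w
  proof -
    obtain c d where "lookup f w = laurent_const c" "lookup g w = laurent_const d"
      using normal_forms_lookup fg by blast
    then show ?thesis
      by (auto simp: lookup_add laurent_const_def single_add[symmetric])
  qed
  then show ?thesis using fg Poly_Mapping.keys_add[of f g] by (auto simp: normal_forms_def)
qed

lemma normal_forms_scF: "g \<in> normal_forms \<Longrightarrow> scF c * g \<in> normal_forms"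
proof -
  assume g: "g \<in> normal_forms"
  have lk: "lookup (scF c * g) w = laurent_const c * lookup g w" for w
    by (simp add: scF_def free_scalar_def mult_map_scale_conv_mult[symmetric] map.rep_eq when_def)
  have "lookup (scF c * g) w \<in> range laurent_const" for w
  proof -
    obtain d where "lookup g w = laurent_const d" using normal_forms_lookup[OF g] by blast
    then show ?thesis by (auto simp: lk laurent_const_def mult_single)
  qed
  moreover have "keys (scF c * g) \<subseteq> keys g" by (auto simp: in_keys_iff lk)
  ultimately show ?thesis using g by (auto simp: normal_forms_def)
qed

definition reducible :: "'k free_elem \<Rightarrow> bool" where
  "reducible f \<longleftrightarrow> (\<exists>g\<in>normal_forms. f - g \<in> clker)"

lemma reducible_add: "reducible f \<Longrightarrow> reducible g \<Longrightarrow> reducible (f + g)"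
  unfolding reducible_def by (metis add_diff_add clker_add normal_forms_add)

lemma reducible_scF: "reducible f \<Longrightarrow> reducible (scF c * f)"
  unfolding reducible_def
  by (metis clker_mult_left FA_scF normal_forms_scF right_diff_distrib)

lemma reducible_cong: "reducible g \<Longrightarrow> f - g \<in> clker \<Longrightarrow> reducible f"
  unfolding reducible_def
proof (elim bexE)
  fix h assume h: "h \<in> normal_forms" "g - h \<in> clker" and fg: "f - g \<in> clker"
  have "f - h = (f - g) + (g - h)" by simp
  then show "\<exists>h\<in>normal_forms. f - h \<in> clker" using clker_add[OF fg h(2)] h(1) by auto
qed

text \<open>Every application of \<open>cl_swap\<close> makes a letter smaller at the first position that changes.\<close>

lemma reducible_mon: "set w \<subseteq> idx \<Longrightarrow> reducible (mon w)"
proof (induction w rule: wf_induct_rule[OF wf_lenlex[OF wellorder_class.wf]])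
  case (1 w)
  show ?case
  proof (cases "sorted w")
    case True
    then have "mon w \<in> normal_forms"
      using 1 by (auto simp: normal_forms_def mon_def ordered_words_def laurent_const_def intro!: range_eqI[of _ _ 1])
    then show ?thesis unfolding reducible_def using clker_0 by (intro bexI[of _ "mon w"]) auto
  next
    case False
    then obtain u a b v where w: "w = u @ [a, b] @ v" "b < a" using not_sorted_adjacent by blast
    have mem: "a \<in> idx" "b \<in> idx" "set u \<subseteq> idx" "set v \<subseteq> idx" using 1 w by auto
    obtain c1 c2 e f where ef: "e \<in> idx" "f \<in> idx" "e < a"
      and k: "mon [a, b] - (scF c1 * mon [b, a] + scF c2 * mon [e, f]) \<in> clker"
      using cl_swap[OF mem(1,2) w(2)] by (elim exE conjE)
    have lt: "(u @ [x, y] @ v, w) \<in> lenlex {(x, y). x < y}" if "x < a" for x y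
      using that unfolding w lenlex_conv by (auto intro!: lex_append_leftI)
    have "reducible (mon (u @ [b, a] @ v))" "reducible (mon (u @ [e, f] @ v))"
      using 1(1)[OF lt] mem ef w(2) by auto
    then have red: "reducible (scF c1 * mon (u @ [b, a] @ v) + scF c2 * mon (u @ [e, f] @ v))"
      by (intro reducible_add reducible_scF)
    have "mon u * (mon [a, b] - (scF c1 * mon [b, a] + scF c2 * mon [e, f])) * mon v \<in> clker"
      using mem by (intro clker_mult_left clker_mult_right k FA_mon)
    moreover have sc: "mon u * (scF c * g) = scF c * (mon u * g)" for c g
      by (metis mult.assoc scF_commute)
    ultimately have "mon w - (scF c1 * mon (u @ [b, a] @ v) + scF c2 * mon (u @ [e, f] @ v)) \<in> clker"
      by (simp only: w mon_append left_diff_distrib right_diff_distrib distrib_left distrib_right mult.assoc sc)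
    then show ?thesis by (rule reducible_cong[OF red])
  qed
qed

lemma reducible_all:
  assumes f: "f \<in> carrier FA" shows "reducible f"
proof -
  have red: "reducible (single w (lookup f w))" if "w \<in> keys f" for w
  proof -
    let ?p = "lookup f w"
    have lw: "set (letters w) \<subseteq> idx" using that f by (auto simp: FA_carrier)
    have "(free_scalar ?p - scF (evq ?p)) * mon (letters w) \<in> clker"
      by (intro clker_mult_right clker_scalar FA_mon lw)
    moreover have "single w ?p = free_scalar ?p * mon (letters w)"
      by (simp add: free_scalar_def mon_def mult_single)
    ultimately have "single w ?p - scF (evq ?p) * mon (letters w) \<in> clker"
      by (simp add: left_diff_distrib)
    then show ?thesis using reducible_cong reducible_scF reducible_mon[OF lw] by blast
  qed
  have "reducible (\<Sum>w\<in>A. single w (lookup f w))"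
    if "A \<subseteq> keys f" for A
    using finite_subset[OF that finite_keys] that
  proof (induction A rule: finite_induct)
    case empty
    then show ?case unfolding reducible_def by (intro bexI[of _ 0]) (auto simp: normal_forms_def clker_0)
  qed (auto intro: reducible_add red)
  from this[OF order.refl] show ?thesis using poly_mapping_as_sum[of f] by simp
qed

lemma Phi_normal_form:
  assumes g: "g \<in> normal_forms"
  shows "Phi g = (\<Sum>w\<in>letters ` keys g. scal (evq (lookup g (Gen_Word w))) * xw w)"
proof -
  have "inj_on letters (keys g)" by (auto intro!: inj_onI simp: gen_word.expand)
  then show ?thesis by (simp add: Phi_def hom_ext_def sum.reindex)
qed

lemma Phi_normal_form_inj:
  assumes g: "g \<in> normal_forms" and z: "Phi g = 0"
  shows "g = 0"
proof (rule ccontr)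
  assume "g \<noteq> 0"
  then obtain w where w: "w \<in> keys g" by (metis all_not_in_conv keys_eq_empty)
  have "evq (lookup g (Gen_Word (letters w))) = 0"
  proof (rule xw_independent[where W = "letters ` keys g"
        and c = "\<lambda>v. evq (lookup g (Gen_Word v))"])
    show "(\<Sum>v\<in>letters ` keys g. scal (evq (lookup g (Gen_Word v))) * xw v) = 0"
      using Phi_normal_form[OF g] z by simp
  qed (use g w in \<open>auto simp: normal_forms_def\<close>)
  moreover obtain c where "lookup g w = laurent_const c" using normal_forms_lookup[OF g] by blast
  ultimately show False using w by (simp add: in_keys_iff)
qed

text \<open>Faithfulness of the realisation: straightening brings \<open>f - g\<close> to a normal
  form modulo \<open>clker\<close>, and on normal forms \<open>Phi\<close> is injective because
  ordered words are independent in the torus.\<close>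

lemma cl_eq_iff_Phi:
  assumes "f \<in> carrier FA" "g \<in> carrier FA"
  shows "cl f = cl g \<longleftrightarrow> Phi f = Phi g"
proof
  assume "cl f = cl g"
  then have "f - g \<in> clker" using assms by (simp add: cl_eq_iff_clker)
  then show "Phi f = Phi g" using cl_eq_0_Phi[of "f - g"] by (simp add: clker_def Phi_minus)
next
  assume e: "Phi f = Phi g"
  obtain h where h: "h \<in> normal_forms" "(f - g) - h \<in> clker"
    using reducible_all[OF FA_minus[OF assms]] by (auto simp: reducible_def)
  have "Phi h = 0" using cl_eq_0_Phi[of "(f - g) - h"] h(2) e by (simp add: clker_def Phi_minus)
  then have "h = 0" by (rule Phi_normal_form_inj[OF h(1)])
  then show "cl f = cl g" using h assms by (simp add: cl_eq_iff_clker)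
qed

section \<open>The embedding of the specialised algebra\<close>

definition Psi :: "'k free_elem set set \<Rightarrow> 'k linop" where
  "Psi s = Phi (SOME f. f \<in> carrier FA \<and> cl f = s)"

lemma Psi_cl: "f \<in> carrier FA \<Longrightarrow> Psi (cl f) = Phi f"
proof -
  assume f: "f \<in> carrier FA"
  define g where "g = (SOME g. g \<in> carrier FA \<and> cl g = cl f)"
  have "g \<in> carrier FA \<and> cl g = cl f" unfolding g_def by (rule someI[of _ f]) (use f in auto)
  then show ?thesis using f by (simp add: Psi_def g_def[symmetric] flip: cl_eq_iff_Phi)
qed

lemma SR_cases: "s \<in> carrier SR \<Longrightarrow> (\<And>f. f \<in> carrier FA \<Longrightarrow> s = cl f \<Longrightarrow> P) \<Longrightarrow> P"
  by (auto simp: SR_carrier)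

lemma Psi_inj: "s \<in> carrier SR \<Longrightarrow> s' \<in> carrier SR \<Longrightarrow> Psi s = Psi s' \<Longrightarrow> s = s'"
  by (elim SR_cases) (simp add: Psi_cl cl_eq_iff_Phi)
lemma Psi_mult: "s \<in> carrier SR \<Longrightarrow> s' \<in> carrier SR \<Longrightarrow> Psi (s \<otimes>\<^bsub>SR\<^esub> s') = Psi s * Psi s'"
  by (elim SR_cases) (simp add: Psi_cl Phi_mult FA_mult flip: cl_mult)
lemma Psi_add: "s \<in> carrier SR \<Longrightarrow> s' \<in> carrier SR \<Longrightarrow> Psi (s \<oplus>\<^bsub>SR\<^esub> s') = Psi s + Psi s'"
  by (elim SR_cases) (simp add: Psi_cl Phi_add FA_add flip: cl_add)
lemma Psi_zero [simp]: "Psi \<zero>\<^bsub>SR\<^esub> = 0"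
  using Psi_cl[OF FA_0] by (simp add: cl_0)
lemma Psi_one [simp]: "Psi \<one>\<^bsub>SR\<^esub> = 1"
  using Psi_cl[OF FA_1] Phi_mon[of "[]"] by (simp add: cl_1 mon_def zero_gen_word_def[symmetric])
lemma Psi_uminus: "s \<in> carrier SR \<Longrightarrow> Psi (\<ominus>\<^bsub>SR\<^esub> s) = - Psi s"
  using Psi_add[of s "\<ominus>\<^bsub>SR\<^esub> s"] by (simp add: SR.r_neg eq_neg_iff_add_eq_0 add.commute)
lemma Psi_pow: "s \<in> carrier SR \<Longrightarrow> Psi (s [^]\<^bsub>SR\<^esub> (m::nat)) = Psi s ^ m"
  by (induction m) (simp_all add: Psi_mult SR.nat_pow_closed power_commutes)
lemma Psi_finsum: "(\<And>x. x \<in> A \<Longrightarrow> f x \<in> carrier SR) \<Longrightarrow> Psi (\<Oplus>\<^bsub>SR\<^esub>x\<in>A. f x) = (\<Sum>x\<in>A. Psi (f x))"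
proof (induction A rule: infinite_finite_induct)
  case (insert x A)
  then show ?case by (subst SR.finsum_insert) (auto simp: Psi_add intro!: SR.finsum_closed)
qed (simp_all add: SR.finsum_infinite)

lemma eps_scalar_cl: "eps_scalar n \<epsilon> c = cl (scF c)"
  by (simp add: eps_scalar_def cl_def scF_def)
lemma eps_scalar_closed: "eps_scalar n \<epsilon> c \<in> carrier SR"
  by (simp add: eps_scalar_cl cl_closed FA_scF)
lemma Psi_eps_scalar [simp]: "Psi (eps_scalar n \<epsilon> c) = scal c"
  by (simp add: eps_scalar_cl Psi_cl FA_scF)

lemma z_gen_closed: "(i, j) \<in> idx \<Longrightarrow> z_gen n l \<epsilon> i j \<in> carrier SR"
  by (simp add: z_gen_def SR.nat_pow_closed cl_closed FA_gen flip: cl_def)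

lemma Psi_z_gen:
  assumes "(i, j) \<in> idx" shows "Psi (z_gen n l \<epsilon> i j) = mulop (zeta n i j)"
proof -
  have "Psi (z_gen n l \<epsilon> i j) = xg n i j ^ l"
    using assms by (simp add: z_gen_def Psi_pow cl_closed FA_gen Psi_cl xgen_def flip: cl_def)
  then show ?thesis using assms xg_power_l[of i n j] by (simp add: idx_def)
qed

lemma Psi_span:
  assumes "s \<in> carrier SR"
  shows "\<exists>W c. finite W \<and> W \<subseteq> ordered_words \<and> Psi s = (\<Sum>w\<in>W. scal (c w) * xw w)"
proof -
  obtain f where f: "f \<in> carrier FA" "s = cl f" using assms by (auto simp: SR_carrier)
  obtain g where g: "g \<in> normal_forms" "f - g \<in> clker" using reducible_all[OF f(1)] by (auto simp: reducible_def)
  have "s = cl g" using g f by (simp add: cl_eq_iff_clker normal_forms_FA)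
  then have "Psi s = Phi g" by (simp add: Psi_cl normal_forms_FA g(1))
  with Phi_normal_form[OF g(1)] g(1) show ?thesis
    by (intro exI[of _ "letters ` keys g"] exI[of _ "\<lambda>w. evq (lookup g (Gen_Word w))"])
      (auto simp: normal_forms_def)
qed

end

section \<open>The trace form of the torus\<close>

lemma det_upper_triangular_prod:
  assumes "\<And>i j. j < i \<Longrightarrow> i < k \<Longrightarrow> f (i, j) = 0"
  shows "det (mat k k f :: 'a::comm_ring_1 mat) = (\<Prod>i<k. f (i, i))"
proof -
  have "det (mat k k f) = prod_list (diag_mat (mat k k f))"
    by (rule det_upper_triangular[of _ k]) (use assms in \<open>auto simp: upper_triangular_def\<close>)
  then show ?thesis by (simp add: prod_list_diag_prod lessThan_atLeast0)
qed

text \<open>In the Leibniz expansion every other permutation meets a zero entry.\<close>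

lemma det_monomial_matrix:
  fixes f :: "nat \<times> nat \<Rightarrow> 'a::comm_ring_1"
  assumes p: "p permutes {0..<k}" and z: "\<And>i j. i < k \<Longrightarrow> j < k \<Longrightarrow> j \<noteq> p i \<Longrightarrow> f (i, j) = 0"
  shows "det (mat k k f) = signof p * (\<Prod>i<k. f (i, p i))"
proof -
  have fin: "finite {q. q permutes {0..<k}}" by (rule finite_permutations) simp
  have "det (mat k k f) = (\<Sum>q\<in>{q. q permutes {0..<k}}. signof q * (\<Prod>i = 0..<k. mat k k f $$ (i, q i)))"
    by (rule det_def') simp
  also have "\<dots> = (\<Sum>q\<in>{p}. signof q * (\<Prod>i = 0..<k. mat k k f $$ (i, q i)))"
  proof (rule sum.mono_neutral_right[OF fin])
    show "\<forall>q\<in>{q. q permutes {0..<k}} - {p}. signof q * (\<Prod>i = 0..<k. mat k k f $$ (i, q i)) = 0"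
    proof
      fix q assume q: "q \<in> {q. q permutes {0..<k}} - {p}"
      then obtain i where i: "q i \<noteq> p i" by auto
      then have ik: "i < k" using q p permutes_not_in[of _ "{0..<k}" i] by (metis DiffE atLeastLessThan_iff mem_Collect_eq zero_le)
      then have "q i < k" using q permutes_in_image[of q "{0..<k}" i] by auto
      then have "mat k k f $$ (i, q i) = 0" using z i ik by auto
      then have "(\<Prod>i = 0..<k. mat k k f $$ (i, q i)) = 0"
        using ik by (intro prod_zero) auto
      then show "signof q * (\<Prod>i = 0..<k. mat k k f $$ (i, q i)) = 0" by simp
    qed
  qed (use p in auto)
  also have "\<dots> = signof p * (\<Prod>i<k. f (i, p i))"
  proof -
    have "(\<Prod>i = 0..<k. mat k k f $$ (i, p i)) = (\<Prod>i = 0..<k. f (i, p i))"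
    proof (intro prod.cong refl)
      fix i assume i: "i \<in> {0..<k}"
      then have "p i < k" using p permutes_in_image[of p "{0..<k}" i] by auto
      then show "mat k k f $$ (i, p i) = f (i, p i)" using i by simp
    qed
    then show ?thesis by (simp add: lessThan_atLeast0)
  qed
  finally show ?thesis .
qed

lemma lookup_sum_single: "finite A \<Longrightarrow> lookup (\<Sum>k\<in>A. single k (f k)) j = (if j \<in> A then f j else 0)"
  by (simp add: lookup_sum lookup_single when_def)

lemma prod_single:
  "(\<Prod>x\<in>A. single (e x) (c x)) = single (\<Sum>x\<in>A. e x) (\<Prod>x\<in>A. c x :: 'a::comm_ring_1)"
proof (induction A rule: infinite_finite_induct)
qed (simp_all add: mult_single)

context qtorus
begin

definition latt :: "expo \<Rightarrow> bool" where
  "latt e \<longleftrightarrow> (\<forall>k. int l dvd lookup e k)"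

lemma latt_add: "latt a \<Longrightarrow> latt b \<Longrightarrow> latt (a + b)"
  and latt_0 [simp]: "latt 0" and latt_uminus: "latt a \<Longrightarrow> latt (- a)"
  by (auto simp: latt_def lookup_add)

lemma latt_add_cancel: "latt a \<Longrightarrow> latt (a + b) \<longleftrightarrow> latt b"
  using latt_add[of a b] latt_add[of "- a" "a + b"] latt_uminus[of a] by auto

lemma \<beta>_latt: "latt a \<Longrightarrow> int l dvd \<beta> a b" "latt b \<Longrightarrow> int l dvd \<beta> a b"
  unfolding \<beta>_def latt_def by (auto intro!: dvd_sum)

definition CT :: "'k lau set" where
  "CT = {g. \<forall>e\<in>keys g. latt e}"

text \<open>\<open>comp b\<close> is the coordinate at the monomial with exponent \<open>b\<close>, over the Laurent polynomials in
  the \<open>l\<close>-th powers.\<close>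

definition comp :: "expo \<Rightarrow> 'k lau \<Rightarrow> 'k lau" where
  "comp b f = (\<Sum>e\<in>keys f. if latt (e - b) then single (e - b) (lookup f e) else 0)"

lemma comp_add: "comp b (f + g) = comp b f + comp b g"
  unfolding comp_def by (rule setsum_keys_plus_distrib) (auto simp: single_add)

lemma comp_0 [simp]: "comp b 0 = 0"
  by (simp add: comp_def)

lemma comp_sum: "comp b (\<Sum>x\<in>A. f x) = (\<Sum>x\<in>A. comp b (f x))"
  by (induction A rule: infinite_finite_induct) (auto simp: comp_add)

lemma comp_single: "comp b (single e c) = (if latt (e - b) then single (e - b) c else 0)"
  by (cases "c = 0") (simp_all add: comp_def)

lemma comp_CT_mult:
  assumes g: "g \<in> CT" shows "comp b (g * f) = g * comp b f"
proof -
  have 1: "comp b (single d c * f) = single d c * comp b f" if "latt d" for d c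
  proof -
    have "comp b (single d c * single e x) = single d c * comp b (single e x)" for e x
      using latt_add_cancel[OF that, of "e - b"] by (simp add: mult_single comp_single add_diff_eq)
    then have "comp b (\<Sum>e\<in>keys f. single d c * single e (lookup f e))
      = single d c * comp b (\<Sum>e\<in>keys f. single e (lookup f e))"
      by (simp add: comp_sum sum_distrib_left)
    then show ?thesis using poly_mapping_as_sum[of f] by (simp flip: sum_distrib_left)
  qed
  have "comp b ((\<Sum>d\<in>keys g. single d (lookup g d)) * f)
      = (\<Sum>d\<in>keys g. single d (lookup g d)) * comp b f"
    using g by (simp add: sum_distrib_right comp_sum 1 CT_def)
  then show ?thesis using poly_mapping_as_sum[of g] by simp
qed

section \<open>Exponents reduced modulo \<open>l\<close>\<close>

definition boxB :: "expo set" where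
  "boxB = {a. keys a \<subseteq> idx \<and> (\<forall>k\<in>idx. 0 \<le> lookup a k \<and> lookup a k < int l)}"

lemma lookup_outside: "keys a \<subseteq> idx \<Longrightarrow> k \<notin> idx \<Longrightarrow> lookup a k = 0"
  using in_keys_iff[of k a] by blast

lemma boxB_bounds: "a \<in> boxB \<Longrightarrow> 0 \<le> lookup a k \<and> lookup a k < int l"
  using l_gt lookup_outside[of a k] by (cases "k \<in> idx") (auto simp: boxB_def)

lemma boxB_eqI: "a \<in> boxB \<Longrightarrow> b \<in> boxB \<Longrightarrow> latt (a - b) \<Longrightarrow> a = b"
proof (rule poly_mapping_eqI)
  fix k assume ab: "a \<in> boxB" "b \<in> boxB" "latt (a - b)"
  then have "lookup a k mod int l = lookup b k mod int l"
    by (simp add: latt_def lookup_minus mod_eq_dvd_iff del: split_paired_All)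
  then show "lookup a k = lookup b k"
    using boxB_bounds[OF ab(1), of k] boxB_bounds[OF ab(2), of k] by simp
qed

definition emod :: "expo \<Rightarrow> expo" where
  "emod e = (\<Sum>k\<in>idx. single k (lookup e k mod int l))"

lemma lookup_emod: "lookup (emod e) k = (if k \<in> idx then lookup e k mod int l else 0)"
  by (simp add: emod_def lookup_sum_single)

lemma emod_boxB: "emod e \<in> boxB"
  using l_gt by (auto simp: boxB_def lookup_emod in_keys_iff split: if_splits)

lemma latt_emod: "keys e \<subseteq> idx \<Longrightarrow> latt (e - emod e)"
  unfolding latt_def lookup_minus lookup_emod
  using lookup_outside[of e] by (simp add: dvd_minus_mod del: split_paired_All)

lemma boxB_latt_iff: "keys e \<subseteq> idx \<Longrightarrow> b \<in> boxB \<Longrightarrow> latt (e - b) \<longleftrightarrow> b = emod e"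
proof
  assume e: "keys e \<subseteq> idx" and b: "b \<in> boxB" and "latt (e - b)"
  then have "latt (- (e - b) + (e - emod e))" by (intro latt_add latt_uminus latt_emod)
  then have "latt (b - emod e)" by simp
  then show "b = emod e" using boxB_eqI[of b "emod e"] b emod_boxB by blast
qed (auto simp: latt_emod)

lemma finite_boxB [simp]: "finite boxB" and card_boxB: "card boxB = l ^ (n ^ 2)"
proof -
  have bij: "bij_betw (\<lambda>f. \<Sum>k\<in>idx. single k (int (f k))) (idx \<rightarrow>\<^sub>E {..<l}) boxB"
  proof (rule bij_betw_byWitness[where f' = "\<lambda>a. restrict (\<lambda>k. nat (lookup a k)) idx"])
    show "\<forall>f\<in>idx \<rightarrow>\<^sub>E {..<l}. (\<lambda>k\<in>idx. nat (lookup (\<Sum>k\<in>idx. single k (int (f k))) k)) = f"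
    proof (intro ballI ext)
      fix f k assume "f \<in> idx \<rightarrow>\<^sub>E {..<l}"
      then show "(\<lambda>k\<in>idx. nat (lookup (\<Sum>k\<in>idx. single k (int (f k))) k)) k = f k"
        by (cases "k \<in> idx") (use PiE_arb[of f idx _ k] in \<open>simp_all add: lookup_sum_single\<close>)
    qed
    show "\<forall>a\<in>boxB. (\<Sum>k\<in>idx. single k (int ((\<lambda>k\<in>idx. nat (lookup a k)) k))) = a"
    proof (intro ballI poly_mapping_eqI)
      fix a k assume a: "a \<in> boxB"
      then show "lookup (\<Sum>k\<in>idx. single k (int ((\<lambda>k\<in>idx. nat (lookup a k)) k))) k = lookup a k"
        using boxB_bounds[OF a, of k] lookup_outside[of a k] by (cases "k \<in> idx") (simp_all add: lookup_sum_single boxB_def)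
    qed
    show "(\<lambda>f. \<Sum>k\<in>idx. single k (int (f k))) ` (idx \<rightarrow>\<^sub>E {..<l}) \<subseteq> boxB"
    proof (intro image_subsetI)
      fix f assume f: "f \<in> idx \<rightarrow>\<^sub>E {..<l}"
      have "keys (\<Sum>k\<in>idx. single k (int (f k))) \<subseteq> idx"
        by (rule subsetI) (simp add: in_keys_iff lookup_sum_single split: if_splits)
      moreover have "f k < l" if "k \<in> idx" for k using f that by (auto dest: PiE_mem)
      ultimately show "(\<Sum>k\<in>idx. single k (int (f k))) \<in> boxB"
        by (simp add: boxB_def lookup_sum_single)
    qed
    show "(\<lambda>a. \<lambda>k\<in>idx. nat (lookup a k)) ` boxB \<subseteq> idx \<rightarrow>\<^sub>E {..<l}"
    proof (intro image_subsetI restrict_PiE_iff[THEN iffD2] ballI)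
      fix a k assume "a \<in> boxB" "k \<in> idx"
      then show "nat (lookup a k) \<in> {..<l}"
        using boxB_bounds[of a k] by (auto simp: nat_less_iff)
    qed
  qed
  have "finite (idx \<rightarrow>\<^sub>E {..<l})" by (intro finite_PiE) auto
  then show "finite boxB" using bij_betw_finite[OF bij] by simp
  have "card idx = n ^ 2" by (simp add: idx_def power2_eq_square)
  then show "card boxB = l ^ (n ^ 2)"
    using bij_betw_same_card[OF bij] by (simp add: card_PiE)
qed

text \<open>Exponents live on all pairs of naturals; support in \<open>idx\<close> guarantees a
  representative in \<open>boxB\<close>.\<close>

definition supp_idx :: "'k lau \<Rightarrow> bool" where
  "supp_idx f \<longleftrightarrow> (\<forall>e\<in>keys f. keys e \<subseteq> idx)"

text \<open>Each exponent is congruent modulo \<open>l\<close> to exactly one element of the box, so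
  a monomial contributes to a single summand.\<close>

lemma comp_expansion:
  assumes f: "supp_idx f"
  shows "f = (\<Sum>b\<in>boxB. comp b f * single b 1)"
proof -
  have "(\<Sum>b\<in>boxB. comp b (single e c) * single b 1) = single e c"
    if "e \<in> keys f" for e c
  proof -
    have "(\<Sum>b\<in>boxB. comp b (single e c) * single b 1)
        = (\<Sum>b\<in>boxB. if b = emod e then single e c else 0)"
    proof (rule sum.cong[OF refl])
      fix b assume "b \<in> boxB"
      then have "latt (e - b) \<longleftrightarrow> b = emod e" using f that by (intro boxB_latt_iff) (auto simp: supp_idx_def)
      then show "comp b (single e c) * single b 1 = (if b = emod e then single e c else 0)"
        unfolding comp_single by (auto simp: mult_single)
    qed
    then show ?thesis by (simp add: emod_boxB)
  qed
  then have "(\<Sum>e\<in>keys f. \<Sum>b\<in>boxB. comp b (single e (lookup f e)) * single b 1)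
     = (\<Sum>e\<in>keys f. single e (lookup f e))"
    by (intro sum.cong) auto
  then have "(\<Sum>e\<in>keys f. \<Sum>b\<in>boxB. comp b (single e (lookup f e)) * single b 1) = f"
    using poly_mapping_as_sum[of f] by simp
  moreover have "comp b f = (\<Sum>e\<in>keys f. comp b (single e (lookup f e)))" for b
    using arg_cong[OF poly_mapping_as_sum[of f], of "comp b"] by (simp only: comp_sum)
  then have "(\<Sum>b\<in>boxB. comp b f * single b 1)
      = (\<Sum>b\<in>boxB. \<Sum>e\<in>keys f. comp b (single e (lookup f e)) * single b 1)"
    by (simp only: sum_distrib_right)
  ultimately show ?thesis by (simp only: sum.swap[of _ boxB])
qed

lemma comp_CT: "comp b f \<in> CT"
proof -
  have "keys (comp b f) \<subseteq> (\<Union>e\<in>keys f.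
      keys (if latt (e - b) then single (e - b) (lookup f e) else 0))"
    unfolding comp_def by (rule keys_sum)
  then show ?thesis by (auto simp: CT_def split: if_splits)
qed

lemma CT_mult: "g \<in> CT \<Longrightarrow> h \<in> CT \<Longrightarrow> g * h \<in> CT"
  using keys_mult[of g h] latt_add unfolding CT_def by blast
lemma CT_add: "g \<in> CT \<Longrightarrow> h \<in> CT \<Longrightarrow> g + h \<in> CT"
  using Poly_Mapping.keys_add[of g h] unfolding CT_def by blast
lemma CT_scalar: "single 0 c \<in> CT"
  by (auto simp: CT_def)
lemma tm_mulop_CT:
  assumes "g \<in> CT" shows "tm a * mulop g = mulop g * tm a"
proof -
  have 1: "tm a * mulop (single d c) = mulop (single d c) * tm a" if "latt d" for d c
    using \<beta>_latt(2)[OF that, of a]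
    by (intro linop_eqI_single) (simp add: mult_single \<beta>_add_right power_int_add eps_powi_dvd algebra_simps)
  have "tm a * mulop (\<Sum>d\<in>keys g. single d (lookup g d))
     = mulop (\<Sum>d\<in>keys g. single d (lookup g d)) * tm a"
    using assms by (simp add: mulop_sum sum_distrib_left sum_distrib_right 1 CT_def)
  then show ?thesis using poly_mapping_as_sum[of g] by simp
qed

lemma Tspan_mulop_CT: "f \<in> Tspan A \<Longrightarrow> g \<in> CT \<Longrightarrow> f * mulop g = mulop g * f"
proof (induction rule: Tspan.induct)
  case (Tspan_step a f c)
  have "scal c * tm a * mulop g = mulop g * (scal c * tm a)"
    using tm_mulop_CT[OF Tspan_step(4), of a] by (simp add: mult.assoc scal_left_commute[of "mulop g"])
  then show ?case using Tspan_step by (simp add: distrib_left distrib_right)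
qed simp

lemma app_Tspan_CT: "f \<in> Tspan A \<Longrightarrow> g \<in> CT \<Longrightarrow> app f (g * u) = g * app f u"
  using arg_cong[OF Tspan_mulop_CT, of f A g "\<lambda>h. app h u"] by simp

lemma supp_idx_app:
  assumes "f \<in> Tspan idx" "supp_idx u" shows "supp_idx (app f u)"
  unfolding supp_idx_def
proof
  fix e assume "e \<in> keys (app f u)"
  then obtain a b where "e = a + b" "keys a \<subseteq> idx" "b \<in> keys u"
    using keys_app_Tspan[OF assms(1)] by blast
  then show "keys e \<subseteq> idx"
    using Poly_Mapping.keys_add[of a b] assms(2) unfolding supp_idx_def by blast
qed

lemma supp_idx_1: "supp_idx 1"
  by (auto simp: supp_idx_def)

text \<open>Operators in \<open>Tspan idx\<close> are linear over the central subring
  \<open>CT\<close>, so they act on coordinates through a matrix.\<close>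

lemma comp_app:
  assumes "f \<in> Tspan idx" "supp_idx u"
  shows "comp a (app f u) = (\<Sum>b\<in>boxB. comp a (app f (single b 1)) * comp b u)"
proof -
  have "comp a (app f u) = comp a (app f (\<Sum>b\<in>boxB. comp b u * single b 1))"
    using comp_expansion[OF assms(2)] by simp
  also have "\<dots> = (\<Sum>b\<in>boxB. comp b u * comp a (app f (single b 1)))"
    by (simp add: app_sum comp_sum app_Tspan_CT[OF assms(1) comp_CT] comp_CT_mult[OF comp_CT])
  finally show ?thesis by (simp add: mult.commute)
qed

lemma comp_scalar: "comp b (single 0 c * f) = single 0 c * comp b f"
  by (rule comp_CT_mult[OF CT_scalar])

text \<open>A diagonal entry of \<open>tm a\<close> is nonzero only if \<open>a\<close> lies in the
  lattice, and then \<open>\<epsilon> powi \<beta> a b\<close> is 1. All diagonal entries therefore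
  agree with the one at exponent 0.\<close>

lemma trace_formula:
  "f \<in> Tspan idx \<Longrightarrow> (\<Sum>b\<in>boxB. comp b (app f (single b 1))) = of_nat (card boxB) * comp 0 (app f 1)"
proof (induction rule: Tspan.induct)
  case (Tspan_step a f c)
  have "comp b (app (tm a) (single b 1)) = comp 0 (app (tm a) 1)" for b
    by (simp add: comp_single eps_powi_dvd \<beta>_latt(1) flip: single_one)
  then show ?case using Tspan_step
    by (simp add: comp_add comp_scalar sum.distrib flip: sum_distrib_left) (simp add: algebra_simps)
qed simp

text \<open>Up to the factor \<open>card boxB\<close> from \<open>trace_formula\<close>, this is the
  trace form on the torus monomials.\<close>

definition Gram :: "expo \<Rightarrow> expo \<Rightarrow> 'k lau" where
  "Gram a b = comp 0 (single (a + b) (\<epsilon> powi \<beta> a b))"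

text \<open>A monomial \<open>d\<close> differs from its reduction \<open>emod d\<close> by a
  lattice exponent. Such a factor changes neither the power of \<epsilon> nor whether the sum with
  \<open>b\<close> lies in the lattice.\<close>

lemma comp_0_Gram:
  assumes b: "b \<in> boxB"
  shows "f \<in> Tspan idx \<Longrightarrow> comp 0 (app f (single b 1)) = (\<Sum>a\<in>boxB. comp a (app f 1) * Gram a b)"
proof (induction rule: Tspan.induct)
  case (Tspan_step d f c)
  let ?a = "emod d"
  have d: "latt (d - ?a)" using latt_emod Tspan_step by blast
  have "(\<Sum>a\<in>boxB. comp a (app (tm d) 1) * Gram a b) = (\<Sum>a\<in>boxB. if a = ?a then comp 0 (app (tm d) (single b 1)) else 0)"
  proof (rule sum.cong[OF refl])
    fix a assume a: "a \<in> boxB"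
    have iff: "latt (d - a) \<longleftrightarrow> a = ?a" using Tspan_step a by (intro boxB_latt_iff)
    show "comp a (app (tm d) 1) * Gram a b = (if a = ?a then comp 0 (app (tm d) (single b 1)) else 0)"
    proof (cases "a = ?a")
      case True
      have e1: "latt (a + b) \<longleftrightarrow> latt (d + b)"
        using latt_add_cancel[OF d, of "?a + b"] True by (simp add: algebra_simps)
      have "\<beta> d b = \<beta> (d - ?a) b + \<beta> a b" using \<beta>_add_left[of "d - ?a" a b] True by simp
      then have e2: "\<epsilon> powi \<beta> d b = \<epsilon> powi \<beta> a b"
        using eps_powi_dvd[OF \<beta>_latt(1)[OF d, of b]] by (simp add: power_int_add)
      have "comp a (app (tm d) 1) = single (d - a) 1"
        using d True by (simp add: comp_single flip: single_one)
      then show ?thesis using True e1 e2 by (simp add: Gram_def comp_single mult_single algebra_simps)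
    next
      case False
      then have "comp a (app (tm d) 1) = 0" using iff by (simp add: comp_single flip: single_one)
      then show ?thesis using False by simp
    qed
  qed
  then have "(\<Sum>a\<in>boxB. comp a (app (tm d) 1) * Gram a b) = comp 0 (app (tm d) (single b 1))"
    by (simp add: emod_boxB)
  then show ?case using Tspan_step
    by (simp add: comp_add comp_scalar distrib_right sum.distrib mult.assoc flip: sum_distrib_left)
qed simp

lemma comp_0_mult:
  assumes "f \<in> Tspan idx" "g \<in> Tspan idx"
  shows "comp 0 (app (f * g) 1) = (\<Sum>a\<in>boxB. \<Sum>b\<in>boxB. comp a (app f 1) * (Gram a b * comp b (app g 1)))"
proof -
  have "comp 0 (app (f * g) 1) = (\<Sum>b\<in>boxB. comp 0 (app f (single b 1)) * comp b (app g 1))"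
    using comp_app[OF assms(1) supp_idx_app[OF assms(2) supp_idx_1]] by simp
  also have "\<dots> = (\<Sum>b\<in>boxB. \<Sum>a\<in>boxB. comp a (app f 1) * (Gram a b * comp b (app g 1)))"
    by (intro sum.cong refl) (simp add: comp_0_Gram[OF _ assms(1)] sum_distrib_right mult.assoc)
  finally show ?thesis by (subst sum.swap)
qed


section \<open>The Gram determinant of the torus monomials\<close>

abbreviation NN :: nat where "NN \<equiv> l ^ (n ^ 2)"

text \<open>The increasing order is what will make the coordinate matrix of the ordered monomials
  triangular.\<close>

definition box_nth :: "nat \<Rightarrow> expo" where "box_nth i = sorted_list_of_set boxB ! i"

lemma box_nth_bij: "bij_betw box_nth {..<NN} boxB"
  unfolding box_nth_def[abs_def]
  by (rule bij_betw_nth) (simp_all add: card_boxB[symmetric])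

lemma box_nth_boxB: "i < NN \<Longrightarrow> box_nth i \<in> boxB"
  using box_nth_bij by (auto simp: bij_betw_def)

lemma box_nth_less: "i < j \<Longrightarrow> j < NN \<Longrightarrow> box_nth i < box_nth j"
  using sorted_wrt_nth_less[OF strict_sorted_list_of_set[of boxB], of i j]
  by (simp add: box_nth_def card_boxB)

lemma sum_boxB_box_nth: "(\<Sum>b\<in>boxB. f b) = (\<Sum>i<NN. f (box_nth i))"
  using sum.reindex_bij_betw[OF box_nth_bij, of f] by simp

text \<open>Negation modulo \<open>l\<close> is an involution of the box; it pairs the monomials
  with a nonzero Gram entry.\<close>

lemma emod_neg_neg: "a \<in> boxB \<Longrightarrow> emod (- emod (- a)) = a"
proof -
  assume a: "a \<in> boxB"
  then have ka: "keys (- a) \<subseteq> idx" by (simp add: boxB_def)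
  have km: "keys (- emod (- a)) \<subseteq> idx" using emod_boxB[of "- a"] by (simp add: boxB_def)
  have "- a - emod (- a) = - emod (- a) - a" by simp
  with latt_emod[OF ka] have "latt (- emod (- a) - a)" by (rule back_subst)
  then show ?thesis using boxB_latt_iff[OF km a] by simp
qed

definition GramM :: "'k lau mat" where
  "GramM = mat NN NN (\<lambda>(i, j). of_nat NN * Gram (box_nth i) (box_nth j))"

text \<open>By the reflection \<open>b \<mapsto> (l - 1, \<dots>, l - 1) - b\<close> of the box.\<close>

lemma sum_boxB_double:
  "(\<Sum>b\<in>boxB. b) + (\<Sum>b\<in>boxB. b) = (\<Sum>k\<in>idx. single k (int (NN * (l - 1))))"
proof (rule poly_mapping_eqI)
  fix k
  show "lookup ((\<Sum>b\<in>boxB. b) + (\<Sum>b\<in>boxB. b)) k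
      = lookup (\<Sum>k\<in>idx. single k (int (NN * (l - 1)))) k"
  proof (cases "k \<in> idx")
    case False
    then have "lookup b k = 0" if "b \<in> boxB" for b
      using that lookup_outside[of b k] by (simp add: boxB_def)
    then show ?thesis by (subst lookup_sum_single[OF finite_idx]) (simp add: False lookup_add lookup_sum)
  next
    case True
    define top where "top = (\<Sum>k\<in>idx. single k (int l - 1))"
    have lt: "lookup top j = (if j \<in> idx then int l - 1 else 0)" for j
      by (simp add: top_def lookup_sum_single)
    have refl: "top - b \<in> boxB" if b: "b \<in> boxB" for b
    proof -
      have "keys (top - b) \<subseteq> idx"
      proof
        fix j assume "j \<in> keys (top - b)"
        then show "j \<in> idx" using lookup_outside[of b j] b
          by (cases "j \<in> idx") (simp_all add: in_keys_iff lookup_minus lt boxB_def)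
      qed
      moreover have "0 \<le> lookup (top - b) k \<and> lookup (top - b) k < int l"
        if "k \<in> idx" for k
        using boxB_bounds[OF b, of k] that by (simp add: lookup_minus lt)
      ultimately show ?thesis by (simp add: boxB_def)
    qed
    have "(\<Sum>b\<in>boxB. lookup b k) = (\<Sum>b\<in>boxB. int l - 1 - lookup b k)"
      by (rule sum.reindex_bij_witness[where i = "\<lambda>b. top - b" and j = "\<lambda>b. top - b"])
        (use refl True in \<open>simp_all add: lookup_minus lt\<close>)
    also have "\<dots> = int NN * (int l - 1) - (\<Sum>b\<in>boxB. lookup b k)"
      by (simp add: sum_subtractf card_boxB)
    finally show ?thesis using True l_gt
      by (subst lookup_sum_single[OF finite_idx]) (simp add: lookup_add lookup_sum of_nat_diff)
  qed
qed

lemma tau_power: "tau k ^ m = single (single k (int (m * l))) 1"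
  by (induction m) (simp_all add: tau_def mult_single single_add[symmetric] algebra_simps)

text \<open>Row \<open>b\<close> has its only nonzero entry in column \<open>emod (- b)\<close>.
  Each box exponent thus occurs twice in the product, once as a row and once as a column, and
  \<open>sum_boxB_double\<close> gives the total \<open>NN * (l - 1)\<close> in every coordinate.
  Each \<open>tau\<close> already carries a factor \<open>l\<close>, which explains the exponent.
  The constant is nonzero because the characteristic is 0.\<close>

lemma det_GramM:
  "\<exists>c. c \<noteq> 0 \<and> det GramM = single 0 c * (\<Prod>k\<in>idx. tau k) ^ (l ^ (n ^ 2 - 1) * (l - 1))"
proof -
  define ix where "ix = the_inv_into {..<NN} box_nth"
  have ix: "ix b < NN" "box_nth (ix b) = b" if "b \<in> boxB" for b
  proof -
    show "box_nth (ix b) = b" unfolding ix_def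
      by (rule f_the_inv_into_f_bij_betw[OF box_nth_bij that])
    have "ix b \<in> {..<NN}" using bij_betw_the_inv_into[OF box_nth_bij] that by (auto simp: ix_def bij_betw_def)
    then show "ix b < NN" by simp
  qed
  have ixen: "ix (box_nth i) = i" if "i < NN" for i
    using that box_nth_bij by (simp add: ix_def the_inv_into_f_f bij_betw_def)
  define p where "p i = (if i < NN then ix (emod (- box_nth i)) else i)" for i
  have p_lt: "p i < NN" "box_nth (p i) = emod (- box_nth i)" if "i < NN" for i
    using that ix[OF emod_boxB] by (simp_all add: p_def)
  have pp: "p (p i) = i" if "i < NN" for i
  proof -
    have "p (p i) = ix (emod (- box_nth (p i)))" using p_lt(1)[OF that] by (simp add: p_def)
    then show ?thesis using that by (simp add: p_lt(2) emod_neg_neg box_nth_boxB ixen)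
  qed
  have bij: "bij_betw p {..<NN} {..<NN}"
    by (rule bij_betw_byWitness[where f' = p]) (use pp p_lt in auto)
  have perm: "p permutes {0..<NN}"
    using bij by (intro bij_imp_permutes) (auto simp: lessThan_atLeast0 p_def)
  define c where "c = (\<Prod>i<NN. of_nat NN * \<epsilon> powi \<beta> (box_nth i) (box_nth (p i)))"
  have nz: "c \<noteq> 0" using l_gt by (simp add: c_def)
  have z: "(case (i, j) of (i, j) \<Rightarrow> of_nat NN * Gram (box_nth i) (box_nth j)) = 0" if "i < NN" "j < NN" "j \<noteq> p i" for i j
  proof -
    have k: "keys (- box_nth i) \<subseteq> idx" using box_nth_boxB[OF that(1)] by (simp add: boxB_def)
    have "\<not> latt (box_nth i + box_nth j)"
    proof
      assume "latt (box_nth i + box_nth j)"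
      then have "latt (- (box_nth i + box_nth j))" by (rule latt_uminus)
      then have "latt (- box_nth i - box_nth j)" by simp
      then have "box_nth j = box_nth (p i)" using boxB_latt_iff[OF k box_nth_boxB[OF that(2)]] p_lt(2)[OF that(1)] by simp
      then show False using that ixen p_lt(1)[OF that(1)] by metis
    qed
    then show ?thesis by (simp add: Gram_def comp_single)
  qed
  have val: "of_nat NN * Gram (box_nth i) (box_nth (p i)) = single (box_nth i + box_nth (p i)) (of_nat NN * \<epsilon> powi \<beta> (box_nth i) (box_nth (p i)))"
    if "i < NN" for i
  proof -
    have k: "keys (- box_nth i) \<subseteq> idx" using box_nth_boxB[OF that(1)] by (simp add: boxB_def)
    have "latt (- (- box_nth i - emod (- box_nth i)))" by (rule latt_uminus[OF latt_emod[OF k]])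
    then have "latt (box_nth i + box_nth (p i))" using p_lt(2)[OF that] by (simp add: algebra_simps)
    then show ?thesis by (simp add: Gram_def comp_single mult_single flip: single_of_nat)
  qed
  have "det GramM = signof p * (\<Prod>i<NN. case (i, p i) of (i, j) \<Rightarrow> of_nat NN * Gram (box_nth i) (box_nth j))"
    unfolding GramM_def by (rule det_monomial_matrix[OF perm]) (rule z)
  also have "(\<Prod>i<NN. case (i, p i) of (i, j) \<Rightarrow> of_nat NN * Gram (box_nth i) (box_nth j))
      = (\<Prod>i<NN. single (box_nth i + box_nth (p i)) (of_nat NN * \<epsilon> powi \<beta> (box_nth i) (box_nth (p i))))"
    by (intro prod.cong refl) (simp only: val lessThan_iff prod.case)
  also have "\<dots> = single ((\<Sum>i<NN. box_nth i) + (\<Sum>i<NN. box_nth (p i))) c"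
    by (simp only: prod_single c_def sum.distrib)
  also have "(\<Sum>i<NN. box_nth (p i)) = (\<Sum>i<NN. box_nth i)"
    by (rule sum.reindex_bij_betw[OF bij])
  also have "(\<Sum>i<NN. box_nth i) + (\<Sum>i<NN. box_nth i) = (\<Sum>k\<in>idx. single k (int (NN * (l - 1))))"
    using sum_boxB_double by (simp only: sum_boxB_box_nth[of "\<lambda>b. b"])
  also have "single (\<Sum>k\<in>idx. single k (int (NN * (l - 1)))) c
     = single 0 c * (\<Prod>k\<in>idx. tau k) ^ (l ^ (n ^ 2 - 1) * (l - 1))"
  proof -
    have "l ^ (n ^ 2) = l ^ (n ^ 2 - 1) * l"
      using n_pos by (metis power_minus_mult zero_less_power)
    then have "l ^ (n ^ 2 - 1) * (l - 1) * l = NN * (l - 1)" by simp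
    then show ?thesis
      by (simp only: prod_power_distrib tau_power prod_single) (simp add: mult_single)
  qed
  finally have "det GramM = signof p * (single 0 c * (\<Prod>k\<in>idx. tau k) ^ (l ^ (n ^ 2 - 1) * (l - 1)))" .
  moreover have "(signof p :: 'k lau) = single 0 (signof p)"
    by (simp add: sign_def single_uminus)
  ultimately have "det GramM = single 0 (signof p * c) * (\<Prod>k\<in>idx. tau k) ^ (l ^ (n ^ 2 - 1) * (l - 1))"
    by (simp only: mult.assoc[symmetric] mult_single add_0)
  moreover have "(signof p * c :: 'k) \<noteq> 0" using nz by (simp add: sign_def)
  ultimately show ?thesis by blast
qed

section \<open>Torus coordinates of ordered monomials\<close>

definition expo_word :: "expo \<Rightarrow> (nat \<times> nat) list" where
  "expo_word a = concat (map (\<lambda>k. replicate (nat (lookup a k)) k) (sorted_list_of_set idx))"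

lemma sorted_concat_replicate: "sorted ks \<Longrightarrow> sorted (concat (map (\<lambda>k. replicate (f k) k) (ks :: 'a::linorder list)))"
  by (induction ks) (auto simp: sorted_append)

lemma expo_word_ordered: "expo_word a \<in> ordered_words"
  by (auto simp: ordered_words_def expo_word_def intro!: sorted_concat_replicate)

lemma count_concat_replicate:
  "distinct ks \<Longrightarrow> count (mset (concat (map (\<lambda>k. replicate (f k) k) ks))) j = (if j \<in> set ks then f j else 0)"
  by (induction ks) auto

lemma word_content_expo_word:
  assumes "keys a \<subseteq> idx" "\<And>k. 0 \<le> lookup a k"
  shows "word_content (expo_word a) = a"
proof (rule poly_mapping_eqI)
  fix k
  show "lookup (word_content (expo_word a)) k = lookup a k"
    using assms lookup_outside[of a k] by (simp add: lookup_word_content expo_word_def count_concat_replicate)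
qed

lemma word_content_expo_word_box: "a \<in> boxB \<Longrightarrow> word_content (expo_word a) = a"
proof (rule word_content_expo_word)
  show "0 \<le> lookup a k" if "a \<in> boxB" for k using boxB_bounds[OF that, of k] by simp
qed (simp add: boxB_def)

lemma xw_expo_word: "xw (expo_word a) = prod_list (map (\<lambda>k. xgen k ^ nat (lookup a k)) (sorted_list_of_set idx))"
proof -
  have "xw (concat (map (\<lambda>k. replicate (f k) k) ks)) = prod_list (map (\<lambda>k. xgen k ^ f k) ks)" for f ks
    by (induction ks) (simp_all add: xw_def prod_list_replicate)
  then show ?thesis by (simp add: expo_word_def)
qed

text \<open>An exponent other than \<open>a\<close> first deviates from \<open>a\<close> by a drop
  to a value in \<open>[0, l)\<close>. Reduction modulo \<open>l\<close> fixes that entry and all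
  entries before it, so the reduced exponent is still below \<open>a\<close>.\<close>

lemma comp_xw_expo_word_less:
  assumes ab: "a \<in> boxB" "b \<in> boxB" and nz: "comp b (app (xw (expo_word a)) 1) \<noteq> 0"
  shows "b \<le> a"
proof -
  obtain e where e: "e \<in> keys (app (xw (expo_word a)) 1)" "latt (e - b)"
  proof -
    have "\<exists>e\<in>keys (app (xw (expo_word a)) 1). (if latt (e - b) then
        single (e - b) (lookup (app (xw (expo_word a)) 1) e) else 0) \<noteq> 0"
      using nz unfolding comp_def by (rule contrapos_np) (simp add: sum.neutral)
    then show ?thesis using that by (auto split: if_splits)
  qed
  from xw_coeff(2)[OF expo_word_ordered e(1)] have "e = a \<or> drops e a" by (simp add: word_content_expo_word_box ab)
  moreover have keys: "keys e \<subseteq> idx" using xw_coeff(3)[OF expo_word_ordered e(1)] .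
  have b: "b = emod e" using boxB_latt_iff[OF keys ab(2)] e(2) by simp
  moreover have "b < a" if "drops e a"
  proof -
    obtain k where k: "\<forall>k'<k. lookup e k' = lookup a k'"
      "0 \<le> lookup e k" "lookup e k < lookup a k"
      using \<open>drops e a\<close> by (auto simp: drops_def)
    have m: "lookup b k' = lookup e k'"
      if "0 \<le> lookup e k'" "lookup e k' < int l" for k'
      using that lookup_outside[OF keys, of k'] by (simp add: b lookup_emod)
    have "lookup b k' = lookup a k'" if "k' < k" for k'
      using m[of k'] k(1) that boxB_bounds[OF ab(1), of k'] by simp
    moreover have "lookup b k < lookup a k"
      using m[of k] k boxB_bounds[OF ab(1), of k] by simp
    ultimately show ?thesis unfolding less_poly_mapping.rep_eq less_fun_def by blast
  qed
  moreover have "emod a = a" using boxB_latt_iff[of a a] ab(1) by (simp add: boxB_def)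
  ultimately show ?thesis by (auto simp: less_imp_le)
qed

text \<open>At the dropped entry an exponent stays different from \<open>a\<close> after reduction
  modulo \<open>l\<close>, so \<open>a\<close> is the only exponent in its class.\<close>

lemma comp_xw_expo_word_diag:
  assumes a: "a \<in> boxB"
  shows "comp a (app (xw (expo_word a)) 1) = 1"
proof -
  let ?f = "app (xw (expo_word a)) 1"
  have "comp a ?f = (\<Sum>e\<in>{a}. if latt (e - a) then single (e - a) (lookup ?f e) else 0)"
    unfolding comp_def
  proof (rule sum.mono_neutral_right)
    have one: "lookup ?f a = 1" using xw_coeff(1)[OF expo_word_ordered, of a] by (simp add: word_content_expo_word_box a)
    then show "{a} \<subseteq> keys ?f" by (simp add: in_keys_iff)
    show "\<forall>e\<in>keys ?f - {a}. (if latt (e - a) then single (e - a) (lookup ?f e) else 0) = 0"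
    proof
      fix e assume e: "e \<in> keys ?f - {a}"
      then have d: "drops e a" using xw_coeff(2)[OF expo_word_ordered, of e a] by (simp add: word_content_expo_word_box a)
      have keys: "keys e \<subseteq> idx" using xw_coeff(3)[OF expo_word_ordered, of e a] e by simp
      obtain k where k: "0 \<le> lookup e k" "lookup e k < lookup a k"
        using d by (auto simp: drops_def)
      have "\<not> latt (e - a)"
      proof
        assume "latt (e - a)"
        then have ae: "a = emod e" using boxB_latt_iff[OF keys a] by simp
        have "lookup e k < int l" using k boxB_bounds[OF a, of k] by simp
        then have "lookup (emod e) k = lookup e k"
          using k(1) lookup_outside[OF keys, of k] by (simp add: lookup_emod)
        then have "lookup a k = lookup e k" using ae by simp
        then show False using k by simp
      qed
      then show "(if latt (e - a) then single (e - a) (lookup ?f e) else 0) = 0" by simp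
    qed
  qed simp
  then show ?thesis using xw_coeff(1)[OF expo_word_ordered, of a] by (simp add: word_content_expo_word_box a)
qed

text \<open>The total degree is positive on the \<open>z\<^sub>i\<^sub>j\<close>, so the units of the central subalgebra are
  scalars.\<close>

definition deg :: "expo \<Rightarrow> int" where "deg e = (\<Sum>k\<in>idx. lookup e k)"

lemma deg_add: "deg (a + b) = deg a + deg b" by (simp add: deg_def lookup_add sum.distrib)
lemma deg_0 [simp]: "deg 0 = 0" by (simp add: deg_def)
lemma deg_single: "k \<in> idx \<Longrightarrow> deg (single k x) = x"
  by (simp add: deg_def lookup_single when_def)

text \<open>Since exponents may be negative, nonnegative degree alone would admit nonconstant
  monomials of degree 0; the second clause excludes them.\<close>

definition nonneg_deg :: "'k lau \<Rightarrow> bool" where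
  "nonneg_deg g \<longleftrightarrow> (\<forall>e\<in>keys g. 0 \<le> deg e \<and> (deg e = 0 \<longrightarrow> e = 0))"

lemma nonneg_deg_add: "nonneg_deg g \<Longrightarrow> nonneg_deg h \<Longrightarrow> nonneg_deg (g + h)"
  using Poly_Mapping.keys_add[of g h] unfolding nonneg_deg_def by blast
lemma nonneg_deg_uminus: "nonneg_deg g \<Longrightarrow> nonneg_deg (- g)"
  by (simp add: nonneg_deg_def)
lemma nonneg_deg_scalar: "nonneg_deg (single 0 c)"
  by (simp add: nonneg_deg_def)
lemma nonneg_deg_mult: "nonneg_deg g \<Longrightarrow> nonneg_deg h \<Longrightarrow> nonneg_deg (g * h)"
  unfolding nonneg_deg_def
proof
  fix e assume g: "\<forall>e\<in>keys g. 0 \<le> deg e \<and> (deg e = 0 \<longrightarrow> e = 0)"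
    and h: "\<forall>e\<in>keys h. 0 \<le> deg e \<and> (deg e = 0 \<longrightarrow> e = 0)"
    and "e \<in> keys (g * h)"
  then obtain a b where "e = a + b" "a \<in> keys g" "b \<in> keys h"
    using keys_mult[of g h] by blast
  with g[rule_format, of a] h[rule_format, of b] show "0 \<le> deg e \<and> (deg e = 0 \<longrightarrow> e = 0)"
    by (auto simp: deg_add)
qed

text \<open>The product of the largest terms of \<open>g\<close> and \<open>h\<close> cannot cancel,
  so their exponents add up to 0 and both have degree 0. The order compares degrees first, and hence
  every exponent of \<open>g\<close> has degree at most 0.\<close>

lemma nonneg_deg_unit:
  assumes gh: "g * h = 1" and g: "nonneg_deg g" and h: "nonneg_deg h"
  shows "\<exists>u. u \<noteq> 0 \<and> g = single 0 u"
proof -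
  have nz: "g \<noteq> 0" "h \<noteq> 0" using gh by auto
  define F where "F e = (deg e, e)" for e
  have top: "\<exists>e\<in>keys f. \<forall>e'\<in>keys f. F e' \<le> F e" if "f \<noteq> 0" for f :: "'k lau"
  proof -
    have ne: "finite (F ` keys f)" "F ` keys f \<noteq> {}" using that by auto
    have "Max (F ` keys f) \<in> F ` keys f" by (rule Max_in[OF ne])
    then obtain e where "e \<in> keys f" "F e = Max (F ` keys f)" by auto
    then show ?thesis using Max_ge[OF ne(1)] by (intro bexI[of _ e]) auto
  qed
  obtain d where d: "d \<in> keys g" "\<And>e. e \<in> keys g \<Longrightarrow> F e \<le> F d" using top[OF nz(1)] by blast
  obtain e where e: "e \<in> keys h" "\<And>e'. e' \<in> keys h \<Longrightarrow> F e' \<le> F e" using top[OF nz(2)] by blast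
  have uniq: "u = d \<and> v = e" if "u \<in> keys g" "v \<in> keys h" "u + v = d + e" for u v
  proof -
    have le: "F u \<le> F d" "F v \<le> F e" using d e that by auto
    then have dl: "deg u \<le> deg d" "deg v \<le> deg e" by (auto simp: F_def less_eq_prod_def)
    have "deg u + deg v = deg d + deg e" using that(3) deg_add by metis
    then have "deg u = deg d" "deg v = deg e" using dl by auto
    then have "u \<le> d" "v \<le> e" using le by (auto simp: F_def less_eq_prod_def)
    then show ?thesis using that(3) by (metis add_le_cancel_left add_right_cancel antisym add_mono order.refl add_left_cancel)
  qed
  have "lookup (g * h) (d + e) = (\<Sum>u\<in>keys g. \<Sum>v\<in>keys h.
      if u = d \<and> v = e then lookup g d * lookup h e else 0)"
    unfolding poly_mapping_mult_as_sum lookup_sum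
    by (intro sum.cong refl) (use uniq in \<open>auto simp: lookup_single when_def\<close>)
  also have "\<dots> = (\<Sum>u\<in>keys g. if u = d then lookup g d * lookup h e else 0)"
    using e(1) by (intro sum.cong refl) simp
  also have "\<dots> = lookup g d * lookup h e"
    using d(1) by simp
  finally have "lookup (g * h) (d + e) \<noteq> 0" using d(1) e(1) by (simp add: in_keys_iff)
  then have "d + e \<in> keys (1 :: 'k lau)" unfolding in_keys_iff[symmetric] gh .
  then have "d + e = 0" by simp
  then have "deg d + deg e = 0" using deg_add[of d e] by simp
  moreover have "0 \<le> deg d" "0 \<le> deg e" using g h d e by (auto simp: nonneg_deg_def)
  ultimately have d0: "deg d = 0" by simp
  have "e' = 0" if "e' \<in> keys g" for e'
  proof -
    have "deg e' \<le> 0" using d(2)[OF that] d0 by (auto simp: F_def less_eq_prod_def)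
    then show ?thesis using g that by (auto simp: nonneg_deg_def)
  qed
  then have "g = single 0 (lookup g 0)"
    by (intro poly_mapping_eqI) (auto simp: lookup_single when_def in_keys_iff)
  then show ?thesis using nz by (metis single_zero)
qed

text \<open>The recursion is homogeneous: in each summand the inverse variable lowers the degree
  \<open>l\<close> of the old entry to 0, and the final \<open>tau\<close> restores it.\<close>

lemma zeta_CT_deg:
  assumes "i \<in> {1..m}" "m \<le> n" "j \<in> {1..n}" "e \<in> keys (zeta m i j)"
  shows "latt e \<and> deg e = int l"
  using assms
proof (induction m arbitrary: i j e)
  case (Suc m)
  have tau: "latt d \<and> deg d = int l" if "d \<in> keys (tau (Suc m, s))" "s \<in> {1..n}" for s d
    using that Suc.prems by (auto simp: tau_def latt_def lookup_single when_def deg_single idx_iff)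
  show ?case
  proof (cases "i = Suc m")
    case True
    then show ?thesis using Suc.prems tau[of e j] by simp
  next
    case False
    have summand: "latt d \<and> deg d = 0" if s: "s \<in> {j..n}" and d: "d \<in> keys (zeta m i s * taui (Suc m, s))" for s d
    proof -
      obtain a b where ab: "d = a + b" "a \<in> keys (zeta m i s)" "b \<in> keys (taui (Suc m, s))"
        using keys_mult[of "zeta m i s" "taui (Suc m, s)"] d by blast
      have "latt a \<and> deg a = int l" using Suc.IH[of i s a] Suc.prems False s ab by auto
      moreover have "latt b \<and> deg b = - int l" using ab(3) Suc.prems s
        by (auto simp: taui_def latt_def lookup_single when_def deg_single idx_iff)
      ultimately show ?thesis by (auto simp: ab(1) latt_add deg_add)
    qed
    obtain a b where ab: "e = a + b" "a \<in> keys (\<Sum>s\<in>{j..n}. zeta m i s * taui (Suc m, s))"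
      "b \<in> keys (tau (Suc m, j))"
      using Suc.prems(4) False keys_mult[of "\<Sum>s\<in>{j..n}. zeta m i s * taui (Suc m, s)" "tau (Suc m, j)"] by auto
    have "latt a \<and> deg a = 0" using ab(2) keys_sum[of "\<lambda>s. zeta m i s * taui (Suc m, s)" "{j..n}"] summand by blast
    then show ?thesis using tau[OF ab(3) Suc.prems(3)] by (auto simp: ab(1) latt_add deg_add)
  qed
qed simp

lemma zeta_CT: "(i, j) \<in> idx \<Longrightarrow> zeta n i j \<in> CT"
  using zeta_CT_deg[of i n j] by (auto simp: CT_def idx_iff)

lemma zeta_nonneg_deg: "(i, j) \<in> idx \<Longrightarrow> nonneg_deg (zeta n i j)"
  using zeta_CT_deg[of i n j] l_gt by (auto simp: nonneg_deg_def idx_iff)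

end

section \<open>The central subalgebra\<close>

text \<open>Bridges determinants indexed from 1, as in the discriminant, and matrices indexed from
  0.\<close>

lemma sum_permutes_Suc:
  fixes f :: "nat \<Rightarrow> nat \<Rightarrow> 'a::comm_ring_1"
  shows "(\<Sum>p | p permutes {1..m}. of_int (sign p) * (\<Prod>i\<in>{1..m}. f i (p i)))
    = det (mat m m (\<lambda>(i, j). f (Suc i) (Suc j)))"
proof -
  have bij: "bij_betw Suc {0..<m} {1..m}" by (auto simp: bij_betw_def image_Suc_atLeastLessThan)
  have img: "Suc ` {0..<m} = {1..m}" using bij by (simp add: bij_betw_def)
  have bij': "bij_betw (\<lambda>i. i - 1) {1..m} {0..<m}"
    by (rule bij_betw_byWitness[where f' = Suc]) auto
  have perm: "map_permutation {0..<m} Suc q permutes {1..m}" if "q permutes {0..<m}" for q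
    by (rule map_permutation_permutes[OF bij that])
  have perm': "map_permutation {1..m} (\<lambda>i. i - 1) q permutes {0..<m}" if "q permutes {1..m}" for q
    by (rule map_permutation_permutes[OF bij' that])
  have "det (mat m m (\<lambda>(i, j). f (Suc i) (Suc j)))
     = (\<Sum>q | q permutes {0..<m}. signof q * (\<Prod>i = 0..<m. mat m m (\<lambda>(i, j). f (Suc i) (Suc j)) $$ (i, q i)))"
    by (rule det_def') simp
  also have "\<dots> = (\<Sum>p | p permutes {1..m}. of_int (sign p) * (\<Prod>i\<in>{1..m}. f i (p i)))"
  proof (rule sum.reindex_bij_witness[where i = "map_permutation {1..m} (\<lambda>i. i - 1)" and j = "map_permutation {0..<m} Suc"])
    fix q assume "q \<in> {q. q permutes {0..<m}}"
    then have q: "q permutes {0..<m}" by simp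
    show "map_permutation {0..<m} Suc q \<in> {p. p permutes {1..m}}" using perm[OF q] by simp
    show "map_permutation {1..m} (\<lambda>i. i - 1) (map_permutation {0..<m} Suc q) = q"
      by (rule map_permutation_compose_inv[OF bij q]) auto
    have app: "map_permutation {0..<m} Suc q (Suc i) = Suc (q i)" if "i \<in> {0..<m}" for i
      by (rule map_permutation_apply) (use that in auto)
    have "(\<Prod>i\<in>{1..m}. f i (map_permutation {0..<m} Suc q i)) = (\<Prod>i\<in>{0..<m}. f (Suc i) (map_permutation {0..<m} Suc q (Suc i)))"
      unfolding img[symmetric] by (subst prod.reindex) (simp_all add: comp_def)
    also have "\<dots> = (\<Prod>i = 0..<m. mat m m (\<lambda>(i, j). f (Suc i) (Suc j)) $$ (i, q i))"
      by (intro prod.cong refl) (use app permutes_in_image[OF q] in auto)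
    finally have "(\<Prod>i\<in>{1..m}. f i (map_permutation {0..<m} Suc q i)) = (\<Prod>i = 0..<m. mat m m (\<lambda>(i, j). f (Suc i) (Suc j)) $$ (i, q i))" .
    moreover have "sign (map_permutation {0..<m} Suc q) = sign q"
      by (rule sign_map_permutation) (use q in auto)
    ultimately show "of_int (sign (map_permutation {0..<m} Suc q)) * (\<Prod>i\<in>{1..m}. f i (map_permutation {0..<m} Suc q i))
       = signof q * (\<Prod>i = 0..<m. mat m m (\<lambda>(i, j). f (Suc i) (Suc j)) $$ (i, q i))"
      by (simp add: sign_def)
  next
    fix p assume "p \<in> {p. p permutes {1..m}}"
    then have p: "p permutes {1..m}" by simp
    show "map_permutation {1..m} (\<lambda>i. i - 1) p \<in> {q. q permutes {0..<m}}" using perm'[OF p] by simp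
    show "map_permutation {0..<m} Suc (map_permutation {1..m} (\<lambda>i. i - 1) p) = p"
      by (rule map_permutation_compose_inv[OF bij' p]) auto
  qed
  finally show ?thesis by simp
qed

lemma sum_permutes_lessThan:
  fixes f :: "nat \<Rightarrow> nat \<Rightarrow> 'a::comm_ring_1"
  shows "(\<Sum>p | p permutes {..<m}. of_int (sign p) * (\<Prod>i\<in>{..<m}. f i (p i))) = det (mat m m (\<lambda>(i, j). f i j))"
proof -
  have "det (mat m m (\<lambda>(i, j). f i j)) = (\<Sum>q | q permutes {0..<m}. signof q * (\<Prod>i = 0..<m. mat m m (\<lambda>(i, j). f i j) $$ (i, q i)))"
    by (rule det_def') simp
  also have "\<dots> = (\<Sum>p | p permutes {0..<m}. of_int (sign p) * (\<Prod>i\<in>{0..<m}. f i (p i)))"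
  proof (rule sum.cong[OF refl])
    fix q assume "q \<in> {q. q permutes {0..<m}}"
    then have q: "q permutes {0..<m}" by simp
    have "(\<Prod>i = 0..<m. mat m m (\<lambda>(i, j). f i j) $$ (i, q i)) = (\<Prod>i\<in>{0..<m}. f i (q i))"
      by (intro prod.cong refl) (use permutes_in_image[OF q] in auto)
    then show "signof q * (\<Prod>i = 0..<m. mat m m (\<lambda>(i, j). f i j) $$ (i, q i)) = of_int (sign q) * (\<Prod>i\<in>{0..<m}. f i (q i))"
      by (simp add: sign_def)
  qed
  finally show ?thesis by (simp add: lessThan_atLeast0)
qed

text \<open>Moves a determinant over a ring with carrier into a ring given by a type class, where
  matrix algebra applies.\<close>

lemma (in cring) hom_ring_det:
  fixes g :: "'a \<Rightarrow> 'd::comm_ring_1"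
  assumes add: "\<And>x y. x \<in> carrier R \<Longrightarrow> y \<in> carrier R \<Longrightarrow> g (x \<oplus> y) = g x + g y"
    and mult: "\<And>x y. x \<in> carrier R \<Longrightarrow> y \<in> carrier R \<Longrightarrow> g (x \<otimes> y) = g x * g y"
    and one: "g \<one> = 1" and fin: "finite I"
    and M: "\<And>i j. i \<in> I \<Longrightarrow> j \<in> I \<Longrightarrow> M i j \<in> carrier R"
  shows "ring_det R I M \<in> carrier R"
    and "g (ring_det R I M) = (\<Sum>p | p permutes I. of_int (sign p) * (\<Prod>i\<in>I. g (M i (p i))))"
proof -
  have zero: "g \<zero> = 0" using add[of \<zero> \<zero>] by simp
  have neg: "g (\<ominus> x) = - g x" if "x \<in> carrier R" for x
    using add[of x "\<ominus> x"] that zero by (simp add: r_neg eq_neg_iff_add_eq_0 add.commute)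
  have fs: "g (\<Oplus>x\<in>A. h x) = (\<Sum>x\<in>A. g (h x))" if "h \<in> A \<rightarrow> carrier R" for A and h :: "'c \<Rightarrow> 'a"
    using that
  proof (induction A rule: infinite_finite_induct)
    case (insert x A)
    then show ?case by (subst finsum_insert) (auto simp: add intro!: finsum_closed)
  qed (simp_all add: zero finsum_infinite)
  have fp: "g (\<Otimes>x\<in>A. h x) = (\<Prod>x\<in>A. g (h x))" if "h \<in> A \<rightarrow> carrier R" for A and h :: "'c \<Rightarrow> 'a"
    using that
  proof (induction A rule: infinite_finite_induct)
    case (insert x A)
    then show ?case by (subst finprod_insert) (auto simp: mult intro!: finprod_closed)
  qed (simp_all add: one finprod_infinite)
  have sg: "[sign p] \<cdot> x \<in> carrier R \<and> g ([sign p] \<cdot> x) = of_int (sign p) * g x" if "x \<in> carrier R" for x and p :: "'c \<Rightarrow> 'c"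
    using that by (auto simp: sign_def add.int_pow_neg neg add.int_pow_1)
  have pin: "(\<lambda>i. M i (p i)) \<in> I \<rightarrow> carrier R" if "p permutes I" for p
    using M permutes_in_image[OF that] by auto
  have summand: "(\<lambda>p. [sign p] \<cdot> (\<Otimes>i\<in>I. M i (p i))) \<in> {p. p permutes I} \<rightarrow> carrier R"
    using sg finprod_closed[OF pin] by auto
  then show "ring_det R I M \<in> carrier R" unfolding ring_det_def by (rule finsum_closed)
  show "g (ring_det R I M) = (\<Sum>p | p permutes I. of_int (sign p) * (\<Prod>i\<in>I. g (M i (p i))))"
    unfolding ring_det_def fs[OF summand]
  proof (rule sum.cong[OF refl])
    fix p assume "p \<in> {p. p permutes I}"
    then have p: "p permutes I" by simp
    show "g ([sign p] \<cdot> (\<Otimes>i\<in>I. M i (p i))) = of_int (sign p) * (\<Prod>i\<in>I. g (M i (p i)))"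
      using sg[OF finprod_closed[OF pin[OF p]], of p] by (simp only: fp[OF pin[OF p]])
  qed
qed

context qtorus
begin

abbreviation "Cc \<equiv> C_eps n l \<epsilon>"
abbreviation "CR \<equiv> C_eps_ring n l \<epsilon>"

lemma C_gens_carrier:
  "range (eps_scalar n \<epsilon>) \<union> {z_gen n l \<epsilon> i j | i j. i \<in> {1..n} \<and> j \<in> {1..n}} \<subseteq> carrier SR"
  using eps_scalar_closed z_gen_closed by (auto simp: idx_def)

lemma subring_C: "subring Cc SR"
  unfolding C_eps_def by (rule SR.generate_ring_is_subring[OF C_gens_carrier])

lemma C_closed: "c \<in> Cc \<Longrightarrow> c \<in> carrier SR"
  using subringE(1)[OF subring_C] by blast

lemma eps_scalar_C: "eps_scalar n \<epsilon> c \<in> Cc"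
  unfolding C_eps_def by (rule generate_ring.incl) auto
lemma z_gen_C: "(i, j) \<in> idx \<Longrightarrow> z_gen n l \<epsilon> i j \<in> Cc"
  unfolding C_eps_def by (rule generate_ring.incl) (auto simp: idx_def)

text \<open>Induction on the generation of \<open>C_eps\<close>. Membership in \<open>CT\<close>
  will give linearity of coordinates, and \<open>nonneg_deg\<close> will identify the units; for the
  \<open>z_gen\<close> both come from the homogeneity of \<open>zeta\<close>.\<close>

lemma C_mulop:
  assumes "c \<in> Cc" shows "\<exists>g. Psi c = mulop g \<and> g \<in> CT \<and> nonneg_deg g"
  using assms unfolding C_eps_def
proof (induction rule: generate_ring.induct)
  case one
  show ?case using CT_scalar[of 1] nonneg_deg_scalar[of 1] by (intro exI[of _ 1]) auto
next
  case (incl h)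
  then consider c where "h = eps_scalar n \<epsilon> c" | i j where "h = z_gen n l \<epsilon> i j" "(i, j) \<in> idx"
    by (auto simp: idx_def)
  then show ?case
  proof cases
    case 1
    then show ?thesis using CT_scalar nonneg_deg_scalar by (auto simp: scal_def)
  next
    case 2
    then show ?thesis using zeta_CT zeta_nonneg_deg by (auto simp: Psi_z_gen)
  qed
next
  case (a_inv h)
  then obtain g where g: "Psi h = mulop g" "g \<in> CT" "nonneg_deg g" by blast
  have h: "h \<in> carrier SR" using a_inv(1) C_closed by (simp add: C_eps_def)
  have "Psi (\<ominus>\<^bsub>SR\<^esub> h) = mulop (- g)" using Psi_uminus[OF h] g by (simp add: mulop_uminus)
  moreover have "- g \<in> CT" using g(2) by (simp add: CT_def)
  ultimately show ?case using nonneg_deg_uminus[OF g(3)] by blast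
next
  case (eng_add h h')
  then obtain g g' where g: "Psi h = mulop g" "g \<in> CT" "nonneg_deg g" "Psi h' = mulop g'" "g' \<in> CT" "nonneg_deg g'"
    by blast
  have "h \<in> carrier SR" "h' \<in> carrier SR" using eng_add(1,2) C_closed by (simp_all add: C_eps_def)
  then have "Psi (h \<oplus>\<^bsub>SR\<^esub> h') = mulop (g + g')" using g by (simp add: Psi_add mulop_add)
  then show ?case using g CT_add nonneg_deg_add by blast
next
  case (eng_mult h h')
  then obtain g g' where g: "Psi h = mulop g" "g \<in> CT" "nonneg_deg g" "Psi h' = mulop g'" "g' \<in> CT" "nonneg_deg g'"
    by blast
  have "h \<in> carrier SR" "h' \<in> carrier SR" using eng_mult(1,2) C_closed by (simp_all add: C_eps_def)
  then have "Psi (h \<otimes>\<^bsub>SR\<^esub> h') = mulop (g * g')" using g by (simp add: Psi_mult mulop_mult)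
  then show ?case using g CT_mult nonneg_deg_mult by blast
qed

text \<open>A central element acts by multiplication with a Laurent polynomial, so its value at 1
  recovers that multiplier.\<close>

definition gam :: "'k free_elem set set \<Rightarrow> 'k lau" where "gam c = app (Psi c) 1"

lemma Psi_gam: "c \<in> Cc \<Longrightarrow> Psi c = mulop (gam c)"
  and gam_CT: "c \<in> Cc \<Longrightarrow> gam c \<in> CT" and gam_nonneg_deg: "c \<in> Cc \<Longrightarrow> nonneg_deg (gam c)"
  using C_mulop[of c] by (auto simp: gam_def)

lemma gam_inj: "c \<in> Cc \<Longrightarrow> c' \<in> Cc \<Longrightarrow> gam c = gam c' \<Longrightarrow> c = c'"
  by (rule Psi_inj) (simp_all add: C_closed Psi_gam)

text \<open>Commutativity is read off from the faithful image, where multiplication operators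
  commute.\<close>

lemma cring_C: "cring CR"
proof -
  have "c \<otimes>\<^bsub>SR\<^esub> c' = c' \<otimes>\<^bsub>SR\<^esub> c" if "c \<in> Cc" "c' \<in> Cc" for c c'
    by (rule Psi_inj) (use that in \<open>simp_all add: C_closed Psi_mult Psi_gam mulop_commute\<close>)
  then have "subcring Cc SR" by (intro SR.subcringI subring_C)
  then show ?thesis using SR.subcring_iff[of Cc] C_closed by blast
qed

sublocale CR: cring CR by (rule cring_C)

lemma CR_carrier: "carrier CR = Cc" by simp

lemma gam_add: "c \<in> Cc \<Longrightarrow> c' \<in> Cc \<Longrightarrow> gam (c \<oplus>\<^bsub>CR\<^esub> c') = gam c + gam c'"
  by (simp add: gam_def Psi_add C_closed)
lemma gam_mult: "c \<in> Cc \<Longrightarrow> c' \<in> Cc \<Longrightarrow> gam (c \<otimes>\<^bsub>CR\<^esub> c') = gam c * gam c'"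
  by (simp add: gam_def Psi_mult C_closed) (simp add: Psi_gam)
lemma gam_one: "gam \<one>\<^bsub>CR\<^esub> = 1" by (simp add: gam_def)
lemma gam_zero: "gam \<zero>\<^bsub>CR\<^esub> = 0" by (simp add: gam_def)

lemma gam_finsum: "(\<And>x. x \<in> A \<Longrightarrow> f x \<in> Cc) \<Longrightarrow> gam (\<Oplus>\<^bsub>CR\<^esub>x\<in>A. f x) = (\<Sum>x\<in>A. gam (f x))"
proof (induction A rule: infinite_finite_induct)
  case (insert x A)
  then have "f \<in> A \<rightarrow> carrier CR" "f x \<in> carrier CR" by auto
  moreover from this have "(\<Oplus>\<^bsub>CR\<^esub>x\<in>A. f x) \<in> Cc" using CR.finsum_closed[of f A] by simp
  ultimately show ?case using insert by (subst CR.finsum_insert) (simp_all only: gam_add CR_carrier, simp_all)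
qed (simp_all only: CR.finsum_infinite CR.finsum_empty gam_zero sum.infinite sum.empty not_False_eq_True)

lemma gam_finprod: "(\<And>x. x \<in> A \<Longrightarrow> f x \<in> Cc) \<Longrightarrow> gam (\<Otimes>\<^bsub>CR\<^esub>x\<in>A. f x) = (\<Prod>x\<in>A. gam (f x))"
proof (induction A rule: infinite_finite_induct)
  case (insert x A)
  then have "f \<in> A \<rightarrow> carrier CR" "f x \<in> carrier CR" by auto
  moreover from this have "(\<Otimes>\<^bsub>CR\<^esub>x\<in>A. f x) \<in> Cc" using CR.finprod_closed[of f A] by simp
  ultimately show ?case using insert by (subst CR.finprod_insert) (simp_all only: gam_mult CR_carrier, simp_all)
qed (simp_all only: CR.finprod_infinite CR.finprod_empty gam_one prod.infinite prod.empty not_False_eq_True)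

lemma CR_pow_closed: "c \<in> Cc \<Longrightarrow> c [^]\<^bsub>CR\<^esub> (m::nat) \<in> Cc"
  using CR.nat_pow_closed[of c m] by simp

lemma gam_pow: "c \<in> Cc \<Longrightarrow> gam (c [^]\<^bsub>CR\<^esub> (m::nat)) = gam c ^ m"
  by (induction m) (simp_all only: CR.nat_pow_0 CR.nat_pow_Suc gam_one gam_mult CR_pow_closed power_0 power_Suc2)

lemma gam_eps_scalar: "gam (eps_scalar n \<epsilon> c) = single 0 c"
  by (simp add: gam_def)
lemma gam_z_gen: "(i, j) \<in> idx \<Longrightarrow> gam (z_gen n l \<epsilon> i j) = zeta n i j"
  by (simp add: gam_def Psi_z_gen)

lemma gam_ring_det:
  assumes "finite I" "\<And>i j. i \<in> I \<Longrightarrow> j \<in> I \<Longrightarrow> M i j \<in> Cc"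
  shows "ring_det CR I M \<in> Cc"
    and "gam (ring_det CR I M) = (\<Sum>p | p permutes I. of_int (sign p) * (\<Prod>i\<in>I. gam (M i (p i))))"
  using CR.hom_ring_det[of gam I M] gam_add gam_mult gam_one assms by simp_all

lemma gam_minor:
  assumes I: "I = {a..<a + k}" "I \<subseteq> {1..n}" and J: "J = {b..<b + k}" "J \<subseteq> {1..n}"
  shows "ring_minor CR (z_gen n l \<epsilon>) I J \<in> Cc"
    and "gam (ring_minor CR (z_gen n l \<epsilon>) I J) = det (mat k k (\<lambda>(i, j). zeta n (a + i) (b + j)))"
proof -
  have mem: "(a + i, b + j) \<in> idx" if "i < k" "j < k" for i j
  proof -
    have "a + i \<in> I" "b + j \<in> J" using that I(1) J(1) by auto
    then show ?thesis using I(2) J(2) by (auto simp: idx_def)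
  qed
  let ?M = "\<lambda>i j. z_gen n l \<epsilon> (sorted_list_of_set I ! i) (sorted_list_of_set J ! j)"
  have M: "?M i j = z_gen n l \<epsilon> (a + i) (b + j)" if "i < k" "j < k" for i j
    using that by (simp add: I J)
  have eq: "ring_minor CR (z_gen n l \<epsilon>) I J = ring_det CR {..<k} ?M"
    unfolding ring_minor_def using I by simp
  have MC: "?M i j \<in> Cc" if "i \<in> {..<k}" "j \<in> {..<k}" for i j
    using that M[of i j] mem[of i j] z_gen_C by simp
  show "ring_minor CR (z_gen n l \<epsilon>) I J \<in> Cc"
    unfolding eq by (rule gam_ring_det) (use MC in auto)
  have "gam (ring_minor CR (z_gen n l \<epsilon>) I J) = (\<Sum>p | p permutes {..<k}. of_int (sign p) * (\<Prod>i\<in>{..<k}. gam (?M i (p i))))"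
    unfolding eq by (rule gam_ring_det) (use MC in auto)
  also have "\<dots> = det (mat k k (\<lambda>(i, j). gam (?M i j)))"
    by (rule sum_permutes_lessThan)
  also have "mat k k (\<lambda>(i, j). gam (?M i j)) = mat k k (\<lambda>(i, j). zeta n (a + i) (b + j))"
    by (rule cong_mat) (auto simp: M mem gam_z_gen)
  finally show "gam (ring_minor CR (z_gen n l \<epsilon>) I J) = det (mat k k (\<lambda>(i, j). zeta n (a + i) (b + j)))" .
qed

lemma gam_minor_SW:
  assumes "k \<in> {1..n}"
  shows "ring_minor CR (z_gen n l \<epsilon>) {n - k + 1..n} {1..k} \<in> Cc"
    and "gam (ring_minor CR (z_gen n l \<epsilon>) {n - k + 1..n} {1..k}) = (\<Prod>a<k. tau (n - k + 1 + a, 1 + a))"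
proof -
  have I: "{n - k + 1..n} = {n - k + 1..<n - k + 1 + k}" "{1..k} = {1..<1 + k}" using assms by auto
  have sub: "{n - k + 1..n} \<subseteq> {1..n}" "{1..k} \<subseteq> {1..n}" using assms by auto
  note g = gam_minor[OF I(1) _ I(2)]
  show "ring_minor CR (z_gen n l \<epsilon>) {n - k + 1..n} {1..k} \<in> Cc" using assms by (intro g(1)) auto
  show "gam (ring_minor CR (z_gen n l \<epsilon>) {n - k + 1..n} {1..k}) = (\<Prod>a<k. tau (n - k + 1 + a, 1 + a))"
    using assms g(2)[OF sub] zeta_minor_SW[of k] by simp
qed

lemma gam_minor_NE:
  assumes "k \<in> {1..n}"
  shows "ring_minor CR (z_gen n l \<epsilon>) {1..k} {n - k + 1..n} \<in> Cc"
    and "gam (ring_minor CR (z_gen n l \<epsilon>) {1..k} {n - k + 1..n}) = (\<Prod>a<k. tau (1 + a, n - k + 1 + a))"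
proof -
  have I: "{n - k + 1..n} = {n - k + 1..<n - k + 1 + k}" "{1..k} = {1..<1 + k}" using assms by auto
  have sub: "{n - k + 1..n} \<subseteq> {1..n}" "{1..k} \<subseteq> {1..n}" using assms by auto
  note g = gam_minor[OF I(2) _ I(1)]
  show "ring_minor CR (z_gen n l \<epsilon>) {1..k} {n - k + 1..n} \<in> Cc" using assms by (intro g(1)) auto
  show "gam (ring_minor CR (z_gen n l \<epsilon>) {1..k} {n - k + 1..n}) = (\<Prod>a<k. tau (1 + a, n - k + 1 + a))"
    using assms g(2)[OF sub(2) sub(1)] zeta_minor_NE[of k] by simp
qed

end

section \<open>Bases and the discriminant\<close>

lemma mat_mult_entry:
  "A \<in> carrier_mat m k \<Longrightarrow> B \<in> carrier_mat k r \<Longrightarrow> i < m \<Longrightarrow> j < r \<Longrightarrow>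
    (A * B) $$ (i, j) = (\<Sum>t<k. A $$ (i, t) * B $$ (t, j))"
  by (simp add: scalar_prod_def lessThan_atLeast0)

lemma sum_diag_commute:
  fixes A B :: "'a::comm_ring_1 mat"
  assumes "A \<in> carrier_mat m m" "B \<in> carrier_mat m m"
  shows "(\<Sum>i<m. (A * B) $$ (i, i)) = (\<Sum>i<m. (B * A) $$ (i, i))"
proof -
  have "(\<Sum>i<m. (A * B) $$ (i, i)) = (\<Sum>i<m. \<Sum>t<m. A $$ (i, t) * B $$ (t, i))"
    using assms by (intro sum.cong refl mat_mult_entry) auto
  also have "\<dots> = (\<Sum>t<m. \<Sum>i<m. B $$ (t, i) * A $$ (i, t))"
    by (subst sum.swap) (simp add: mult.commute)
  also have "\<dots> = (\<Sum>t<m. (B * A) $$ (t, t))"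
    using assms by (intro sum.cong refl mat_mult_entry[symmetric]) auto
  finally show ?thesis .
qed

text \<open>The adjugate plays the part of an inverse of \<open>K\<close>; the resulting factor
  \<open>det K\<close> is cancelled in the integral domain.\<close>

lemma sum_diag_conjugate:
  fixes A B K :: "'a::idom mat"
  assumes A: "A \<in> carrier_mat m m" and B: "B \<in> carrier_mat m m" and K: "K \<in> carrier_mat m m"
    and eq: "A * K = K * B" and nz: "det K \<noteq> 0"
  shows "(\<Sum>i<m. A $$ (i, i)) = (\<Sum>i<m. B $$ (i, i))"
proof -
  let ?D = "adj_mat K"
  have D: "?D \<in> carrier_mat m m" by (rule adj_mat(1)[OF K])
  have "A * (K * ?D) = (A * K) * ?D" using A K D by simp
  also have "\<dots> = K * (B * ?D)" using eq A B K D by simp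
  finally have 1: "A * (K * ?D) = K * (B * ?D)" .
  have s1: "A * (K * ?D) = det K \<cdot>\<^sub>m A"
    using A adj_mat(2)[OF K] by (simp add: mult_smult_distrib[OF A one_carrier_mat])
  have s2: "(B * ?D) * K = det K \<cdot>\<^sub>m B"
  proof -
    have "(B * ?D) * K = B * (?D * K)" using B D K by simp
    then show ?thesis using B adj_mat(3)[OF K] by (simp add: mult_smult_distrib[OF B one_carrier_mat])
  qed
  have "det K * (\<Sum>i<m. A $$ (i, i)) = (\<Sum>i<m. (A * (K * ?D)) $$ (i, i))"
    unfolding s1 using A by (simp add: sum_distrib_left)
  also have "\<dots> = (\<Sum>i<m. ((B * ?D) * K) $$ (i, i))"
    unfolding 1 by (rule sum_diag_commute) (use K B D in auto)
  also have "\<dots> = det K * (\<Sum>i<m. B $$ (i, i))"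
    unfolding s2 using B by (simp add: sum_distrib_left)
  finally show ?thesis using nz by simp
qed

context qtorus
begin

lemma xgen_Tspan: "k \<in> idx \<Longrightarrow> xgen k \<in> Tspan idx"
proof -
  assume k: "k \<in> idx"
  have "xgen k - tg k \<in> Tspan idx"
    using xgen_leading[OF k] by (rule Tspan_mono) (auto simp: above_def)
  from Tspan_add[OF this Tspan_tg[OF k]] show ?thesis by simp
qed

lemma xw_Tspan: "set w \<subseteq> idx \<Longrightarrow> xw w \<in> Tspan idx"
  by (induction w) (auto simp: Tspan_1 Tspan_mult xgen_Tspan)

lemma Psi_Tspan: "s \<in> carrier SR \<Longrightarrow> Psi s \<in> Tspan idx"
proof -
  assume "s \<in> carrier SR"
  then obtain W c where W: "W \<subseteq> ordered_words" "Psi s = (\<Sum>w\<in>W. scal (c w) * xw w)"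
    using Psi_span by blast
  have "xw w \<in> Tspan idx" if "w \<in> W" for w
    using that W(1) by (intro xw_Tspan) (auto simp: ordered_words_def)
  then show "Psi s \<in> Tspan idx" unfolding W(2) by (intro Tspan_sum Tspan_scal)
qed

text \<open>Columns hold the coordinates over \<open>CT\<close> in the torus monomials. Families are
  indexed from 1 and matrices from 0, hence \<open>Suc j\<close>.\<close>

definition Kmat :: "(nat \<Rightarrow> 'k free_elem set set) \<Rightarrow> 'k lau mat" where
  "Kmat y = mat NN NN (\<lambda>(i, j). comp (box_nth i) (app (Psi (y (Suc j))) 1))"

lemma Kmat_carrier [simp]: "Kmat y \<in> carrier_mat NN NN"
  by (simp add: Kmat_def)

lemma Kmat_entry: "i < NN \<Longrightarrow> j < NN \<Longrightarrow> Kmat y $$ (i, j) = comp (box_nth i) (app (Psi (y (Suc j))) 1)"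
  by (simp add: Kmat_def)

lemma Psi_combination:
  assumes "\<And>i. i \<in> {1..NN} \<Longrightarrow> c i \<in> Cc" "\<And>i. i \<in> {1..NN} \<Longrightarrow> b i \<in> carrier SR"
  shows "Psi (\<Oplus>\<^bsub>SR\<^esub>i\<in>{1..NN}. c i \<otimes>\<^bsub>SR\<^esub> b i) = (\<Sum>t<NN. mulop (gam (c (Suc t))) * Psi (b (Suc t)))"
proof -
  have "Psi (\<Oplus>\<^bsub>SR\<^esub>i\<in>{1..NN}. c i \<otimes>\<^bsub>SR\<^esub> b i) = (\<Sum>i\<in>{1..NN}. mulop (gam (c i)) * Psi (b i))"
    using assms by (subst Psi_finsum) (auto simp: C_closed Psi_mult Psi_gam intro!: sum.cong)
  then show ?thesis by (simp add: sum.atLeast1_atMost_eq)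
qed

lemma Kmat_combination:
  assumes c: "\<And>i j. i < NN \<Longrightarrow> j < NN \<Longrightarrow> c j (Suc i) \<in> Cc" and b: "\<And>i. i \<in> {1..NN} \<Longrightarrow> b i \<in> carrier SR"
    and x: "\<And>j. j < NN \<Longrightarrow> x (Suc j) = (\<Oplus>\<^bsub>SR\<^esub>i\<in>{1..NN}. c j i \<otimes>\<^bsub>SR\<^esub> b i)"
  shows "Kmat x = Kmat b * mat NN NN (\<lambda>(i, j). gam (c j (Suc i)))" (is "_ = _ * ?P")
proof (rule eq_matI)
  fix i j assume "i < dim_row (Kmat b * ?P)" "j < dim_col (Kmat b * ?P)"
  then have ij: "i < NN" "j < NN" by (simp_all add: Kmat_def)
  have cC: "c j i' \<in> Cc" if "i' \<in> {1..NN}" for i' using c[of "i' - 1" j] that ij by auto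
  have "Kmat x $$ (i, j) = comp (box_nth i) (app (\<Sum>t<NN. mulop (gam (c j (Suc t))) * Psi (b (Suc t))) 1)"
    using ij x[OF ij(2)] Psi_combination[of "c j" b] cC b by (simp add: Kmat_entry)
  also have "\<dots> = (\<Sum>t<NN. gam (c j (Suc t)) * comp (box_nth i) (app (Psi (b (Suc t))) 1))"
    using cC by (simp add: app_sum_op comp_sum comp_CT_mult gam_CT)
  also have "\<dots> = (Kmat b * ?P) $$ (i, j)"
    using ij by (subst mat_mult_entry[where m = NN and k = NN and r = NN]) (auto simp: Kmat_entry mult.commute)
  finally show "Kmat x $$ (i, j) = (Kmat b * ?P) $$ (i, j)" .
qed (simp_all add: Kmat_def)

lemma basis_coords:
  assumes "is_basis SR Cc NN b" "s \<in> carrier SR"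
  shows "basis_coords SR Cc NN b s \<in> {1..NN} \<rightarrow>\<^sub>E Cc"
    and "s = (\<Oplus>\<^bsub>SR\<^esub>i\<in>{1..NN}. basis_coords SR Cc NN b s i \<otimes>\<^bsub>SR\<^esub> b i)"
proof -
  have "\<exists>!c. c \<in> {1..NN} \<rightarrow>\<^sub>E Cc \<and> s = (\<Oplus>\<^bsub>SR\<^esub>i\<in>{1..NN}. c i \<otimes>\<^bsub>SR\<^esub> b i)"
    using assms by (simp add: is_basis_def)
  from theI'[OF this] show "basis_coords SR Cc NN b s \<in> {1..NN} \<rightarrow>\<^sub>E Cc"
    "s = (\<Oplus>\<^bsub>SR\<^esub>i\<in>{1..NN}. basis_coords SR Cc NN b s i \<otimes>\<^bsub>SR\<^esub> b i)"
    unfolding basis_coords_def by blast+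
qed

lemma basis_closed: "is_basis SR Cc NN b \<Longrightarrow> i \<in> {1..NN} \<Longrightarrow> b i \<in> carrier SR"
  by (auto simp: is_basis_def)

lemma basis_coords_C:
  "is_basis SR Cc NN b \<Longrightarrow> s \<in> carrier SR \<Longrightarrow> i \<in> {1..NN} \<Longrightarrow> basis_coords SR Cc NN b s i \<in> Cc"
  using basis_coords(1) by (rule PiE_mem)

lemma Kmat_basis_coords:
  assumes b: "is_basis SR Cc NN b" and x: "\<And>j. j < NN \<Longrightarrow> x (Suc j) \<in> carrier SR"
  shows "Kmat x = Kmat b * mat NN NN (\<lambda>(i, j). gam (basis_coords SR Cc NN b (x (Suc j)) (Suc i)))"
  by (rule Kmat_combination) (use b x basis_coords(2)[OF b x] basis_coords_C[OF b x] basis_closed[OF b] in auto)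

definition std_basis :: "nat \<Rightarrow> 'k free_elem set set" where
  "std_basis i = cl (mon (expo_word (box_nth (i - 1))))"

lemma expo_word_FA: "mon (expo_word a) \<in> carrier FA"
  using expo_word_ordered[of a] by (intro FA_mon) (auto simp: ordered_words_def)

lemma std_basis_closed: "std_basis i \<in> carrier SR"
  by (simp add: std_basis_def cl_closed expo_word_FA)

lemma Psi_std_basis: "Psi (std_basis (Suc i)) = xw (expo_word (box_nth i))"
  by (simp add: std_basis_def Psi_cl expo_word_FA)

text \<open>Triangularity comes from \<open>comp_xw_expo_word_less\<close> along the increasing
  enumeration. The exact value 1 matters: over \<open>CT\<close>, where each \<open>tau\<close> of a
  torus variable is a unit, a determinant known only up to units would not determine the
  discriminant.\<close>

lemma det_Kmat_std: "det (Kmat std_basis) = 1"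
proof -
  have "det (Kmat std_basis) = (\<Prod>i<NN. case (i, i) of (i, j) \<Rightarrow> comp (box_nth i) (app (Psi (std_basis (Suc j))) 1))"
    unfolding Kmat_def
  proof (rule det_upper_triangular_prod)
    fix i j assume ji: "j < i" "i < NN"
    then have "box_nth j < box_nth i" by (rule box_nth_less)
    moreover have "box_nth j \<in> boxB" "box_nth i \<in> boxB" using box_nth_boxB ji by auto
    ultimately have "comp (box_nth i) (app (xw (expo_word (box_nth j))) 1) = 0" using comp_xw_expo_word_less leD by blast
    then show "(case (i, j) of (i, j) \<Rightarrow> comp (box_nth i) (app (Psi (std_basis (Suc j))) 1)) = 0"
      by (simp add: Psi_std_basis)
  qed
  then show ?thesis by (simp add: Psi_std_basis comp_xw_expo_word_diag box_nth_boxB)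
qed

section \<open>Ordered monomials with small exponents form a basis\<close>

definition CV :: "'k lau set" where "CV = gam ` Cc"

lemma CV_mult: "g \<in> CV \<Longrightarrow> h \<in> CV \<Longrightarrow> g * h \<in> CV"
  unfolding CV_def using CR.m_closed by (auto simp flip: gam_mult)
lemma CV_add: "g \<in> CV \<Longrightarrow> h \<in> CV \<Longrightarrow> g + h \<in> CV"
  unfolding CV_def using CR.a_closed by (auto simp flip: gam_add)
lemma CV_scalar: "single 0 c \<in> CV"
  unfolding CV_def using eps_scalar_C gam_eps_scalar by (metis imageI)
lemma CV_zeta: "k \<in> idx \<Longrightarrow> zeta n (fst k) (snd k) \<in> CV"
  unfolding CV_def using z_gen_C gam_z_gen by (metis imageI prod.collapse)
lemma CV_0: "0 \<in> CV" and CV_1: "1 \<in> CV"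
  using CV_scalar[of 0] CV_scalar[of 1] by simp_all
lemma CV_power: "g \<in> CV \<Longrightarrow> g ^ m \<in> CV"
  by (induction m) (auto simp: CV_1 CV_mult)
lemma CV_CT: "g \<in> CV \<Longrightarrow> g \<in> CT"
  unfolding CV_def using gam_CT by auto

text \<open>Each exponent is split by division by \<open>l\<close>: the \<open>l\<close>-th powers
  are central multipliers and can be collected in front.\<close>

lemma xw_reduce:
  assumes "w \<in> ordered_words"
  shows "\<exists>g\<in>CV. \<exists>b\<in>boxB. xw w = mulop g * xw (expo_word b)"
proof -
  let ?a = "word_content w"
  have keys: "keys ?a \<subseteq> idx" using assms by (simp add: keys_word_content ordered_words_def)
  have "word_content (expo_word ?a) = ?a" by (rule word_content_expo_word[OF keys]) (simp add: lookup_word_content)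
  then have w: "w = expo_word ?a" using word_content_inj[of w "expo_word ?a"] assms expo_word_ordered[of ?a] by (simp add: ordered_words_def)
  define f where "f k = nat (lookup ?a k)" for k
  have fb: "nat (lookup (emod ?a) k) = f k mod l" if "k \<in> idx" for k
    using that by (simp add: lookup_emod f_def lookup_word_content zmod_int[symmetric])
  have step: "\<exists>g\<in>CV. prod_list (map (\<lambda>k. xgen k ^ f k) ks) = mulop g * prod_list (map (\<lambda>k. xgen k ^ (f k mod l)) ks)"
    if "set ks \<subseteq> idx" for ks
    using that
  proof (induction ks)
    case Nil
    then show ?case using CV_1 by (intro bexI[of _ 1]) auto
  next
    case (Cons k ks)
    then obtain g where g: "g \<in> CV" "prod_list (map (\<lambda>k. xgen k ^ f k) ks) = mulop g * prod_list (map (\<lambda>k. xgen k ^ (f k mod l)) ks)"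
      by auto
    have k: "k \<in> idx" using Cons by simp
    have "xgen k ^ f k = (xgen k ^ l) ^ (f k div l) * xgen k ^ (f k mod l)"
      by (simp flip: power_mult power_add)
    also have "xgen k ^ l = mulop (zeta n (fst k) (snd k))"
      using xg_power_l[of "fst k" n "snd k"] k by (auto simp: xgen_def idx_def)
    finally have p: "xgen k ^ f k = mulop (zeta n (fst k) (snd k) ^ (f k div l)) * xgen k ^ (f k mod l)"
      by (simp add: mulop_power)
    have "xgen k ^ m \<in> Tspan idx" for m
      by (induction m) (auto simp: Tspan_1 Tspan_mult xgen_Tspan k)
    from Tspan_mulop_CT[OF this CV_CT[OF g(1)]]
    have c0: "xgen k ^ (f k mod l) * mulop g = mulop g * xgen k ^ (f k mod l)" .
    have c: "xgen k ^ (f k mod l) * (mulop g * z) = mulop g * (xgen k ^ (f k mod l) * z)" for z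
      by (simp only: mult.assoc[symmetric] c0)
    have "prod_list (map (\<lambda>k. xgen k ^ f k) (k # ks)) = mulop (zeta n (fst k) (snd k) ^ (f k div l) * g) *
      prod_list (map (\<lambda>k. xgen k ^ (f k mod l)) (k # ks))"
      by (simp only: list.map prod_list.Cons p g(2) mult.assoc c mulop_mult)
    then show ?case using CV_mult[OF CV_power[OF CV_zeta[OF k]] g(1)] by blast
  qed
  obtain g where g: "g \<in> CV" "prod_list (map (\<lambda>k. xgen k ^ f k) (sorted_list_of_set idx))
      = mulop g * prod_list (map (\<lambda>k. xgen k ^ (f k mod l)) (sorted_list_of_set idx))"
    using step[of "sorted_list_of_set idx"] by auto
  have m: "map (\<lambda>k. xgen k ^ nat (lookup (emod ?a) k)) (sorted_list_of_set idx)
      = map (\<lambda>k. xgen k ^ (f k mod l)) (sorted_list_of_set idx)"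
    by (rule map_cong[OF refl]) (simp add: fb)
  have "xw (expo_word ?a) = mulop g * xw (expo_word (emod ?a))"
    unfolding xw_expo_word m using g(2) by (simp only: f_def)
  then have "xw w = mulop g * xw (expo_word (emod ?a))" by (simp only: w[symmetric])
  then show ?thesis using g(1) emod_boxB by blast
qed

definition representable :: "'k linop \<Rightarrow> bool" where
  "representable f \<longleftrightarrow> (\<exists>g. (\<forall>b\<in>boxB. g b \<in> CV) \<and> f = (\<Sum>b\<in>boxB. mulop (g b) * xw (expo_word b)))"

lemma representable_0: "representable 0"
  unfolding representable_def by (rule exI[of _ "\<lambda>_. 0"]) (simp add: CV_0)

lemma representable_add:
  assumes "representable f" "representable h" shows "representable (f + h)"
proof -
  from assms(1) obtain g where g: "\<forall>b\<in>boxB. g b \<in> CV" "f = (\<Sum>b\<in>boxB. mulop (g b) * xw (expo_word b))"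
    unfolding representable_def by (elim exE conjE)
  from assms(2) obtain g' where g': "\<forall>b\<in>boxB. g' b \<in> CV" "h = (\<Sum>b\<in>boxB. mulop (g' b) * xw (expo_word b))"
    unfolding representable_def by (elim exE conjE)
  show ?thesis
    unfolding representable_def
  proof (intro exI[of _ "\<lambda>b. g b + g' b"] conjI ballI)
    show "g b + g' b \<in> CV" if "b \<in> boxB" for b using that g(1) g'(1) by (intro CV_add) auto
    show "f + h = (\<Sum>b\<in>boxB. mulop (g b + g' b) * xw (expo_word b))"
      by (simp only: g(2) g'(2) mulop_add distrib_right sum.distrib)
  qed
qed

lemma representable_sum:
  "(\<And>x. x \<in> A \<Longrightarrow> representable (f x)) \<Longrightarrow> representable (\<Sum>x\<in>A. f x)"
  by (induction A rule: infinite_finite_induct) (simp_all add: representable_0 representable_add)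

lemma representable_Psi:
  assumes "s \<in> carrier SR" shows "representable (Psi s)"
proof -
  obtain W c where W: "finite W" "W \<subseteq> ordered_words" "Psi s = (\<Sum>w\<in>W. scal (c w) * xw w)"
    using Psi_span[OF assms] by (elim exE conjE)
  have "representable (scal (c w) * xw w)" if w: "w \<in> W" for w
  proof -
    obtain g b where gb: "g \<in> CV" "b \<in> boxB" "xw w = mulop g * xw (expo_word b)"
      using xw_reduce[OF subsetD[OF W(2) w]] by (elim bexE)
    let ?g = "\<lambda>b'. if b' = b then single 0 (c w) * g else 0"
    have "(\<Sum>b'\<in>boxB. mulop (?g b') * xw (expo_word b')) = (\<Sum>b'\<in>boxB. if b' = b then scal (c w) * xw w else 0)"
      by (intro sum.cong refl) (auto simp: gb(3) mulop_mult scal_def mult.assoc)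
    also have "\<dots> = scal (c w) * xw w" using gb(2) by simp
    finally show ?thesis unfolding representable_def
      by (intro exI[of _ ?g]) (auto simp: CV_0 CV_mult CV_scalar gb(1))
  qed
  then show ?thesis unfolding W(3) by (rule representable_sum)
qed

text \<open>Spanning comes from \<open>representable_Psi\<close>. For uniqueness, the difference of
  two coordinate vectors lies in the kernel of \<open>Kmat std_basis\<close>, whose determinant is
  1.\<close>

lemma is_basis_std: "is_basis SR Cc NN std_basis"
  unfolding is_basis_def
proof (intro conjI ballI)
  show "std_basis \<in> {1..NN} \<rightarrow> carrier SR" by (simp add: std_basis_closed)
  fix s assume s: "s \<in> carrier SR"
  show "\<exists>!c. c \<in> {1..NN} \<rightarrow>\<^sub>E Cc \<and> s = (\<Oplus>\<^bsub>SR\<^esub>i\<in>{1..NN}. c i \<otimes>\<^bsub>SR\<^esub> std_basis i)"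
  proof (rule ex_ex1I)
    obtain g where g: "\<forall>b\<in>boxB. g b \<in> CV" "Psi s = (\<Sum>b\<in>boxB. mulop (g b) * xw (expo_word b))"
      using representable_Psi[OF s] by (auto simp: representable_def)
    have "\<exists>c\<in>Cc. gam c = g (box_nth i)" if "i < NN" for i
      using g(1) box_nth_boxB[OF that] by (force simp: CV_def)
    then obtain c where c: "\<And>i. i < NN \<Longrightarrow> c i \<in> Cc" "\<And>i. i < NN \<Longrightarrow> gam (c i) = g (box_nth i)" by metis
    define d where "d = (\<lambda>i\<in>{1..NN}. c (i - 1))"
    have d: "d \<in> {1..NN} \<rightarrow>\<^sub>E Cc" unfolding d_def using c(1) by (intro restrict_PiE_iff[THEN iffD2] ballI) auto
    have dC: "d i \<in> Cc" if "i \<in> {1..NN}" for i using d that by (rule PiE_mem)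
    have "Psi (\<Oplus>\<^bsub>SR\<^esub>i\<in>{1..NN}. d i \<otimes>\<^bsub>SR\<^esub> std_basis i) = (\<Sum>t<NN. mulop (gam (d (Suc t))) * Psi (std_basis (Suc t)))"
      by (rule Psi_combination) (simp_all only: dC std_basis_closed)
    also have "\<dots> = (\<Sum>t<NN. mulop (g (box_nth t)) * xw (expo_word (box_nth t)))"
      by (intro sum.cong refl) (simp add: d_def c Psi_std_basis)
    also have "\<dots> = Psi s" unfolding g(2) by (rule sum_boxB_box_nth[symmetric])
    finally have "s = (\<Oplus>\<^bsub>SR\<^esub>i\<in>{1..NN}. d i \<otimes>\<^bsub>SR\<^esub> std_basis i)"
      using s dC by (intro Psi_inj) (auto intro!: SR.finsum_closed simp: C_closed std_basis_closed)
    then show "\<exists>c. c \<in> {1..NN} \<rightarrow>\<^sub>E Cc \<and> s = (\<Oplus>\<^bsub>SR\<^esub>i\<in>{1..NN}. c i \<otimes>\<^bsub>SR\<^esub> std_basis i)"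
      using d by blast
  next
    fix c d
    assume c: "c \<in> {1..NN} \<rightarrow>\<^sub>E Cc \<and> s = (\<Oplus>\<^bsub>SR\<^esub>i\<in>{1..NN}. c i \<otimes>\<^bsub>SR\<^esub> std_basis i)"
      and d: "d \<in> {1..NN} \<rightarrow>\<^sub>E Cc \<and> s = (\<Oplus>\<^bsub>SR\<^esub>i\<in>{1..NN}. d i \<otimes>\<^bsub>SR\<^esub> std_basis i)"
    have cC: "c i \<in> Cc" "d i \<in> Cc" if "i \<in> {1..NN}" for i using c d that by (auto dest: PiE_mem)
    define v where "v = vec NN (\<lambda>t. gam (c (Suc t)) - gam (d (Suc t)))"
    have "Kmat std_basis *\<^sub>v v = 0\<^sub>v NN"
    proof (rule eq_vecI)
      fix i assume "i < dim_vec (0\<^sub>v NN :: 'k lau vec)"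
      then have i: "i < NN" by simp
      have e: "comp (box_nth i) (app (Psi s) 1) = (\<Sum>t<NN. gam (c' (Suc t)) * comp (box_nth i) (app (Psi (std_basis (Suc t))) 1))"
        if "\<And>i. i \<in> {1..NN} \<Longrightarrow> c' i \<in> Cc" "s = (\<Oplus>\<^bsub>SR\<^esub>i\<in>{1..NN}. c' i \<otimes>\<^bsub>SR\<^esub> std_basis i)" for c'
      proof -
        have "Psi s = (\<Sum>t<NN. mulop (gam (c' (Suc t))) * Psi (std_basis (Suc t)))"
          using Psi_combination[of c' std_basis] that std_basis_closed by simp
        then show ?thesis using that(1) by (simp add: app_sum_op comp_sum comp_CT_mult gam_CT)
      qed
      have "(Kmat std_basis *\<^sub>v v) $ i = (\<Sum>t<NN. comp (box_nth i) (app (Psi (std_basis (Suc t))) 1) * (gam (c (Suc t)) - gam (d (Suc t))))"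
        using i by (simp add: v_def scalar_prod_def Kmat_def lessThan_atLeast0)
      also have "\<dots> = (\<Sum>t<NN. gam (c (Suc t)) * comp (box_nth i) (app (Psi (std_basis (Suc t))) 1))
          - (\<Sum>t<NN. gam (d (Suc t)) * comp (box_nth i) (app (Psi (std_basis (Suc t))) 1))"
        unfolding sum_subtractf[symmetric] by (intro sum.cong refl) (simp add: algebra_simps)
      also have "\<dots> = 0"
        using e[OF cC(1) c[THEN conjunct2]] e[OF cC(2) d[THEN conjunct2]] by (metis diff_self)
      finally show "(Kmat std_basis *\<^sub>v v) $ i = 0\<^sub>v NN $ i" using i by simp
    qed (simp add: Kmat_def)
    moreover have "v \<in> carrier_vec NN" by (simp add: v_def)
    moreover have "det (Kmat std_basis) \<noteq> 0" by (simp add: det_Kmat_std)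
    ultimately have "v = 0\<^sub>v NN"
      using det_0_iff_vec_prod_zero[OF Kmat_carrier, of std_basis] by blast
    then have v0: "v $ t = 0" if "t < NN" for t using that by simp
    have "gam (c (Suc t)) = gam (d (Suc t))" if "t < NN" for t
      using v0[OF that] that unfolding v_def by simp
    then have "c (Suc t) = d (Suc t)" if "t < NN" for t
      using that cC by (intro gam_inj) auto
    then have cd: "c i = d i" if "i \<in> {1..NN}" for i
      using that by (cases i) auto
    show "c = d" by (rule PiE_ext[OF conjunct1[OF c] conjunct1[OF d] cd])
  qed
qed

section \<open>Change of basis, trace and discriminant\<close>

lemma nonneg_deg_det:
  assumes "\<And>i j. i < m \<Longrightarrow> j < m \<Longrightarrow> nonneg_deg (f (i, j))"
  shows "nonneg_deg (det (mat m m f))"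
proof -
  have sum: "nonneg_deg (\<Sum>x\<in>A. h x)" if "\<And>x. x \<in> A \<Longrightarrow> nonneg_deg (h x)" for A :: "(nat \<Rightarrow> nat) set" and h
    using that nonneg_deg_scalar[of 0] by (induction A rule: infinite_finite_induct) (auto intro: nonneg_deg_add)
  have prod: "nonneg_deg (\<Prod>x\<in>A. h x)" if "\<And>x. x \<in> A \<Longrightarrow> nonneg_deg (h x)" for A :: "nat set" and h
    using that nonneg_deg_scalar[of 1] by (induction A rule: infinite_finite_induct) (auto intro: nonneg_deg_mult)
  have sg: "nonneg_deg (signof p)" for p :: "nat \<Rightarrow> nat"
    using nonneg_deg_scalar[of 1] nonneg_deg_uminus[of 1] by (simp add: sign_def)
  have "det (mat m m f) = (\<Sum>p\<in>{p. p permutes {0..<m}}. signof p * (\<Prod>i = 0..<m. mat m m f $$ (i, p i)))"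
    by (rule det_def') simp
  also have "nonneg_deg \<dots>"
  proof (intro sum nonneg_deg_mult prod sg)
    fix p i assume p: "p \<in> {p. p permutes {0..<m}}" and i: "i \<in> {0..<m}"
    then have "p i < m" using permutes_in_image[of p "{0..<m}" i] by auto
    then show "nonneg_deg (mat m m f $$ (i, p i))" using assms i by simp
  qed
  finally show ?thesis .
qed

text \<open>The transition matrices to and from the standard basis have entries in
  \<open>C_eps\<close>. Their determinants are inverse to each other and satisfy
  \<open>nonneg_deg\<close>, so \<open>nonneg_deg_unit\<close> makes them scalars.\<close>

lemma det_Kmat_basis:
  assumes b: "is_basis SR Cc NN b"
  shows "\<exists>u. u \<noteq> 0 \<and> det (Kmat b) = single 0 u"
proof -
  have bc: "b (Suc j) \<in> carrier SR" if "j < NN" for j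
    using basis_closed[OF b, of "Suc j"] that by simp
  define P where "P = mat NN NN (\<lambda>(i, j). gam (basis_coords SR Cc NN std_basis (b (Suc j)) (Suc i)))"
  define Q where "Q = mat NN NN (\<lambda>(i, j). gam (basis_coords SR Cc NN b (std_basis (Suc j)) (Suc i)))"
  have "Kmat b = Kmat std_basis * P"
    unfolding P_def by (rule Kmat_basis_coords[where x = b, OF is_basis_std bc])
  then have dP: "det (Kmat b) = det P"
    using det_mult[of "Kmat std_basis" NN P] by (simp add: P_def det_Kmat_std)
  have Kstd: "Kmat std_basis = Kmat b * Q"
    unfolding Q_def by (rule Kmat_basis_coords[where x = std_basis, OF b std_basis_closed])
  have "det (Kmat b * Q) = det (Kmat b) * det Q"
    by (rule det_mult[where n = NN]) (simp_all add: Q_def)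
  then have "det P * det Q = 1"
    unfolding Kstd[symmetric] det_Kmat_std dP by simp
  moreover have "nonneg_deg (det P)"
    unfolding P_def
    by (rule nonneg_deg_det) (use basis_coords_C[OF is_basis_std bc] gam_nonneg_deg in auto)
  moreover have "nonneg_deg (det Q)"
    unfolding Q_def
    by (rule nonneg_deg_det) (use basis_coords_C[OF b std_basis_closed] gam_nonneg_deg in auto)
  ultimately show ?thesis unfolding dP by (rule nonneg_deg_unit)
qed

text \<open>Left multiplication has one matrix over \<open>C_eps\<close> in the basis
  \<open>b\<close> and another over \<open>CT\<close> in the torus monomials. \<open>Kmat b\<close>
  intertwines the two, so the trace can be computed in the torus, where \<open>trace_formula\<close>
  applies.\<close>

lemma regular_trace:
  assumes b: "is_basis SR Cc NN b" and s: "s \<in> carrier SR"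
  shows "regular_trace SR Cc NN b s \<in> Cc"
    and "gam (regular_trace SR Cc NN b s) = of_nat NN * comp 0 (app (Psi s) 1)"
proof -
  have bc: "b (Suc j) \<in> carrier SR" if "j < NN" for j
    using basis_closed[OF b, of "Suc j"] that by simp
  have sb: "s \<otimes>\<^bsub>SR\<^esub> b (Suc j) \<in> carrier SR" if "j < NN" for j
    using s bc[OF that] by simp
  have LC: "left_mult_matrix SR Cc NN b s i i \<in> Cc" if "i \<in> {1..NN}" for i
    unfolding left_mult_matrix_def
    by (rule basis_coords_C[OF b _ that]) (use s basis_closed[OF b that] in simp)
  then have "(\<lambda>i. left_mult_matrix SR Cc NN b s i i) \<in> {1..NN} \<rightarrow> carrier CR" by auto
  from CR.finsum_closed[OF this] show "regular_trace SR Cc NN b s \<in> Cc"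
    by (simp add: regular_trace_def)
  define M where "M = mat NN NN (\<lambda>(i, j). gam (left_mult_matrix SR Cc NN b s (Suc i) (Suc j)))"
  define Lam where "Lam = mat NN NN (\<lambda>(i, j). comp (box_nth i) (app (Psi s) (single (box_nth j) 1)))"
  have car: "M \<in> carrier_mat NN NN" "Lam \<in> carrier_mat NN NN" by (simp_all add: M_def Lam_def)
  have "Kmat (\<lambda>j. s \<otimes>\<^bsub>SR\<^esub> b j) = Kmat b * M"
    unfolding M_def left_mult_matrix_def
    by (rule Kmat_basis_coords[where x = "\<lambda>j. s \<otimes>\<^bsub>SR\<^esub> b j", OF b sb])
  moreover have "Kmat (\<lambda>j. s \<otimes>\<^bsub>SR\<^esub> b j) = Lam * Kmat b"
  proof (rule eq_matI)
    fix i j assume "i < dim_row (Lam * Kmat b)" "j < dim_col (Lam * Kmat b)"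
    then have ij: "i < NN" "j < NN" by (simp_all add: Kmat_def Lam_def)
    have "Kmat (\<lambda>j. s \<otimes>\<^bsub>SR\<^esub> b j) $$ (i, j) = comp (box_nth i) (app (Psi s) (app (Psi (b (Suc j))) 1))"
      using ij s bc by (simp add: Kmat_entry Psi_mult)
    also have "\<dots> = (\<Sum>t<NN. comp (box_nth i) (app (Psi s) (single (box_nth t) 1)) * comp (box_nth t) (app (Psi (b (Suc j))) 1))"
      unfolding comp_app[OF Psi_Tspan[OF s] supp_idx_app[OF Psi_Tspan[OF bc[OF ij(2)]] supp_idx_1]]
      by (rule sum_boxB_box_nth)
    also have "\<dots> = (Lam * Kmat b) $$ (i, j)"
      using ij by (subst mat_mult_entry[where m = NN and k = NN and r = NN]) (auto simp: Kmat_entry Lam_def)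
    finally show "Kmat (\<lambda>j. s \<otimes>\<^bsub>SR\<^esub> b j) $$ (i, j) = (Lam * Kmat b) $$ (i, j)" .
  qed (simp_all add: Kmat_def Lam_def)
  ultimately have "Lam * Kmat b = Kmat b * M" by simp
  moreover have "det (Kmat b) \<noteq> 0"
    using det_Kmat_basis[OF b] by (metis lookup_single_eq lookup_zero)
  ultimately have tr: "(\<Sum>i<NN. Lam $$ (i, i)) = (\<Sum>i<NN. M $$ (i, i))"
    using car by (intro sum_diag_conjugate[where K = "Kmat b"]) auto
  have "gam (regular_trace SR Cc NN b s) = (\<Sum>i\<in>{1..NN}. gam (left_mult_matrix SR Cc NN b s i i))"
    unfolding regular_trace_def by (rule gam_finsum[OF LC])
  also have "\<dots> = (\<Sum>i<NN. M $$ (i, i))" by (simp add: sum.atLeast1_atMost_eq M_def)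
  also have "\<dots> = (\<Sum>i<NN. comp (box_nth i) (app (Psi s) (single (box_nth i) 1)))"
    unfolding tr[symmetric] by (intro sum.cong refl) (simp add: Lam_def)
  also have "\<dots> = (\<Sum>b\<in>boxB. comp b (app (Psi s) (single b 1)))" by (rule sum_boxB_box_nth[symmetric])
  also have "\<dots> = of_nat NN * comp 0 (app (Psi s) 1)"
    using trace_formula[OF Psi_Tspan[OF s]] by (simp only: card_boxB)
  finally show "gam (regular_trace SR Cc NN b s) = of_nat NN * comp 0 (app (Psi s) 1)" .
qed

text \<open>By \<open>regular_trace\<close> the trace does not depend on \<open>b\<close>, and it is
  bilinear over \<open>CT\<close>, so the matrix of traces is \<open>GramM\<close> transformed by
  the congruence with \<open>Kmat y\<close>.\<close>

lemma discriminant_gam: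
  assumes b: "is_basis SR Cc NN b" and y: "is_basis SR Cc NN y"
  shows "discriminant SR Cc NN b y \<in> Cc"
    and "gam (discriminant SR Cc NN b y) = det (Kmat y) ^ 2 * det GramM"
proof -
  have yc: "y i \<in> carrier SR" if "i \<in> {1..NN}" for i using basis_closed[OF y that] .
  let ?T = "\<lambda>i j. regular_trace SR Cc NN b (y i \<otimes>\<^bsub>SR\<^esub> y j)"
  have TC: "?T i j \<in> Cc" if "i \<in> {1..NN}" "j \<in> {1..NN}" for i j
    using regular_trace(1)[OF b] yc that by simp
  show "discriminant SR Cc NN b y \<in> Cc"
    unfolding discriminant_def by (rule gam_ring_det(1)) (use TC in auto)
  have "gam (discriminant SR Cc NN b y) = (\<Sum>p | p permutes {1..NN}. of_int (sign p) * (\<Prod>i\<in>{1..NN}. gam (?T i (p i))))"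
    unfolding discriminant_def by (rule gam_ring_det(2)) (use TC in auto)
  also have "\<dots> = det (mat NN NN (\<lambda>(i, j). gam (?T (Suc i) (Suc j))))"
    by (rule sum_permutes_Suc)
  also have "mat NN NN (\<lambda>(i, j). gam (?T (Suc i) (Suc j))) = transpose_mat (Kmat y) * (GramM * Kmat y)"
  proof (rule eq_matI)
    fix i j assume "i < dim_row (transpose_mat (Kmat y) * (GramM * Kmat y))" "j < dim_col (transpose_mat (Kmat y) * (GramM * Kmat y))"
    then have ij: "i < NN" "j < NN" by (simp_all add: Kmat_def)
    have ys: "y (Suc i) \<in> carrier SR" "y (Suc j) \<in> carrier SR" using yc ij by simp_all
    let ?k = "\<lambda>i a. comp a (app (Psi (y (Suc i))) 1)"
    have "gam (?T (Suc i) (Suc j)) = of_nat NN * comp 0 (app (Psi (y (Suc i)) * Psi (y (Suc j))) 1)"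
      using regular_trace(2)[OF b, of "y (Suc i) \<otimes>\<^bsub>SR\<^esub> y (Suc j)"] ys by (simp only: SR.m_closed Psi_mult)
    also have "\<dots> = of_nat NN * (\<Sum>a\<in>boxB. \<Sum>b\<in>boxB. ?k i a * (Gram a b * ?k j b))"
      using comp_0_mult[OF Psi_Tspan[OF ys(1)] Psi_Tspan[OF ys(2)]] by simp
    also have "\<dots> = (\<Sum>s<NN. ?k i (box_nth s) * (\<Sum>t<NN. of_nat NN * Gram (box_nth s) (box_nth t) * ?k j (box_nth t)))"
      unfolding sum_boxB_box_nth sum_distrib_left by (intro sum.cong refl) (simp only: mult.assoc mult.left_commute)
    also have "\<dots> = (\<Sum>s<NN. transpose_mat (Kmat y) $$ (i, s) * (GramM * Kmat y) $$ (s, j))"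
    proof (rule sum.cong[OF refl])
      fix s assume s: "s \<in> {..<NN}"
      have "(GramM * Kmat y) $$ (s, j) = (\<Sum>t<NN. of_nat NN * Gram (box_nth s) (box_nth t) * ?k j (box_nth t))"
        using ij s by (subst mat_mult_entry[where m = NN and k = NN and r = NN]) (auto simp: Kmat_entry GramM_def)
      then show "?k i (box_nth s) * (\<Sum>t<NN. of_nat NN * Gram (box_nth s) (box_nth t) * ?k j (box_nth t)) = transpose_mat (Kmat y) $$ (i, s) * (GramM * Kmat y) $$ (s, j)"
        using ij s by (simp only: lessThan_iff) (simp add: Kmat_def)
    qed
    also have "\<dots> = (transpose_mat (Kmat y) * (GramM * Kmat y)) $$ (i, j)"
      by (rule mat_mult_entry[symmetric, where m = NN and k = NN and r = NN])
        (use ij in \<open>auto simp: GramM_def intro!: mult_carrier_mat[where n = NN]\<close>)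
    finally show "mat NN NN (\<lambda>(i, j). gam (?T (Suc i) (Suc j))) $$ (i, j) = (transpose_mat (Kmat y) * (GramM * Kmat y)) $$ (i, j)"
      using ij by simp
  qed (simp_all add: Kmat_def)
  also have "det (transpose_mat (Kmat y) * (GramM * Kmat y)) = det (Kmat y) ^ 2 * det GramM"
  proof -
    have G: "GramM \<in> carrier_mat NN NN" by (simp add: GramM_def)
    have "det (transpose_mat (Kmat y) * (GramM * Kmat y)) = det (transpose_mat (Kmat y)) * (det GramM * det (Kmat y))"
      using det_mult[OF _ mult_carrier_mat[OF G Kmat_carrier], of "transpose_mat (Kmat y)" y] det_mult[OF G Kmat_carrier, of y]
      by simp
    then show ?thesis using det_transpose[OF Kmat_carrier, of y] by (simp add: power2_eq_square algebra_simps)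
  qed
  finally show "gam (discriminant SR Cc NN b y) = det (Kmat y) ^ 2 * det GramM" .
qed

text \<open>Under \<open>gam\<close> the product of all corner minors becomes the product of all
  \<open>tau\<close>, by \<open>prod_idx_diagonals\<close>, which is the base of the power in
  \<open>det_GramM\<close>. Injectivity of \<open>gam\<close> carries the identity back to
  \<open>C_eps\<close>.\<close>

lemma discriminant_eq:
  fixes \<Delta> L
  defines "\<Delta> \<equiv> ring_minor CR (z_gen n l \<epsilon>)" and "L \<equiv> l ^ (n ^ 2 - 1) * (l - 1)"
  assumes b: "is_basis SR Cc NN b" and y: "is_basis SR Cc NN y"
  shows "\<exists>u. u \<noteq> 0 \<and> discriminant SR Cc NN b y = eps_scalar n \<epsilon> u \<otimes>\<^bsub>CR\<^esub>
      ((\<Otimes>\<^bsub>CR\<^esub>k\<in>{1..n}. \<Delta> {n - k + 1..n} {1..k} [^]\<^bsub>CR\<^esub> L) \<otimes>\<^bsub>CR\<^esub>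
       (\<Otimes>\<^bsub>CR\<^esub>j\<in>{1..n - 1}. \<Delta> {1..j} {n - j + 1..n} [^]\<^bsub>CR\<^esub> L))"
proof -
  obtain v where v: "v \<noteq> 0" "det (Kmat y) = single 0 v" using det_Kmat_basis[OF y] by blast
  obtain c where c: "c \<noteq> 0" "det GramM = single 0 c * (\<Prod>k\<in>idx. tau k) ^ L"
    using det_GramM unfolding L_def by blast
  let ?S = "\<Otimes>\<^bsub>CR\<^esub>k\<in>{1..n}. \<Delta> {n - k + 1..n} {1..k} [^]\<^bsub>CR\<^esub> L"
  let ?N = "\<Otimes>\<^bsub>CR\<^esub>j\<in>{1..n - 1}. \<Delta> {1..j} {n - j + 1..n} [^]\<^bsub>CR\<^esub> L"
  have SC: "\<Delta> {n - k + 1..n} {1..k} [^]\<^bsub>CR\<^esub> L \<in> Cc" if "k \<in> {1..n}" for k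
    unfolding \<Delta>_def by (rule CR_pow_closed[OF gam_minor_SW(1)[OF that]])
  have NC: "\<Delta> {1..j} {n - j + 1..n} [^]\<^bsub>CR\<^esub> L \<in> Cc" if "j \<in> {1..n - 1}" for j
    unfolding \<Delta>_def by (rule CR_pow_closed[OF gam_minor_NE(1)]) (use that in auto)
  have S: "?S \<in> Cc" using CR.finprod_closed[of _ "{1..n}"] SC by (simp add: Pi_iff)
  have N: "?N \<in> Cc" using CR.finprod_closed[of _ "{1..n - 1}"] NC by (simp add: Pi_iff)
  have SN: "?S \<otimes>\<^bsub>CR\<^esub> ?N \<in> Cc" using CR.m_closed[of ?S ?N] S N by (simp only: CR_carrier)
  have gS: "gam ?S = (\<Prod>k\<in>{1..n}. (\<Prod>a<k. tau (n - k + 1 + a, 1 + a)) ^ L)"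
  proof -
    have "gam ?S = (\<Prod>k\<in>{1..n}. gam (\<Delta> {n - k + 1..n} {1..k} [^]\<^bsub>CR\<^esub> L))"
      by (rule gam_finprod) (rule SC)
    also have "\<dots> = (\<Prod>k\<in>{1..n}. (\<Prod>a<k. tau (n - k + 1 + a, 1 + a)) ^ L)"
      by (intro prod.cong refl) (simp only: \<Delta>_def gam_pow gam_minor_SW)
    finally show ?thesis .
  qed
  have gN: "gam ?N = (\<Prod>j\<in>{1..n - 1}. (\<Prod>a<j. tau (1 + a, n - j + 1 + a)) ^ L)"
  proof -
    have "gam ?N = (\<Prod>j\<in>{1..n - 1}. gam (\<Delta> {1..j} {n - j + 1..n} [^]\<^bsub>CR\<^esub> L))"
      by (rule gam_finprod) (rule NC)
    also have "\<dots> = (\<Prod>j\<in>{1..n - 1}. (\<Prod>a<j. tau (1 + a, n - j + 1 + a)) ^ L)"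
    proof (intro prod.cong refl)
      fix j assume "j \<in> {1..n - 1}"
      then have "j \<in> {1..n}" by auto
      then show "gam (\<Delta> {1..j} {n - j + 1..n} [^]\<^bsub>CR\<^esub> L) = (\<Prod>a<j. tau (1 + a, n - j + 1 + a)) ^ L"
        by (simp only: \<Delta>_def gam_pow gam_minor_NE)
    qed
    finally show ?thesis .
  qed
  have gSN: "gam (?S \<otimes>\<^bsub>CR\<^esub> ?N) = (\<Prod>k\<in>idx. tau k) ^ L"
    unfolding gam_mult[OF S N] gS gN prod_idx_diagonals[of tau, symmetric] power_mult_distrib prod_power_distrib ..
  \<comment> \<open>\<open>v\<close> enters squared through the congruence, and \<open>c\<close> is
    the constant of the Gram determinant.\<close>
  let ?u = "v ^ 2 * c"
  have e: "eps_scalar n \<epsilon> ?u \<otimes>\<^bsub>CR\<^esub> (?S \<otimes>\<^bsub>CR\<^esub> ?N) \<in> Cc"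
    using CR.m_closed[of "eps_scalar n \<epsilon> ?u" "?S \<otimes>\<^bsub>CR\<^esub> ?N"] eps_scalar_C SN by (simp only: CR_carrier)
  have "gam (discriminant SR Cc NN b y) = gam (eps_scalar n \<epsilon> ?u \<otimes>\<^bsub>CR\<^esub> (?S \<otimes>\<^bsub>CR\<^esub> ?N))"
    unfolding discriminant_gam(2)[OF b y] gam_mult[OF eps_scalar_C SN] gSN gam_eps_scalar c(2) v(2)
    by (simp add: power2_eq_square mult_single mult.assoc[symmetric])
  then have "discriminant SR Cc NN b y = eps_scalar n \<epsilon> ?u \<otimes>\<^bsub>CR\<^esub> (?S \<otimes>\<^bsub>CR\<^esub> ?N)"
    by (rule gam_inj[OF discriminant_gam(1)[OF b y] e])
  then show ?thesis using v c by (intro exI[of _ ?u]) simp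
qed

end

theorem theoremB:
  fixes \<epsilon> :: "'k :: field_char_0" and l n :: nat
  assumes "l > 2" and "odd l"
    and "\<epsilon> ^ l = 1" and "\<And>k. 0 < k \<Longrightarrow> k < l \<Longrightarrow> \<epsilon> ^ k \<noteq> 1"
    and "n > 0"
  defines "S \<equiv> R_eps n \<epsilon>" and "C \<equiv> C_eps n l \<epsilon>" and "A \<equiv> C_eps_ring n l \<epsilon>"
    and "\<Delta> \<equiv> ring_minor (C_eps_ring n l \<epsilon>) (z_gen n l \<epsilon>)"
    and "N \<equiv> l ^ (n ^ 2)" and "L \<equiv> l ^ (n ^ 2 - 1) * (l - 1)"
  shows "(\<exists>y. is_basis S C N y) \<and>
    (\<forall>b y. is_basis S C N b \<longrightarrow> is_basis S C N y \<longrightarrow>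
      (\<exists>u :: 'k. u \<noteq> 0 \<and>
        discriminant S C N b y =
          eps_scalar n \<epsilon> u \<otimes>\<^bsub>A\<^esub>
            ((\<Otimes>\<^bsub>A\<^esub>k \<in> {1..n}. \<Delta> {n - k + 1..n} {1..k} [^]\<^bsub>A\<^esub> L) \<otimes>\<^bsub>A\<^esub>
             (\<Otimes>\<^bsub>A\<^esub>j \<in> {1..n - 1}. \<Delta> {1..j} {n - j + 1..n} [^]\<^bsub>A\<^esub> L))))"
proof -
  interpret qtorus n l \<epsilon>
    by unfold_locales (use assms(1-5) in auto)
  show ?thesis
    unfolding S_def C_def A_def \<Delta>_def N_def L_def
    using is_basis_std discriminant_eq by blast
qed

end
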